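(* Let $X_1,X_2,\dots$ be i.i.d. random variables with $\mathbf E X_1=0$ and $\mathbf E X_1^2\in(0,\infty)$, and let $S_0=0$, $S_n=X_1+\dots+X_n$. For $x\ge0$ let $\tau_x=\inf\{n\ge1: x+S_n\le0\}$. Assume that $S_n$ is left-continuous, i.e. $\mathbf P(X_1\in\{-1,0,1,2,\dots\})=1$, and that $\mathbf E|X_1|^{r+3}$ is finite for some integer $r\ge0$. Then there exist polynomials $V_1(x),V_2(x),\dots,V_{\lfloor r/2\rfloor+1}(x)$ (every $V_k$ is of degree $2k-1$) such that $$\mathbf P(\tau_x>n)=\sum_{j=1}^{\lfloor r/2\rfloor+1}V_j(x)a_n^{(j)}+O\left(\frac{1+x^{r+2}}{n^{(r+2)/2}}\right),\qquad n\to\infty,$$ uniformly in $x\ge0$.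
   Context: For integers $j\ge1$, $n\ge0$: $a_n^{(j)}:=[s^n](1-s)^{j-3/2}=(-1)^n\binom{j-3/2}{n}$, where $[s^n]f(s)$ is the coefficient of $s^n$ in the power series $f$.
   Formalization: Proved for integers x ≥ 1 only (the claim fails at x = 0 and at non-integer x, where τ_x = τ_{⌈x⌉}); for r ≥ 2 it is also assumed that X_1 is not concentrated on a residue class c + dℤ with d ≥ 2 (the claim fails for such walks, e.g. steps ±1). *)

theory Defs
  imports
    "HOL-Probability.Probability"
    "HOL-Library.Extended_Nat"
    "HOL-Computational_Algebra.Formal_Power_Series"
    "HOL-Computational_Algebra.Polynomial"
begin

definition walk :: "(nat \<Rightarrow> 'a \<Rightarrow> real) \<Rightarrow> nat \<Rightarrow> 'a \<Rightarrow> real" where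
  "walk X n \<omega> = (\<Sum>i=1..n. X i \<omega>)"

text \<open>The infimum of the empty set is \<open>\<infinity>\<close>: the walk never leaves the positive half-line.
  Time \<open>0\<close> is excluded.\<close>

definition tau :: "(nat \<Rightarrow> 'a \<Rightarrow> real) \<Rightarrow> real \<Rightarrow> 'a \<Rightarrow> enat" where
  "tau X x \<omega> = Inf {enat n | n. n \<ge> 1 \<and> x + walk X n \<omega> \<le> 0}"

text \<open>\<open>fps_binomial c\<close> is the series \<open>(1 + s) ^ c\<close>, so the series below is
  \<open>(1 - s) ^ (j - 3/2)\<close>.\<close>

definition acoeff :: "nat \<Rightarrow> nat \<Rightarrow> real" where
  "acoeff j n = fps_nth (fps_binomial (real j - 3/2) oo (- fps_X)) n"

lemma acoeff_gchoose: "acoeff j n = (-1) ^ n * ((real j - 3/2) gchoose n)"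
proof -
  have "- fps_X = fps_const (-1 :: real) * fps_X"
    by (simp flip: fps_const_neg)
  then have "fps_binomial (real j - 3/2) oo (- fps_X) =
      Abs_fps (\<lambda>n. (-1) ^ n * fps_nth (fps_binomial (real j - 3/2)) n)"
    by (simp only: fps_compose_linear)
  then show ?thesis
    unfolding acoeff_def by simp
qed

text \<open>The law of \<open>Y\<close> is not concentrated on any residue class \<open>c + d \<int>\<close> with \<open>d \<ge> 2\<close>
  (maximal span one). The simple walk with steps \<open>\<plusminus>1\<close> violates this with
  \<open>c = 1\<close>, \<open>d = 2\<close>.\<close>

definition span_one :: "'a measure \<Rightarrow> ('a \<Rightarrow> real) \<Rightarrow> bool" where
  "span_one M Y \<longleftrightarrow>
     (\<forall>c d :: int. d \<ge> 2 \<longrightarrow>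
        measure M {\<omega> \<in> space M. \<exists>k::int. Y \<omega> = of_int (c + d * k)} \<noteq> 1)"

end

theory Submission
  imports Defs "HOL-Library.Landau_Symbols"
begin

text \<open>
  For a left-continuous walk, Kemperman's formula gives \<open>P(\<tau>\<^sub>x = k) = x / k * P(S\<^sub>k = - x)\<close>, and the walk
  is recurrent, so \<open>P(\<tau>\<^sub>x > n)\<close> is the sum of these probabilities over \<open>k > n\<close>. By Fourier inversion
  \<open>P(S\<^sub>k = - x)\<close> is, up to the periodicity \<open>d\<close> of the walk, the integral of
  \<open>exp (i t x / d) \<phi>(t) ^ k / (2 \<pi>)\<close> over \<open>[-\<pi>, \<pi>]\<close>. The exponential is expanded to order \<open>r\<close> in \<open>t x\<close>,
  and \<open>\<phi>(t)\<close> is compared with \<open>exp (- a t\<^sup>2) (1 + R(t))\<close>, where \<open>R(t) = O(t\<^sup>3)\<close> is a polynomial. This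
  expands \<open>P(S\<^sub>k = - x)\<close> in half-integer powers of \<open>k\<close> with coefficients polynomial in \<open>x\<close>. The return
  probabilities of the lazy simple walk are exactly \<open>acoeff 1 k\<close>; applied to that walk, the same
  expansion allows to trade half-integer powers of \<open>k\<close> for the numbers \<open>acoeff j k\<close>, whose tail sums
  telescope because \<open>acoeff (j + 1) k = acoeff j k - acoeff j (k - 1)\<close>.
\<close>

section \<open>First passage probabilities of a skip-free walk\<close>

text \<open>Steps are stored as \<open>m = X + 1\<close>, so a path is a list of naturals, and for
  \<open>x \<le> k\<close> the event S_k = -x has probability
  \<open>fps_nth (Abs_fps p ^ k) (k - x)\<close>.

  The degree of V_j is read off the Fourier integral. The factor (t x)^q integrates to order
  k^(-(q+1)/2), so after multiplication by x/k the power x^(q+1) meets only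
  \<open>acoeff (j + 1) k\<close> with 2 j \<ge> q + 2; this bounds the degree by 2 j - 1. For q = 2
  j - 2 the leading term is, up to sign, an even Gaussian moment, hence nonzero, and the degree is
  attained.

  The obstacle is periodicity. If the span d exceeds 1, the walk from x reaches 0 only at times
  congruent to x modulo d, and the tail sum of \<open>acoeff 2\<close> along a residue class is
  shown to be its 1/d share only up to order n^(-3/2). This lies within the error for r \<le> 1; for
  r \<ge> 2 the walk is assumed to have span one, and all tail sums telescope exactly.\<close>

fun first_hit :: "nat \<Rightarrow> nat list \<Rightarrow> bool" where
  "first_hit x [] \<longleftrightarrow> x = 0"
| "first_hit x (m # w) \<longleftrightarrow> x > 0 \<and> first_hit (x + m - 1) w"

lemma first_hit_sum_list: "first_hit x w \<Longrightarrow> x + sum_list w = length w"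
proof (induction w arbitrary: x)
  case (Cons m w)
  then have "x + m - 1 + sum_list w = length w" "x > 0" by auto
  then show ?case by simp
qed simp

definition hit_words :: "nat \<Rightarrow> nat \<Rightarrow> nat list set" where
  "hit_words n x = {w. length w = n \<and> first_hit x w}"

lemma finite_hit_words: "finite (hit_words n x)"
proof (rule finite_subset)
  show "hit_words n x \<subseteq> {w. set w \<subseteq> {..n} \<and> length w = n}"
    unfolding hit_words_def using first_hit_sum_list member_le_sum_list by fastforce
qed (rule finite_lists_length_eq, simp)

lemma hit_words_0: "hit_words 0 x = (if x = 0 then {[]} else {})"
  unfolding hit_words_def by auto

lemma hit_words_Suc_0: "hit_words (Suc n) 0 = {}"
  unfolding hit_words_def by (auto simp: length_Suc_conv)

lemma hit_words_empty: "n < x \<Longrightarrow> hit_words n x = {}"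
  unfolding hit_words_def using first_hit_sum_list by fastforce

text \<open>The cut-off \<open>M\<close> is left free: larger letters lead to levels that cannot be
  left in time, and sums with different cut-offs have to be compared in the recurrence
  proof.\<close>

lemma hit_words_Suc:
  assumes "x > 0" "M \<ge> Suc n"
  shows "hit_words (Suc n) x = (\<Union>m\<le>M. (#) m ` hit_words n (x + m - 1))"
proof -
  have "m \<le> M" if "length w = n" "first_hit (x + m - 1) w" for m w
    using first_hit_sum_list[OF that(2)] that(1) assms by auto
  then show ?thesis
    using assms(1) unfolding hit_words_def by (fastforce simp: length_Suc_conv image_iff)
qed

text \<open>For a probability vector \<open>p\<close> this is the probability that the walk from
  \<open>x\<close> reaches 0 first at time \<open>n\<close>. Being a finite sum over words, it can
  be studied without a probability space.\<close>

definition hit :: "(nat \<Rightarrow> real) \<Rightarrow> nat \<Rightarrow> nat \<Rightarrow> real" where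
  "hit p n x = (\<Sum>w\<in>hit_words n x. prod_list (map p w))"

lemma hit_0: "hit p 0 x = (if x = 0 then 1 else 0)"
  by (simp add: hit_def hit_words_0)

lemma hit_Suc_0 [simp]: "hit p (Suc n) 0 = 0"
  by (simp add: hit_def hit_words_Suc_0)

lemma hit_eq_0: "n < x \<Longrightarrow> hit p n x = 0"
  by (simp add: hit_def hit_words_empty)

lemma hit_Suc:
  assumes "x > 0" "M \<ge> Suc n"
  shows "hit p (Suc n) x = (\<Sum>m\<le>M. p m * hit p n (x + m - 1))"
proof -
  have "hit p (Suc n) x = (\<Sum>m\<le>M. \<Sum>w\<in>(#) m ` hit_words n (x + m - 1). prod_list (map p w))"
    unfolding hit_def hit_words_Suc[OF assms]
    by (rule sum.UNION_disjoint) (auto simp: finite_hit_words)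
  also have "\<dots> = (\<Sum>m\<le>M. \<Sum>w\<in>hit_words n (x + m - 1). p m * prod_list (map p w))"
    by (rule sum.cong[OF refl], subst sum.reindex) auto
  finally show ?thesis by (simp add: hit_def sum_distrib_left)
qed

lemma hit_nonneg: "(\<And>m. p m \<ge> 0) \<Longrightarrow> hit p n x \<ge> 0"
  unfolding hit_def by (intro sum_nonneg prod_list_nonneg) auto

text \<open>Kemperman's formula. The induction step uses \<open>X f' f ^ n = X (f ^ (n + 1))' / (n + 1)\<close>,
  the exchangeability of the steps.\<close>

lemma hit_eq_fps_power:
  assumes "n > 0" "x \<le> n"
  shows "hit p n x = real x / real n * fps_nth (Abs_fps p ^ n) (n - x)"
  using assms
proof (induction n arbitrary: x)
  case (Suc n)
  let ?f = "Abs_fps p"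
  show ?case
  proof (cases "x = 0")
    case False
    define N where "N = Suc n - x"
    show ?thesis
    proof (cases "n = 0")
      case True
      then have "x = 1" using False Suc.prems by simp
      then show ?thesis using True
        by (subst hit_Suc[where M=1]) (auto simp: hit_0)
    next
      case n: False
      have N: "real N = 1 + real n - real x" using Suc.prems by (simp add: N_def of_nat_diff)
      have "hit p (Suc n) x = (\<Sum>m\<le>Suc n. p m * hit p n (x + m - 1))"
        using False by (intro hit_Suc) auto
      \<comment> \<open>For \<open>m > N\<close> the level \<open>x + m - 1\<close> exceeds the
        remaining \<open>n\<close> steps.\<close>
      also have "\<dots> = (\<Sum>m\<le>N. p m * hit p n (x + m - 1))"
        using False Suc.prems by (intro sum.mono_neutral_right) (auto simp: N_def intro!: hit_eq_0)
      also have "\<dots> = (\<Sum>m\<le>N. p m * ((real x + real m - 1) / real n * fps_nth (?f ^ n) (N - m)))"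
      proof (intro sum.cong refl)
        fix m assume m: "m \<in> {..N}"
        have "n - (x + m - 1) = N - m" "x + m - 1 \<le> n"
          using m False Suc.prems by (auto simp: N_def)
        moreover have "real (x + m - 1) = real x + real m - 1" using False by (simp add: of_nat_diff)
        ultimately show "p m * hit p n (x + m - 1) =
            p m * ((real x + real m - 1) / real n * fps_nth (?f ^ n) (N - m))"
          using Suc.IH[of "x + m - 1"] n by simp
      qed
      also have "\<dots> = ((real x - 1) * (\<Sum>m\<le>N. p m * fps_nth (?f ^ n) (N - m))
          + (\<Sum>m\<le>N. real m * p m * fps_nth (?f ^ n) (N - m))) / real n"
        by (simp add: sum_distrib_left sum_divide_distrib add_divide_distrib algebra_simps
            flip: sum.distrib)
      also have "(\<Sum>m\<le>N. p m * fps_nth (?f ^ n) (N - m)) = fps_nth (?f ^ Suc n) N"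
        by (simp add: fps_mult_nth atLeast0AtMost)
      also have "(\<Sum>m\<le>N. real m * p m * fps_nth (?f ^ n) (N - m)) =
          fps_nth (fps_X * fps_deriv ?f * ?f ^ n) N"
        unfolding fps_mult_nth[of "fps_X * fps_deriv ?f"] atLeast0AtMost
        by (intro sum.cong refl) (auto simp: fps_X_mult_nth simp del: of_nat_Suc)
      also have "fps_X * fps_deriv ?f * ?f ^ n =
          fps_const (1 / real (Suc n)) * (fps_X * fps_deriv (?f ^ Suc n))"
      proof -
        have "fps_const (1 / real (Suc n)) * fps_const (real (Suc n)) = 1"
          by (simp del: of_nat_Suc)
        then have "fps_X * fps_deriv ?f * ?f ^ n =
            (fps_const (1 / real (Suc n)) * fps_const (real (Suc n))) * (fps_X * fps_deriv ?f * ?f ^ n)"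
          by simp
        then show ?thesis
          unfolding fps_deriv_power by (simp only: mult_ac diff_Suc_1)
      qed
      also have "fps_nth \<dots> N = real N / real (Suc n) * fps_nth (?f ^ Suc n) N"
        by (simp add: fps_X_mult_nth del: power_Suc of_nat_Suc)
      also have "((real x - 1) * fps_nth (?f ^ Suc n) N + real N / real (Suc n) * fps_nth (?f ^ Suc n) N) / real n
          = real x / real (Suc n) * fps_nth (?f ^ Suc n) N"
      proof -
        have "((x' - 1) * G + (1 + k - x') / (1 + k) * G) / k = x' / (1 + k) * G"
          if "k > 0" for k x' G :: real
        proof -
          have "1 + k \<noteq> 0" using that by simp
          then have "(x' - 1) * G + (1 + k - x') / (1 + k) * G = k * (x' / (1 + k) * G)"
            by (simp add: divide_simps) (simp add: algebra_simps)
          then show ?thesis using that by simp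
        qed
        then show ?thesis unfolding N using n by simp
      qed
      finally show ?thesis unfolding N_def .
    qed
  qed simp
qed simp

section \<open>Recurrence of a centred skip-free walk (\<open>p\<close> is the law of the step plus
  one, hence mean one)\<close>

locale skip_free_law =
  fixes p :: "nat \<Rightarrow> real"
  assumes p_nonneg: "p m \<ge> 0"
    and p_sums: "p sums 1"
    and mean_sums: "(\<lambda>m. real m * p m) sums 1"
    and p_0: "p 0 > 0"
begin

lemma sum_p_le: "(\<Sum>m\<in>A. p m) \<le> 1" if "finite A"
  using sum_le_suminf[OF sums_summable[OF p_sums] that] p_nonneg sums_unique[OF p_sums] by auto

lemma sum_hit_Suc:
  assumes "x > 0" "M \<ge> Suc n"
  shows "(\<Sum>k\<le>Suc n. hit p k x) = (\<Sum>m\<le>M. p m * (\<Sum>k\<le>n. hit p k (x + m - 1)))"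
proof -
  have "(\<Sum>k\<le>Suc n. hit p k x) = (\<Sum>k\<le>n. hit p (Suc k) x)"
    using assms by (subst sum.atMost_Suc_shift) (simp add: hit_0)
  also have "\<dots> = (\<Sum>k\<le>n. \<Sum>m\<le>M. p m * hit p k (x + m - 1))"
    using assms by (intro sum.cong hit_Suc) auto
  finally show ?thesis by (subst (asm) sum.swap) (simp add: sum_distrib_left)
qed

lemma sum_hit_le: "(\<Sum>k\<le>n. hit p k x) \<le> 1"
proof (induction n arbitrary: x)
  case (Suc n)
  show ?case
  proof (cases "x = 0")
    case True
    then show ?thesis by (subst sum.atMost_Suc_shift) (simp add: hit_0)
  next
    case False
    then have "(\<Sum>k\<le>Suc n. hit p k x) = (\<Sum>m\<le>Suc n. p m * (\<Sum>k\<le>n. hit p k (x + m - 1)))"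
      by (intro sum_hit_Suc) auto
    also have "\<dots> \<le> (\<Sum>m\<le>Suc n. p m * 1)"
      by (intro sum_mono mult_left_mono Suc.IH p_nonneg)
    also have "\<dots> \<le> 1" using sum_p_le[of "{..Suc n}"] by simp
    finally show ?thesis .
  qed
qed (simp add: hit_0)

lemma summable_hit: "summable (\<lambda>k. hit p k x)"
  using sum_hit_le hit_nonneg[OF p_nonneg] by (intro bounded_imp_summable) auto

text \<open>First-step decomposition in the limit. One inequality with a finite cut-off is all that
  the maximum principle uses, and it avoids interchanging the limits in \<open>n\<close> and
  \<open>M\<close>.\<close>

lemma suminf_hit_superharmonic:
  assumes "x > 0"
  shows "(\<Sum>m\<le>M. p m * (\<Sum>k. hit p k (x + m - 1))) \<le> (\<Sum>k. hit p k x)"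
proof (rule LIMSEQ_le)
  show "(\<lambda>n. \<Sum>m\<le>M. p m * (\<Sum>k\<le>n. hit p k (x + m - 1)))
      \<longlonglongrightarrow> (\<Sum>m\<le>M. p m * (\<Sum>k. hit p k (x + m - 1)))"
    by (intro tendsto_intros summable_LIMSEQ' summable_hit)
  show "(\<lambda>n. \<Sum>k\<le>Suc n. hit p k x) \<longlonglongrightarrow> (\<Sum>k. hit p k x)"
    by (intro LIMSEQ_Suc summable_LIMSEQ' summable_hit)
  have "(\<Sum>m\<le>M. p m * (\<Sum>k\<le>n. hit p k (x + m - 1))) \<le> (\<Sum>k\<le>Suc n. hit p k x)" for n
  proof -
    have "(\<Sum>m\<le>M. p m * (\<Sum>k\<le>n. hit p k (x + m - 1)))
        \<le> (\<Sum>m\<le>max M (Suc n). p m * (\<Sum>k\<le>n. hit p k (x + m - 1)))"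
      by (intro sum_mono2) (auto intro!: mult_nonneg_nonneg sum_nonneg p_nonneg hit_nonneg)
    then show ?thesis using sum_hit_Suc[OF assms, of n "max M (Suc n)"] by simp
  qed
  then show "\<exists>N. \<forall>n\<ge>N. (\<Sum>m\<le>M. p m * (\<Sum>k\<le>n. hit p k (x + m - 1))) \<le> (\<Sum>k\<le>Suc n. hit p k x)"
    by blast
qed

text \<open>Recurrence, by the maximum principle: for each \<open>\<epsilon> > 0\<close> the function
  \<open>P (\<tau>\<^sub>x = \<infinity>) - \<epsilon> x\<close> is subharmonic on \<open>x \<ge> 1\<close>, vanishes at \<open>0\<close> and is eventually negative,
  so it has no positive maximum.\<close>

lemma suminf_hit: "(\<Sum>k. hit p k x) = 1"
proof -
  define L where "L x = (\<Sum>k. hit p k x)" for x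
  have L_le: "L x \<le> 1" for x
    unfolding L_def by (intro suminf_le_const summable_hit) (metis sum_hit_le lessThan_Suc_atMost less_Suc_eq_le
      sum.lessThan_Suc add_increasing2 hit_nonneg p_nonneg order_trans le_add_same_cancel1)
  have L_nonneg: "L x \<ge> 0" for x
    unfolding L_def by (intro suminf_nonneg summable_hit hit_nonneg p_nonneg)
  have L_0: "L 0 = 1"
  proof -
    have "(\<lambda>k. hit p k 0) = (\<lambda>k. if k = 0 then 1 else 0)"
      by (metis hit_0 hit_Suc_0 not0_implies_Suc)
    then show ?thesis unfolding L_def using sums_unique[OF sums_single[of 0 "\<lambda>_. 1::real"]] by simp
  qed
  have "1 - L x \<le> e * real x" if e: "e > 0" for e
  proof (rule ccontr)
    define W where "W y = 1 - L y - e * real y" for y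
    assume "\<not> 1 - L x \<le> e * real x"
    then have Wx: "W x > 0" by (simp add: W_def)
    define N where "N = nat \<lceil>1 / e\<rceil>"
    have W_big: "W y \<le> 0" if "y > N" for y
    proof -
      have "1 / e \<le> real y" using that unfolding N_def by linarith
      then have "1 \<le> e * real y" using e by (simp add: field_simps)
      then show ?thesis using L_nonneg[of y] by (simp add: W_def)
    qed
    define B where "B = Max (W ` {..N})"
    have B_ge: "W y \<le> B" if "y \<le> N" for y using that by (auto simp: B_def)
    have "x \<le> N" using W_big Wx by (meson not_le)
    then have B_pos: "B > 0" using B_ge[of x] Wx by simp
    have B_ge': "W y \<le> B" for y using B_ge W_big[of y] B_pos by (cases "y \<le> N") auto
    have "B \<in> W ` {..N}" unfolding B_def by (intro Max_in) auto
    then have ex: "\<exists>y. W y = B" by auto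
    \<comment> \<open>With the least maximiser, the left neighbour \<open>y - 1\<close> lies
      strictly below the maximum. Since the downward step has weight \<open>p 0 > 0\<close>,
      averaging over one step loses a fixed positive amount.\<close>
    define y where "y = (LEAST y. W y = B)"
    have Wy: "W y = B" unfolding y_def using ex by (rule LeastI_ex)
    have y_min: "W z \<noteq> B" if "z < y" for z using that not_less_Least unfolding y_def by blast
    have y_pos: "y > 0" using Wy B_pos L_0 by (cases y) (auto simp: W_def)
    have W1: "W (y - 1) < B" using B_ge'[of "y-1"] y_min[of "y-1"] y_pos by fastforce
    have bound: "(\<Sum>m\<le>M. p m * (1 - e * (real y + real m - 1) - L (y + m - 1))) \<le> B - p 0 * (B - W (y - 1))" for M
    proof -
      have "(\<Sum>m\<le>M. p m * (1 - e * (real y + real m - 1) - L (y + m - 1))) = (\<Sum>m\<le>M. p m * W (y + m - 1))"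
        using y_pos by (intro sum.cong) (auto simp: W_def of_nat_diff)
      also have "\<dots> \<le> (\<Sum>m\<le>M. p m * B - (if m = 0 then p 0 * (B - W (y - 1)) else 0))"
        using p_nonneg B_ge' by (intro sum_mono) (auto simp: right_diff_distrib intro!: mult_left_mono)
      also have "\<dots> = (\<Sum>m\<le>M. p m) * B - p 0 * (B - W (y - 1))"
        by (simp add: sum_subtractf sum_distrib_right)
      also have "\<dots> \<le> 1 * B - p 0 * (B - W (y - 1))"
        using B_pos sum_p_le[of "{..M}"] by (intro diff_right_mono mult_right_mono) auto
      finally show ?thesis by simp
    qed
    \<comment> \<open>Mean one makes the affine part harmonic: the limit is
      \<open>1 - e * real y\<close>.\<close>
    have "(\<lambda>M. \<Sum>m\<le>M. p m * (1 - e * (real y + real m - 1))) \<longlonglongrightarrow> (1 - e * (real y - 1)) * 1 - e * 1"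
    proof -
      have "(\<lambda>m. (1 - e * (real y - 1)) * p m - e * (real m * p m)) sums ((1 - e * (real y - 1)) * 1 - e * 1)"
        by (intro sums_diff sums_mult p_sums mean_sums)
      also have "(\<lambda>m. (1 - e * (real y - 1)) * p m - e * (real m * p m)) = (\<lambda>m. p m * (1 - e * (real y + real m - 1)))"
        by (auto simp: algebra_simps)
      finally show ?thesis by (simp add: sums_def_le)
    qed
    moreover have "(\<Sum>m\<le>M. p m * (1 - e * (real y + real m - 1))) \<le> B - p 0 * (B - W (y - 1)) + L y" for M
      using bound[of M] suminf_hit_superharmonic[OF y_pos, of M, folded L_def]
      by (simp add: right_diff_distrib sum_subtractf)
    ultimately have "(1 - e * (real y - 1)) * 1 - e * 1 \<le> B - p 0 * (B - W (y - 1)) + L y"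
      by (meson LIMSEQ_le_const2)
    moreover have "p 0 * (B - W (y - 1)) > 0" using W1 p_0 by simp
    ultimately show False using Wy by (simp add: W_def algebra_simps)
  qed
  then have "1 - L x \<le> 0 * real x"
    by (intro tendsto_le[of "at_right (0::real)" "\<lambda>e. e * real x" _ "\<lambda>_. 1 - L x"])
      (auto intro!: tendsto_eq_intros eventually_at_right_less[THEN eventually_mono])
  then show ?thesis using L_le[of x] by (simp add: L_def)
qed

text \<open>Recurrence turns the survival probability into a sum over late hitting times, to which
  asymptotics for large \<open>k\<close> apply term by term.\<close>

lemma sums_hit_tail: "(\<lambda>k. hit p (k + Suc n) x) sums (1 - (\<Sum>k\<le>n. hit p k x))"
  using sums_split_initial_segment[OF summable_sums[OF summable_hit[of x]], of "Suc n"]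
  by (simp add: suminf_hit lessThan_Suc_atMost)

end

section \<open>Expansions of sequences in half-integer powers and in the coefficients\<close>

abbreviation Opow :: "real \<Rightarrow> (nat \<Rightarrow> real) set" where
  "Opow \<alpha> \<equiv> O(\<lambda>k. real k powr - \<alpha>)"

text \<open>Coefficients and number of terms stay existential, and terms smaller than the error are
  allowed, so sums and changes of basis need no bookkeeping. The coefficients that matter are
  identified afterwards from decay rates, by \<open>acoeff_sum_coeff_eq_0\<close>.\<close>

definition expands :: "(nat \<Rightarrow> nat \<Rightarrow> real) \<Rightarrow> real \<Rightarrow> (nat \<Rightarrow> real) \<Rightarrow> bool" where
  "expands e \<rho> f \<longleftrightarrow>
     (\<exists>c M. (\<lambda>k. f k - (\<Sum>j<M. c j * e j k)) \<in> Opow \<rho>)"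

lemma expands_small: "f \<in> Opow \<rho> \<Longrightarrow> expands e \<rho> f"
  unfolding expands_def by (intro exI[of _ "\<lambda>_. 0"] exI[of _ 0]) simp

lemma expands_basis: "expands e \<rho> (e j)"
  unfolding expands_def
proof (intro exI)
  have "(\<Sum>i<Suc j. (if i = j then 1 else 0) * e i k) = e j k" for k
    by (simp add: sum.delta if_distrib[of "\<lambda>x. x * _"] cong: if_cong)
  then show "(\<lambda>k. e j k - (\<Sum>i<Suc j. (if i = j then 1 else 0) * e i k)) \<in> Opow \<rho>"
    by (simp only: diff_self) simp
qed

lemma expands_cmult: "expands e \<rho> f \<Longrightarrow> expands e \<rho> (\<lambda>k. c * f k)"
  unfolding expands_def
proof (elim exE)
  fix d M assume "(\<lambda>k. f k - (\<Sum>j<M. d j * e j k)) \<in> Opow \<rho>"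
  then have "(\<lambda>k. c * (f k - (\<Sum>j<M. d j * e j k))) \<in> Opow \<rho>"
    by (cases "c = 0") auto
  then show "\<exists>d M. (\<lambda>k. c * f k - (\<Sum>j<M. d j * e j k)) \<in> Opow \<rho>"
    by (intro exI[of _ "\<lambda>j. c * d j"] exI[of _ M]) (simp add: right_diff_distrib sum_distrib_left mult.assoc)
qed

lemma expands_add:
  assumes "expands e \<rho> f" "expands e \<rho> g"
  shows "expands e \<rho> (\<lambda>k. f k + g k)"
proof -
  obtain c M d N where
    c: "(\<lambda>k. f k - (\<Sum>j<M. c j * e j k)) \<in> Opow \<rho>" and
    d: "(\<lambda>k. g k - (\<Sum>j<N. d j * e j k)) \<in> Opow \<rho>"
    using assms unfolding expands_def by blast
  define c' d' where "c' j = (if j < M then c j else 0)" and "d' j = (if j < N then d j else 0)" for j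
  have "(\<Sum>j<M. c j * e j k) = (\<Sum>j<max M N. c' j * e j k)"
    "(\<Sum>j<N. d j * e j k) = (\<Sum>j<max M N. d' j * e j k)" for k
    by (intro sum.mono_neutral_cong_left; auto simp: c'_def d'_def)+
  with sum_in_bigo(1)[OF c d] have
    "(\<lambda>k. f k + g k - (\<Sum>j<max M N. (c' j + d' j) * e j k)) \<in> Opow \<rho>"
    by (simp add: algebra_simps sum.distrib)
  then show ?thesis unfolding expands_def by (intro exI[of _ "\<lambda>j. c' j + d' j"] exI[of _ "max M N"])
qed

lemma expands_diff: "expands e \<rho> f \<Longrightarrow> expands e \<rho> g \<Longrightarrow> expands e \<rho> (\<lambda>k. f k - g k)"
  using expands_add[OF _ expands_cmult[of e \<rho> g "-1"]] by simp

lemma expands_sum: "(\<And>i. i \<in> I \<Longrightarrow> expands e \<rho> (f i)) \<Longrightarrow> expands e \<rho> (\<lambda>k. \<Sum>i\<in>I. f i k)"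
proof (induction I rule: infinite_finite_induct)
  case (insert i I)
  then have "expands e \<rho> (\<lambda>k. f i k + (\<Sum>i\<in>I. f i k))" by (intro expands_add) auto
  with insert show ?case by simp
qed (auto intro: expands_small)

lemma expands_cong:
  assumes "\<And>k. k > 0 \<Longrightarrow> f k = g k"
  shows "expands e \<rho> f \<longleftrightarrow> expands e \<rho> g"
proof -
  have "(\<lambda>k. f k - h k) \<in> Opow \<rho> \<longleftrightarrow> (\<lambda>k. g k - h k) \<in> Opow \<rho>" for h
    by (intro landau_o.big.in_cong eventually_mono[OF eventually_gt_at_top[of 0]]) (simp add: assms)
  then show ?thesis unfolding expands_def by simp
qed

lemma expands_trans:
  assumes "expands e \<rho> f" "\<And>j. expands e' \<rho> (e j)"
  shows "expands e' \<rho> f"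
proof -
  obtain c M where "(\<lambda>k. f k - (\<Sum>j<M. c j * e j k)) \<in> Opow \<rho>"
    using assms(1) unfolding expands_def by blast
  then have "expands e' \<rho> (\<lambda>k. (f k - (\<Sum>j<M. c j * e j k)) + (\<Sum>j<M. c j * e j k))"
    by (intro expands_add expands_small expands_sum expands_cmult assms(2))
  then show ?thesis by simp
qed

lemma bigo_powr_mono:
  "f \<in> Opow \<alpha> \<Longrightarrow> \<beta> \<le> \<alpha> \<Longrightarrow> f \<in> Opow \<beta>"
  by (erule landau_o.big_trans, rule bigoI[where c=1])
    (auto intro!: eventually_mono[OF eventually_ge_at_top[of 1]] powr_mono)

lemma bigo_powr_mult:
  assumes "f \<in> O(\<lambda>k::nat. real k powr a)" "g \<in> O(\<lambda>k. real k powr b)" "a + b \<le> c"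
  shows "(\<lambda>k. f k * g k) \<in> O(\<lambda>k. real k powr c)"
proof -
  have "(\<lambda>k. f k * g k) \<in> O(\<lambda>k. real k powr a * real k powr b)"
    using assms by (intro landau_o.big.mult)
  then show ?thesis
    using bigo_powr_mono[of "\<lambda>k. f k * g k" "- (a + b)" "- c"] assms(3)
    by (simp add: powr_add[symmetric] add.commute)
qed

lemma bigo_powr_tendsto_0:
  assumes "f \<in> Opow \<epsilon>" "\<epsilon> > 0"
  shows "f \<longlonglongrightarrow> 0"
proof -
  have "(\<lambda>k. real k powr - \<epsilon>) \<longlonglongrightarrow> 0"
    using assms(2) by (intro tendsto_neg_powr filterlim_real_sequentially) auto
  moreover obtain c where "\<forall>\<^sub>F k in sequentially. norm (f k) \<le> c * norm (real k powr - \<epsilon>)"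
    using assms(1) by (elim landau_o.bigE)
  ultimately show ?thesis
    by (intro Lim_null_comparison[of f "\<lambda>k. c * real k powr - \<epsilon>"])
      (auto intro: tendsto_mult_right_zero)
qed

definition half_powr :: "nat \<Rightarrow> nat \<Rightarrow> real" where
  "half_powr q k = real k powr - (real q + 1/2)"

lemma half_powr_bigo: "\<rho> \<le> real q + 1/2 \<Longrightarrow> half_powr q \<in> Opow \<rho>"
  using bigo_powr_mono[OF landau_o.big_refl, of \<rho> "real q + 1/2"] unfolding half_powr_def by simp

lemma half_powr_Suc: "k > 0 \<Longrightarrow> half_powr (Suc q) k = half_powr q k / real k"
proof -
  assume "k > 0"
  have "- (real (Suc q) + 1/2) = - (real q + 1/2) - 1" by simp
  then show ?thesis unfolding half_powr_def using \<open>k > 0\<close> by (simp only: powr_diff) simp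
qed

lemma half_powr_add: "k > 0 \<Longrightarrow> half_powr (i + q) k = half_powr i k / real k ^ q"
  by (induction q) (simp_all add: half_powr_Suc)

text \<open>\<open>k choose l\<close> is a polynomial of degree \<open>l\<close> in
  \<open>k\<close>, and \<open>l \<le> q\<close> keeps all resulting exponents among those of
  \<open>half_powr\<close>. The induction uses (l+1) (k choose l+1) = (k-l) (k choose l); the factor
  k lowers \<open>q\<close> by one.\<close>

lemma expands_binomial_half_powr:
  "l \<le> q \<Longrightarrow> expands half_powr \<rho> (\<lambda>k. real (k choose l) * half_powr q k)"
proof (induction l arbitrary: q)
  case 0
  then show ?case by (simp add: expands_basis)
next
  case (Suc l)
  then obtain q' where q: "q = Suc q'" "l \<le> q'" by (cases q) auto
  have "expands half_powr \<rho> (\<lambda>k. 1 / real (Suc l) *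
      (real (k choose l) * half_powr q' k - real l * (real (k choose l) * half_powr q k)))"
    using q Suc.prems by (intro expands_cmult expands_diff Suc.IH) auto
  also have "?this \<longleftrightarrow> ?case"
  proof (intro expands_cong)
    fix k :: nat assume k: "k > 0"
    have "real (Suc l) * real (k choose Suc l) = (real k - real l) * real (k choose l)"
      using gbinomial_mult_1[of "real k" l] by (simp add: binomial_gbinomial algebra_simps)
    then have "real (k choose Suc l) = (real k - real l) * real (k choose l) / real (Suc l)"
      by (simp add: field_simps del: of_nat_Suc)
    moreover have "half_powr q' k = real k * half_powr q k" using k by (simp add: q half_powr_Suc)
    ultimately show "1 / real (Suc l) *
        (real (k choose l) * half_powr q' k - real l * (real (k choose l) * half_powr q k)) =
        real (k choose Suc l) * half_powr q k"
      by (simp add: left_diff_distrib right_diff_distrib diff_divide_distrib mult_ac del: of_nat_Suc)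
  qed
  finally show ?case .
qed

section \<open>Arithmetic and asymptotics of the coefficients\<close>

lemma acoeff_Suc_mult: "acoeff (Suc j) k * (real j - 1/2 - real k) = (real j - 1/2) * acoeff j k"
proof -
  have "(real j - 1/2 - real k) * ((real j - 1/2) gchoose k) = (real j - 1/2) * ((real j - 1/2 - 1) gchoose k)"
    by (rule gbinomial_absorb_comp)
  then have "((-1) ^ k * ((real j - 1/2 - real k) * ((real j - 1/2) gchoose k))) =
      ((-1) ^ k * ((real j - 1/2) * ((real j - 3/2) gchoose k)))"
    by (simp add: diff_diff_eq)
  then show ?thesis unfolding acoeff_gchoose by (simp add: mult_ac diff_diff_eq add.commute)
qed

text \<open>Coefficientwise form of multiplying \<open>(1 - s) ^ (j - 3/2)\<close> by
  \<open>1 - s\<close>.\<close>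

lemma acoeff_diff: "acoeff (Suc j) (Suc k) = acoeff j (Suc k) - acoeff j k"
proof -
  have "(real j - 1/2) gchoose Suc k = ((real j - 3/2) gchoose k) + ((real j - 3/2) gchoose Suc k)"
    using gbinomial_Suc_Suc[of "real j - 3/2" k] by simp
  then show ?thesis unfolding acoeff_gchoose by (simp add: algebra_simps)
qed

text \<open>The limit is 1 / Gamma(3/2 - j), which is nonzero because a half-integer is never a pole
  of Gamma; the parity argument below excludes that case.\<close>

lemma acoeff_limit:
  "\<exists>L. L \<noteq> 0 \<and> (\<lambda>k. acoeff j k * real k powr (real j - 1/2)) \<longlonglongrightarrow> L"
proof (intro exI conjI)
  let ?z = "real j - 3/2"
  have "- ?z \<notin> \<int>\<^sub>\<le>\<^sub>0"
  proof
    assume "- ?z \<in> \<int>\<^sub>\<le>\<^sub>0"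
    then obtain n :: nat where "- ?z = - real n" by (auto elim!: nonpos_Ints_cases')
    then have "real (2 * j) = real (2 * n + 3)" by simp
    then have "2 * j = 2 * n + 3" by (simp only: of_nat_eq_iff)
    then show False by presburger
  qed
  then show "inverse (Gamma (- ?z)) \<noteq> 0" by (simp add: Gamma_eq_zero_iff)
  have "(\<lambda>k. (?z gchoose k) / ((-1)^k / exp ((?z+1) * ln (real k)))) \<longlonglongrightarrow> inverse (Gamma (- ?z))"
    using gbinomial_asymptotic[of ?z] by simp
  then show "(\<lambda>k. acoeff j k * real k powr (real j - 1/2)) \<longlonglongrightarrow> inverse (Gamma (- ?z))"
  proof (rule Lim_transform_eventually)
    show "\<forall>\<^sub>F k in sequentially. (?z gchoose k) / ((-1)^k / exp ((?z+1) * ln (real k))) =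
        acoeff j k * real k powr (real j - 1/2)"
      using eventually_gt_at_top[of 0]
    proof eventually_elim
      case (elim k)
      then have "real k powr (real j - 1/2) = exp ((?z+1) * ln (real k))"
        by (simp add: powr_def)
      then show ?case by (cases "even k") (simp_all add: acoeff_gchoose)
    qed
  qed
qed

lemma acoeff_bigo: "acoeff j \<in> Opow (real j - 1/2)"
proof -
  obtain L where "(\<lambda>k. acoeff j k * real k powr (real j - 1/2)) \<longlonglongrightarrow> L"
    using acoeff_limit by blast
  then have "(\<lambda>k. acoeff j k * real k powr (real j - 1/2)) \<in> O(\<lambda>_. 1)"
    by (intro bigoI_tendsto) auto
  from landau_o.big.mult[OF this landau_o.big_refl[of "\<lambda>k. real k powr - (real j - 1/2)"]]
  have "(\<lambda>k. (acoeff j k * real k powr (real j - 1/2)) * real k powr - (real j - 1/2))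
      \<in> Opow (real j - 1/2)"
    by simp
  also have "?this \<longleftrightarrow> ?thesis"
  proof (intro landau_o.big.in_cong eventually_mono[OF eventually_gt_at_top[of 0]])
    fix k :: nat assume "k > 0"
    then have "real k powr (real j - 1/2) * real k powr - (real j - 1/2) = 1"
      by (simp only: powr_add[symmetric]) simp
    then show "acoeff j k * real k powr (real j - 1/2) * real k powr - (real j - 1/2) = acoeff j k"
      by (simp only: mult.assoc mult_1_right)
  qed
  finally show ?thesis .
qed

text \<open>The shift aligns orders: \<open>acs j\<close> decays like \<open>half_powr j\<close>,
  and for \<open>j \<ge> 1\<close> its sum beyond \<open>n\<close> telescopes to
  \<open>- acoeff j n\<close>.\<close>

abbreviation acs :: "nat \<Rightarrow> nat \<Rightarrow> real" where "acs j \<equiv> acoeff (Suc j)"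

lemma inverse_bigo: "(\<lambda>k. inverse (real k)) \<in> Opow 1"
  by (intro bigoI[where c=1] eventually_mono[OF eventually_gt_at_top[of 0]])
    (auto simp: powr_minus)

text \<open>Absorption identity solved for the quotient. The only quotient on the right has the next
  index, so iterating it pushes division by \<open>k\<close> below any prescribed order.\<close>

lemma acoeff_div:
  assumes "k > 0"
  shows "acs j k / real k = acs (Suc j) k / real k - acs (Suc j) k / (real j + 1/2)"
proof -
  have eq: "real (Suc j) - 1/2 = real j + 1/2" by simp
  have "acs (Suc j) k * (real j + 1/2 - real k) = (real j + 1/2) * acs j k"
    using acoeff_Suc_mult[of "Suc j" k] unfolding eq .
  moreover have "real j + 1/2 \<noteq> 0" by linarith
  ultimately have "acs j k = acs (Suc j) k * (real j + 1/2 - real k) / (real j + 1/2)"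
    by (subst nonzero_eq_divide_eq) (auto simp only: mult.commute)
  also have "\<dots> = acs (Suc j) k - real k * (acs (Suc j) k / (real j + 1/2))"
    by (simp add: right_diff_distrib diff_divide_distrib mult.commute)
  finally show ?thesis using assms by (simp add: diff_divide_distrib)
qed

text \<open>Induction towards smaller \<open>q\<close>; the base consists of all indices whose
  sequences are already within the error.\<close>

lemma downward_induct [case_names ge step]:
  assumes "\<And>q::nat. real q \<ge> B \<Longrightarrow> P q" "\<And>q. (\<And>q'. q' > q \<Longrightarrow> P q') \<Longrightarrow> P q"
  shows "P q"
proof (induction "nat \<lceil>B\<rceil> - q" arbitrary: q rule: less_induct)
  case less
  show ?case
  proof (cases "real q \<ge> B")
    case False
    then have "q < nat \<lceil>B\<rceil>" by linarith
    then show ?thesis by (intro assms(2)[OF less.hyps]) auto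
  qed (rule assms(1))
qed

lemma expands_acoeff_div: "expands acs \<rho> (\<lambda>k. acs j k / real k)"
proof (induction j rule: downward_induct[where B="\<rho>"])
  case (ge j)
  have "(\<lambda>k. acs j k * inverse (real k)) \<in> Opow \<rho>"
    using ge by (intro bigo_powr_mult[OF acoeff_bigo inverse_bigo]) auto
  then show ?case by (intro expands_small) (simp add: divide_inverse)
next
  case (step j)
  have "expands acs \<rho> (\<lambda>k. acs (Suc j) k / real k - (1 / (real j + 1/2)) * acs (Suc j) k)"
    by (intro expands_diff expands_cmult expands_basis step) auto
  also have "?this \<longleftrightarrow> ?case" by (intro expands_cong) (simp add: acoeff_div[of _ j])
  finally show ?case .
qed

lemma expands_mono:
  assumes "expands e \<rho>' f" "\<rho> \<le> \<rho>'"
  shows "expands e \<rho> f"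
  using assms(1) bigo_powr_mono[OF _ assms(2)] unfolding expands_def by blast

lemma expands_div:
  assumes "expands acs \<rho> f"
  shows "expands acs (\<rho> + 1) (\<lambda>k. f k / real k)"
proof -
  obtain c M where *: "(\<lambda>k. f k - (\<Sum>j<M. c j * acs j k)) \<in> Opow \<rho>"
    using assms unfolding expands_def by blast
  have "(\<lambda>k. (f k - (\<Sum>j<M. c j * acs j k)) * inverse (real k)) \<in> Opow (\<rho> + 1)"
    by (intro bigo_powr_mult[OF * inverse_bigo]) auto
  then have "expands acs (\<rho> + 1) (\<lambda>k. (f k - (\<Sum>j<M. c j * acs j k)) * inverse (real k) + (\<Sum>j<M. c j * (acs j k / real k)))"
    by (intro expands_add expands_small expands_sum expands_cmult expands_acoeff_div)
  then show ?thesis by (simp add: divide_inverse algebra_simps sum_distrib_left)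
qed

text \<open>Inversion of a triangular system: \<open>acoeff 1\<close> has a nonzero coefficient at
  \<open>half_powr 0\<close>, so dividing its expansion by \<open>k ^ q\<close> expresses
  \<open>half_powr q\<close> through \<open>acoeff 1 k / k ^ q\<close> and higher half-integer
  powers. The former is expanded by \<open>expands_div\<close>, the latter by downward
  induction.\<close>

lemma expands_acoeff_half_powr:
  assumes "\<And>\<rho>. expands half_powr \<rho> (acoeff 1)"
  shows "expands acs \<rho> (half_powr q)"
proof -
  \<comment> \<open>An error of order at least 1 keeps the leading order 1/2 visible, even when
    \<open>\<rho>\<close> is small; otherwise \<open>c 0\<close> could not be seen to be
    nonzero.\<close>
  define \<rho>' where "\<rho>' = max \<rho> 1"
  obtain c0 M0 where c0: "(\<lambda>k. acoeff 1 k - (\<Sum>j<M0. c0 j * half_powr j k)) \<in> Opow \<rho>'"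
    using assms unfolding expands_def by blast
  \<comment> \<open>Padding by zero and taking \<open>M = Suc M0\<close> guarantee that the sum has
    a term with index 0.\<close>
  define c where "c j = (if j < M0 then c0 j else 0)" for j
  define M where "M = Suc M0"
  have "(\<Sum>j<M0. c0 j * half_powr j k) = (\<Sum>j<M. c j * half_powr j k)" for k
    by (intro sum.mono_neutral_cong_left) (auto simp: c_def M_def)
  with c0 have c: "(\<lambda>k. acoeff 1 k - (\<Sum>j<M. c j * half_powr j k)) \<in> Opow \<rho>'"
    by simp
  have split: "(\<Sum>j<M. c j * half_powr j k) = c 0 * half_powr 0 k + (\<Sum>j=1..<M. c j * half_powr j k)" for k
    by (simp add: M_def lessThan_atLeast0 sum.atLeast_Suc_lessThan)
  have c_0: "c 0 \<noteq> 0"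
  proof
    assume "c 0 = 0"
    have "half_powr j \<in> Opow 1" if "j \<ge> 1" for j
      using that by (intro half_powr_bigo) auto
    then have "(\<lambda>k. c j * half_powr j k) \<in> Opow 1" if "j \<ge> 1" for j
      using that by (cases "c j = 0") auto
    then have "(\<lambda>k. (acoeff 1 k - (\<Sum>j<M. c j * half_powr j k)) + (\<Sum>j=1..<M. c j * half_powr j k)) \<in> Opow 1"
      by (intro sum_in_bigo(1) big_sum_in_bigo bigo_powr_mono[OF c]) (auto simp: \<rho>'_def)
    then have "acoeff 1 \<in> Opow 1" by (simp add: split \<open>c 0 = 0\<close>)
    then have "(\<lambda>k. acoeff 1 k * real k powr (1/2)) \<in> Opow (1/2)"
      by (rule bigo_powr_mult[OF _ landau_o.big_refl]) auto
    then have "(\<lambda>k. acoeff 1 k * real k powr (1/2)) \<longlonglongrightarrow> 0"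
      by (rule bigo_powr_tendsto_0) simp
    then show False using acoeff_limit[of 1] LIMSEQ_unique by fastforce
  qed
  have div: "expands acs \<rho> (\<lambda>k. acoeff 1 k / real k ^ q)" for q
  proof (induction q)
    case 0
    show ?case using expands_basis[of acs \<rho> 0] by simp
  next
    case (Suc q)
    from expands_mono[OF expands_div[OF this], of \<rho>] show ?case by (simp add: mult.commute)
  qed
  show ?thesis
  proof (induction q rule: downward_induct[where B=\<rho>])
    case (ge q)
    then show ?case by (intro expands_small half_powr_bigo) auto
  next
    case (step q)
    have "(\<lambda>k. (acoeff 1 k - (\<Sum>j<M. c j * half_powr j k)) * inverse (real k ^ q)) \<in> Opow \<rho>"
    proof (rule bigo_powr_mult[OF c, where b=0])
      show "(\<lambda>k. inverse (real k ^ q)) \<in> O(\<lambda>k. real k powr 0)"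
        by (intro bigoI[where c=1] eventually_mono[OF eventually_gt_at_top[of 0]])
          (auto simp: inverse_le_1_iff)
    qed (simp add: \<rho>'_def)
    \<comment> \<open>The expansion of \<open>acoeff 1\<close>, divided by \<open>k ^ q\<close> and
      solved for its first term.\<close>
    then have "expands acs \<rho> (\<lambda>k. 1 / c 0 * (acoeff 1 k / real k ^ q -
        (\<Sum>j=1..<M. c j * half_powr (j + q) k) - (acoeff 1 k - (\<Sum>j<M. c j * half_powr j k)) * inverse (real k ^ q)))"
      by (intro expands_cmult expands_diff expands_sum div step expands_small) auto
    also have "?this \<longleftrightarrow> ?case"
    proof (rule expands_cong)
      fix k :: nat assume k: "k > 0"
      have "half_powr q k = half_powr 0 k / real k ^ q" using half_powr_add[OF k, of 0 q] by simp
      moreover have "(\<Sum>j=1..<M. c j * half_powr (j + q) k) = (\<Sum>j=1..<M. c j * half_powr j k) * inverse (real k ^ q)"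
        using k by (simp add: half_powr_add sum_distrib_right divide_inverse mult.assoc)
      moreover have "1 / d * (A * u - S * u - (A - (d * h + S)) * u) = h * u" if "d \<noteq> 0" for A S d h u :: real
        using that by (simp add: algebra_simps)
      ultimately show "1 / c 0 * (acoeff 1 k / real k ^ q -
        (\<Sum>j=1..<M. c j * half_powr (j + q) k) - (acoeff 1 k - (\<Sum>j<M. c j * half_powr j k)) * inverse (real k ^ q))
        = half_powr q k"
        using c_0 unfolding split divide_inverse by simp
    qed
    finally show ?case .
  qed
qed

text \<open>The \<open>acs j\<close> have strictly decreasing exact orders, so a combination
  decaying faster than its first surviving term must have that coefficient zero.\<close>

lemma acoeff_sum_coeff_eq_0:
  assumes "(\<lambda>k. \<Sum>j<M. c j * acs j k) \<in> Opow \<beta>" "j < M" "real j + 1/2 < \<beta>"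
  shows "c j = 0"
  using assms(2,3)
proof (induction j rule: less_induct)
  case (less j)
  let ?f = "\<lambda>k. \<Sum>j<M. c j * acs j k"
  have eq: "?f k = c j * acs j k + (\<Sum>i=Suc j..<M. c i * acs i k)" for k
  proof -
    have "?f k = (\<Sum>i=j..<M. c i * acs i k)"
      using less by (intro sum.mono_neutral_right) (auto intro!: less.IH)
    then show ?thesis using less.prems by (simp add: sum.atLeast_Suc_lessThan)
  qed
  \<comment> \<open>A gain of at most 1 is also provided by every later sequence; the other bound
    comes from the assumed decay.\<close>
  define \<epsilon> where "\<epsilon> = min 1 (\<beta> - (real j + 1/2))"
  have \<epsilon>: "\<epsilon> > 0" "\<epsilon> \<le> 1" "real j + 1/2 + \<epsilon> \<le> \<beta>"
    using less.prems(2) by (auto simp: \<epsilon>_def)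
  have "acs i \<in> Opow (real j + 1/2 + \<epsilon>)" if "i > j" for i
    using that \<epsilon> by (intro bigo_powr_mono[OF acoeff_bigo]) auto
  then have "(\<lambda>k. c i * acs i k) \<in> Opow (real j + 1/2 + \<epsilon>)" if "i > j" for i
    using that by (cases "c i = 0") auto
  then have "(\<lambda>k. ?f k - (\<Sum>i=Suc j..<M. c i * acs i k)) \<in> Opow (real j + 1/2 + \<epsilon>)"
    using \<epsilon> by (intro sum_in_bigo(2) big_sum_in_bigo bigo_powr_mono[OF assms(1)]) auto
  then have "(\<lambda>k. c j * acs j k) \<in> Opow (real j + 1/2 + \<epsilon>)" by (simp add: eq)
  then have "(\<lambda>k. c j * acs j k * real k powr (real j + 1/2)) \<in> Opow \<epsilon>"
    by (intro bigo_powr_mult[OF _ landau_o.big_refl]) auto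
  then have "(\<lambda>k. c j * acs j k * real k powr (real j + 1/2)) \<longlonglongrightarrow> 0"
    using \<epsilon> by (intro bigo_powr_tendsto_0)
  moreover obtain L where L: "L \<noteq> 0" "(\<lambda>k. acs j k * real k powr (real j + 1/2)) \<longlonglongrightarrow> L"
    using acoeff_limit[of "Suc j"] by (auto simp: add.commute)
  ultimately show ?case
    using tendsto_mult_left[OF L(2), of "c j"] LIMSEQ_unique by (fastforce simp: mult.assoc)
qed

section \<open>Powers of functions close to a Gaussian\<close>

lemma binomial_le_power_real: "real (k choose l) \<le> real k ^ l"
proof (cases "l \<le> k")
  case True
  then show ?thesis using of_nat_mono[OF binomial_le_pow[OF True], where 'a=real] by simp
qed (simp add: binomial_eq_0)

text \<open>Induction on \<open>k\<close> by Pascal's rule. The crude factor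
  \<open>(1 + norm z) ^ k\<close> is affordable because half of the Gaussian exponent will absorb
  it.\<close>

lemma norm_binomial_remainder:
  fixes z :: complex
  shows "norm ((1 + z) ^ k - (\<Sum>l\<le>r. of_nat (k choose l) * z ^ l))
    \<le> real k ^ Suc r * norm z ^ Suc r * (1 + norm z) ^ k"
proof (induction k)
  case 0
  have "(\<Sum>l\<le>r. of_nat (0 choose l) * z ^ l) = (\<Sum>l\<in>{0}. of_nat (0 choose l) * z ^ l)"
    by (intro sum.mono_neutral_right) auto
  then show ?case by simp
next
  case (Suc k)
  let ?S = "\<lambda>k. \<Sum>l\<le>r. of_nat (k choose l) * z ^ l"
  let ?n = "norm z"
  have S: "?S (Suc k) + of_nat (k choose r) * z ^ Suc r = (1 + z) * ?S k"
  proof (induction r)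
    case (Suc r)
    then show ?case by (simp add: algebra_simps)
  qed simp
  have 1: "norm (of_nat (k choose r) * z ^ Suc r) \<le> real k ^ r * ?n ^ Suc r"
    unfolding norm_mult norm_power norm_of_nat
    by (intro mult_right_mono binomial_le_power_real) simp
  have eq: "(1 + z) ^ Suc k - ?S (Suc k) = (1 + z) * ((1 + z) ^ k - ?S k) + of_nat (k choose r) * z ^ Suc r"
    using S by (simp add: algebra_simps)
  have "norm ((1 + z) ^ Suc k - ?S (Suc k))
      \<le> norm (1 + z) * norm ((1 + z) ^ k - ?S k) + norm (of_nat (k choose r) * z ^ Suc r)"
    unfolding eq norm_mult[of "1 + z", symmetric] by (rule norm_triangle_ineq)
  also have "\<dots> \<le> (1 + ?n) * (real k ^ Suc r * ?n ^ Suc r * (1 + ?n) ^ k) + real k ^ r * ?n ^ Suc r"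
    using norm_triangle_ineq[of 1 z] by (intro add_mono mult_mono Suc.IH 1) auto
  also have "\<dots> \<le> real k ^ Suc r * ?n ^ Suc r * (1 + ?n) ^ Suc k + real k ^ r * ?n ^ Suc r * (1 + ?n) ^ Suc k"
  proof -
    have "real k ^ r * ?n ^ Suc r * 1 \<le> real k ^ r * ?n ^ Suc r * (1 + ?n) ^ Suc k"
      by (intro mult_left_mono one_le_power) auto
    then show ?thesis by (simp add: mult_ac)
  qed
  also have "\<dots> = real k ^ r * real (Suc k) * (?n ^ Suc r * (1 + ?n) ^ Suc k)"
    by (simp add: algebra_simps)
  also have "\<dots> \<le> real (Suc k) ^ r * real (Suc k) * (?n ^ Suc r * (1 + ?n) ^ Suc k)"
    by (intro mult_right_mono power_mono) auto
  finally show ?case by (simp only: power_Suc mult_ac)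
qed

lemma norm_power_diff_le:
  fixes x y :: complex
  assumes "norm x \<le> B" "norm y \<le> B"
  shows "norm (x ^ Suc k - y ^ Suc k) \<le> real (Suc k) * norm (x - y) * B ^ k"
proof (induction k)
  case (Suc k)
  have B: "B \<ge> 0" using assms(1) norm_ge_zero order_trans by blast
  have eq: "x ^ Suc (Suc k) - y ^ Suc (Suc k) = x * (x ^ Suc k - y ^ Suc k) + (x - y) * y ^ Suc k"
    by (simp add: algebra_simps)
  have "norm (x ^ Suc (Suc k) - y ^ Suc (Suc k))
      \<le> norm x * norm (x ^ Suc k - y ^ Suc k) + norm (x - y) * norm y ^ Suc k"
    unfolding eq norm_mult[symmetric] norm_power[symmetric] by (rule norm_triangle_ineq)
  also have "\<dots> \<le> B * (real (Suc k) * norm (x - y) * B ^ k) + norm (x - y) * B ^ Suc k"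
    using B assms by (intro add_mono mult_mono power_mono Suc.IH) auto
  finally show ?case by (simp add: algebra_simps)
qed simp

abbreviation gauss :: "real \<Rightarrow> nat \<Rightarrow> real \<Rightarrow> real" where
  "gauss a k t \<equiv> exp (- (a * real k * t\<^sup>2))"

text \<open>For small \<open>t\<close> the power \<open>(1 + R t) ^ k\<close> is expanded by the binomial theorem; for \<open>t\<close> bounded away
  from \<open>0\<close> every term is exponentially small, and \<open>\<bar>t\<bar> ^ (3 * Suc r)\<close> is bounded below.\<close>

lemma power_gauss_approx:
  fixes \<phi> R :: "real \<Rightarrow> complex"
  assumes a: "a > 0" and c: "c > 0" and T: "T > 0"
    and \<phi>: "\<And>t. \<bar>t\<bar> \<le> T \<Longrightarrow> norm (\<phi> t) \<le> exp (- (c * t\<^sup>2))"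
    and R: "\<And>t. \<bar>t\<bar> \<le> T \<Longrightarrow> norm (R t) \<le> K * \<bar>t\<bar> ^ 3"
    and approx: "\<And>t. \<bar>t\<bar> \<le> T \<Longrightarrow> norm (\<phi> t - of_real (exp (- (a * t\<^sup>2))) * (1 + R t)) \<le> A * \<bar>t\<bar> ^ (r + 3)"
  obtains b C where "b > 0" "C \<ge> 0"
    "\<And>k t. k \<ge> 1 \<Longrightarrow> \<bar>t\<bar> \<le> T \<Longrightarrow>
      norm (\<phi> t ^ k - (\<Sum>l\<le>r. of_nat (k choose l) * R t ^ l) * of_real (gauss a k t))
      \<le> C * (real k * \<bar>t\<bar> ^ (r + 3) + real k ^ Suc r * \<bar>t\<bar> ^ (3 * Suc r)) * gauss b k t"
proof -
  have K: "K \<ge> 0" using order_trans[OF norm_ge_zero R[of T]] T by (simp add: zero_le_mult_iff)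
  have A: "A \<ge> 0" using order_trans[OF norm_ge_zero approx[of T]] zero_less_power[OF T, of "r + 3"] T
    by (auto simp: zero_le_mult_iff simp del: power_add)
  \<comment> \<open>Half of \<open>a\<close> is given up to absorb the factor
    \<open>1 + norm (R t)\<close>; \<open>c\<close> controls \<open>\<phi>\<close> itself.\<close>
  define b where "b = min c (a / 2)"
  have b: "b > 0" "b \<le> c" "b \<le> a / 2" using a c by (auto simp: b_def)
  \<comment> \<open>Chosen so that \<open>K * \<bar>t\<bar> ^ 3 \<le> a / 2 * t\<^sup>2\<close> for
    \<open>\<bar>t\<bar> \<le> \<delta>\<close>; \<open>K + 1\<close> avoids division by
    zero.\<close>
  define \<delta> where "\<delta> = a / (2 * (K + 1))"
  have \<delta>: "\<delta> > 0" using a K by (simp add: \<delta>_def)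
  define G where "G = (\<Sum>l\<le>r. (K * T ^ 3) ^ l)"
  have G: "G \<ge> 0" using K T by (auto simp: G_def intro!: sum_nonneg)
  \<comment> \<open>One summand each for replacing \<open>\<phi>\<close> by its approximation, for
    truncating the binomial sum, and for \<open>\<bar>t\<bar> > \<delta>\<close>. The factor
    \<open>exp (b * T\<^sup>2)\<close> restores the one Gaussian factor lost in the difference of
    two \<open>k\<close>-th powers.\<close>
  define C where "C = A * exp (b * T\<^sup>2) + K ^ Suc r + (1 + G) / \<delta> ^ (3 * Suc r)"
  have C: "A * exp (b * T\<^sup>2) \<le> C" "K ^ Suc r \<le> C" "(1 + G) / \<delta> ^ (3 * Suc r) \<le> C" "C \<ge> 0"
    using A K G \<delta> by (auto simp: C_def)
  have "norm (\<phi> t ^ k - (\<Sum>l\<le>r. of_nat (k choose l) * R t ^ l) * of_real (gauss a k t))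
      \<le> C * (real k * \<bar>t\<bar> ^ (r + 3) + real k ^ Suc r * \<bar>t\<bar> ^ (3 * Suc r)) * gauss b k t"
    (is "norm (?f - ?S * ?g) \<le> C * (?u + ?v) * ?E") if k: "k \<ge> 1" and t: "\<bar>t\<bar> \<le> T" for k t
  proof -
    have uv: "?u \<ge> 0" "?v \<ge> 0" by auto
    have E: "exp (- (x * t\<^sup>2)) ^ k \<le> ?E" if "b \<le> x" for x
    proof -
      have "b * (real k * t\<^sup>2) \<le> x * (real k * t\<^sup>2)" using that by (intro mult_right_mono) auto
      then have "real k * - (x * t\<^sup>2) \<le> - (b * real k * t\<^sup>2)" by (simp only: mult_minus_right neg_le_iff_le mult.left_commute mult.assoc)
      then show ?thesis by (simp only: exp_of_nat_mult[symmetric] exp_le_cancel_iff)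
    qed
    have g: "?g = of_real (exp (- (a * t\<^sup>2))) ^ k"
      by (simp add: exp_of_nat_mult[symmetric] mult_ac flip: of_real_power)
    have g': "norm ?g = exp (- (a * t\<^sup>2)) ^ k" unfolding g by (simp add: norm_power)
    show ?thesis
    proof (cases "\<bar>t\<bar> \<le> \<delta>")
      case True
      define \<psi> where "\<psi> = of_real (exp (- (a * t\<^sup>2))) * (1 + R t)"
      have "K * \<bar>t\<bar> ^ 3 = K * \<bar>t\<bar> * t\<^sup>2" by (simp add: power3_eq_cube power2_eq_square)
      also have "\<dots> \<le> a / 2 * t\<^sup>2"
      proof (intro mult_right_mono)
        have "K * \<bar>t\<bar> \<le> (K + 1) * \<delta>" using True K by (intro mult_mono) auto
        also have "\<dots> = a / 2" using K by (simp add: \<delta>_def field_simps)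
        finally show "K * \<bar>t\<bar> \<le> a / 2" .
      qed auto
      finally have Rt: "norm (R t) \<le> a / 2 * t\<^sup>2" using R[OF t] by linarith
      have psi_aux: "exp (- (a * t\<^sup>2)) * (1 + norm (R t)) \<le> exp (- (a / 2 * t\<^sup>2))"
      proof -
        have "1 + norm (R t) \<le> exp (a / 2 * t\<^sup>2)"
          using Rt exp_ge_add_one_self[of "a / 2 * t\<^sup>2"] by linarith
        then have "exp (- (a * t\<^sup>2)) * (1 + norm (R t)) \<le> exp (- (a * t\<^sup>2)) * exp (a / 2 * t\<^sup>2)"
          by (intro mult_left_mono) auto
        then show ?thesis by (simp flip: exp_add)
      qed
      obtain k' where k': "k = Suc k'" using k by (cases k) auto
      have "norm \<psi> \<le> exp (- (a * t\<^sup>2)) * (1 + norm (R t))"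
        unfolding \<psi>_def norm_mult using norm_triangle_ineq[of 1 "R t"] by (simp add: mult_left_mono)
      then have psi: "norm \<psi> \<le> exp (- (b * t\<^sup>2))"
        by (rule order_trans[OF order_trans[OF _ psi_aux]]) (use mult_right_mono[OF b(3), of "t\<^sup>2"] in simp)
      have phi: "norm (\<phi> t) \<le> exp (- (b * t\<^sup>2))"
        by (rule order_trans[OF \<phi>[OF t]]) (use mult_right_mono[OF b(2), of "t\<^sup>2"] in simp)
      have "norm (?f - \<psi> ^ k) \<le> real k * norm (\<phi> t - \<psi>) * exp (- (b * t\<^sup>2)) ^ k'"
        unfolding k' by (rule norm_power_diff_le[OF phi psi])
      also have "\<dots> \<le> real k * (A * \<bar>t\<bar> ^ (r + 3)) * (?E * exp (b * T\<^sup>2))"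
      proof (intro mult_mono)
        show "norm (\<phi> t - \<psi>) \<le> A * \<bar>t\<bar> ^ (r + 3)" unfolding \<psi>_def by (rule approx[OF t])
        have "exp (- (b * t\<^sup>2)) ^ k' = ?E * exp (b * t\<^sup>2)"
          by (simp add: k' exp_of_nat_mult[symmetric] exp_add[symmetric] algebra_simps)
        also have "\<dots> \<le> ?E * exp (b * T\<^sup>2)"
        proof -
          have "t\<^sup>2 \<le> T\<^sup>2" using t T by (simp add: abs_le_square_iff[symmetric])
          then show ?thesis using b(1) by auto
        qed
        finally show "exp (- (b * t\<^sup>2)) ^ k' \<le> ?E * exp (b * T\<^sup>2)" .
      qed (auto simp: A)
      also have "\<dots> = (A * exp (b * T\<^sup>2)) * (?u * ?E)" by (simp only: mult_ac)
      also have "\<dots> \<le> C * (?u * ?E)" using C by (intro mult_right_mono) auto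
      finally have 1: "norm (?f - \<psi> ^ k) \<le> C * (?u * ?E)" .
      have "\<psi> ^ k - ?S * ?g = ((1 + R t) ^ k - ?S) * ?g"
        unfolding \<psi>_def g power_mult_distrib by (subst left_diff_distrib) (simp only: mult.commute)
      then have "norm (\<psi> ^ k - ?S * ?g) = norm ((1 + R t) ^ k - ?S) * exp (- (a * t\<^sup>2)) ^ k"
        by (simp only: norm_mult g')
      also have "\<dots> \<le> (real k ^ Suc r * norm (R t) ^ Suc r * (1 + norm (R t)) ^ k) * exp (- (a * t\<^sup>2)) ^ k"
        by (intro mult_right_mono norm_binomial_remainder) auto
      also have "\<dots> = real k ^ Suc r * norm (R t) ^ Suc r * (exp (- (a * t\<^sup>2)) * (1 + norm (R t))) ^ k"
        by (simp add: power_mult_distrib mult_ac)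
      also have "\<dots> \<le> real k ^ Suc r * (K * \<bar>t\<bar> ^ 3) ^ Suc r * exp (- (a / 2 * t\<^sup>2)) ^ k"
        using R[OF t] psi_aux K by (intro mult_mono power_mono) auto
      also have "\<dots> \<le> real k ^ Suc r * (K * \<bar>t\<bar> ^ 3) ^ Suc r * ?E"
        using E[OF b(3)] K by (intro mult_left_mono) auto
      also have "\<dots> = K ^ Suc r * (?v * ?E)"
        by (simp only: power_mult_distrib power_mult[symmetric] mult_ac)
      also have "\<dots> \<le> C * (?v * ?E)" using C by (intro mult_right_mono) auto
      finally have "norm (\<psi> ^ k - ?S * ?g) \<le> C * (?v * ?E)" .
      with 1 have "norm ((?f - \<psi> ^ k) + (\<psi> ^ k - ?S * ?g)) \<le> C * (?u * ?E) + C * (?v * ?E)"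
        by (intro order_trans[OF norm_triangle_ineq] add_mono)
      then show ?thesis by (simp only: diff_add_cancel add_diff_eq distrib_left distrib_right mult.assoc)
    next
      case False
      then have far: "1 \<le> (\<bar>t\<bar> / \<delta>) ^ (3 * Suc r)" using \<delta> by (intro one_le_power) (auto simp: field_simps)
      have k_pow: "real k ^ l \<le> real k ^ Suc r" if "l \<le> r" for l
        using k that by (intro power_increasing) auto
      have "norm ?f \<le> exp (- (c * t\<^sup>2)) ^ k"
        unfolding norm_power using \<phi>[OF t] by (intro power_mono) auto
      also have "\<dots> \<le> ?E" using E[OF b(2)] .
      also have "\<dots> \<le> real k ^ Suc r * ?E" using k by (simp del: power_Suc)
      finally have 1: "norm ?f \<le> real k ^ Suc r * ?E" .
      have "norm (?S * ?g) \<le> (\<Sum>l\<le>r. real (k choose l) * norm (R t) ^ l) * ?E"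
        unfolding norm_mult g'
      proof (rule mult_mono)
        show "norm ?S \<le> (\<Sum>l\<le>r. real (k choose l) * norm (R t) ^ l)"
          by (rule order_trans[OF norm_sum]) (simp add: norm_mult norm_power)
        show "exp (- (a * t\<^sup>2)) ^ k \<le> ?E" using E[of a] b a by simp
      qed (auto intro!: sum_nonneg)
      also have "\<dots> \<le> (\<Sum>l\<le>r. real k ^ Suc r * (K * T ^ 3) ^ l) * ?E"
      proof (intro mult_right_mono sum_mono mult_mono power_mono)
        fix l assume l: "l \<in> {..r}"
        show "real (k choose l) \<le> real k ^ Suc r"
          using order_trans[OF binomial_le_power_real k_pow] l by simp
        show "norm (R t) \<le> K * T ^ 3"
          by (rule order_trans[OF R[OF t]]) (use K t in \<open>intro mult_left_mono power_mono; simp\<close>)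
      qed auto
      also have "\<dots> = real k ^ Suc r * G * ?E" by (simp add: G_def sum_distrib_left)
      finally have "norm (?S * ?g) \<le> real k ^ Suc r * G * ?E" .
      with 1 have "norm (?f - ?S * ?g) \<le> (1 + G) * (real k ^ Suc r * ?E)"
        using norm_triangle_ineq4[of ?f "?S * ?g"] by (simp add: algebra_simps)
      also have "\<dots> \<le> (1 + G) * (real k ^ Suc r * ?E) * (\<bar>t\<bar> / \<delta>) ^ (3 * Suc r)"
        using mult_left_mono[OF far, of "(1 + G) * (real k ^ Suc r * ?E)"] G by simp
      also have "\<dots> = (1 + G) / \<delta> ^ (3 * Suc r) * (?v * ?E)"
        by (simp only: power_divide times_divide_eq_right times_divide_eq_left mult_ac)
      also have "\<dots> \<le> C * (?v * ?E)" using C by (intro mult_right_mono) auto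
      also have "\<dots> \<le> C * ((?u + ?v) * ?E)" using C uv by (intro mult_left_mono mult_right_mono) auto
      finally show ?thesis by (simp only: mult.assoc)
    qed
  qed
  with b(1) C(4) show ?thesis by (rule that)
qed

section \<open>Gaussian moments and their truncation to \<open>[-pi, pi]\<close>\<close>

lemma gauss_eq_normal_density:
  assumes "b > 0"
  shows "exp (- (b * t\<^sup>2)) = sqrt (pi / b) * normal_density 0 (sqrt (1 / (2 * b))) t"
proof -
  have "normal_density 0 (sqrt (1 / (2 * b))) t = 1 / sqrt (pi / b) * exp (- (b * t\<^sup>2))"
    using assms by (simp add: normal_density_def divide_simps mult.commute)
  then show ?thesis using assms by simp
qed

lemma integrable_gauss_moment:
  assumes "b > 0"
  shows "integrable lborel (\<lambda>t::real. t ^ M * exp (- (b * t\<^sup>2)))"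
  using integrable_mult_right[OF integrable_normal_moment[of "sqrt (1 / (2 * b))" 0 M], of "sqrt (pi / b)"] assms
  by (simp add: gauss_eq_normal_density[OF assms] mult_ac)

lemma integrable_gauss_moment_abs:
  assumes "b > 0"
  shows "integrable lborel (\<lambda>t::real. \<bar>t\<bar> ^ M * exp (- (b * t\<^sup>2)))"
  using integrable_mult_right[OF integrable_normal_moment_abs[of "sqrt (1 / (2 * b))" 0 M], of "sqrt (pi / b)"] assms
  by (simp add: gauss_eq_normal_density[OF assms] mult_ac)

definition gmom :: "real \<Rightarrow> nat \<Rightarrow> real" where
  "gmom b M = (LINT t|lborel. t ^ M * exp (- (b * t\<^sup>2)))"

definition gmom_abs :: "real \<Rightarrow> nat \<Rightarrow> real" where
  "gmom_abs b M = (LINT t|lborel. \<bar>t\<bar> ^ M * exp (- (b * t\<^sup>2)))"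

lemma gmom_odd:
  assumes "b > 0"
  shows "gmom b (2 * q + 1) = 0"
proof -
  have "gmom b (2 * q + 1) = (LINT t|lborel. sqrt (pi / b) * (normal_density 0 (sqrt (1 / (2 * b))) t * (t - 0) ^ (2 * q + 1)))"
    unfolding gmom_def gauss_eq_normal_density[OF assms] by (simp only: mult_ac diff_zero)
  also have "\<dots> = sqrt (pi / b) * 0"
    by (subst integral_mult_right_zero) (rule arg_cong[of _ _ "(*) _"], rule has_bochner_integral_integral_eq[OF normal_moment_odd], use assms in simp)
  finally show ?thesis by simp
qed

text \<open>This positivity is the source of the exact degrees of the polynomials.\<close>

lemma gmom_even_pos:
  assumes "b > 0"
  shows "gmom b (2 * q) > 0"
proof -
  let ?v = "fact (2 * q) / ((2 / (sqrt (1 / (2 * b)))\<^sup>2) ^ q * fact q) :: real"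
  have "gmom b (2 * q) = (LINT t|lborel. sqrt (pi / b) * (normal_density 0 (sqrt (1 / (2 * b))) t * (t - 0) ^ (2 * q)))"
    unfolding gmom_def gauss_eq_normal_density[OF assms] by (simp only: mult_ac diff_zero)
  also have "\<dots> = sqrt (pi / b) * ?v"
    by (subst integral_mult_right_zero) (rule arg_cong[of _ _ "(*) _"], rule has_bochner_integral_integral_eq[OF normal_moment_even], use assms in simp)
  also have "\<dots> > 0" using assms by (intro mult_pos_pos divide_pos_pos zero_less_power) auto
  finally show ?thesis .
qed

lemma gauss_scale_aux:
  assumes "s > 0"
  shows "(x / sqrt s) ^ M * exp (- (b * s * (x / sqrt s)\<^sup>2)) / sqrt s = s powr - (real (M + 1) / 2) * (x ^ M * exp (- (b * x\<^sup>2)))"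
    and "\<bar>x / sqrt s\<bar> ^ M * exp (- (b * s * (x / sqrt s)\<^sup>2)) / sqrt s = s powr - (real (M + 1) / 2) * (\<bar>x\<bar> ^ M * exp (- (b * x\<^sup>2)))"
proof -
  have q: "sqrt s > 0" using assms by simp
  have e: "b * s * (x / sqrt s)\<^sup>2 = b * x\<^sup>2" using assms by (simp only: power_divide real_sqrt_pow2 less_imp_le) simp
  have "sqrt s ^ M * sqrt s = s powr (real (M + 1) / 2)"
  proof -
    have "sqrt s ^ M * sqrt s = (s powr (1/2)) ^ Suc M"
      using assms by (simp only: powr_half_sqrt less_imp_le power_Suc2)
    also have "\<dots> = s powr (real (Suc M) * (1/2))" using assms by (intro powr_power) simp
    finally show ?thesis by simp
  qed
  then have p: "s powr - (real (M + 1) / 2) = 1 / (sqrt s ^ M * sqrt s)"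
    by (simp only: powr_minus_divide)
  show "(x / sqrt s) ^ M * exp (- (b * s * (x / sqrt s)\<^sup>2)) / sqrt s = s powr - (real (M + 1) / 2) * (x ^ M * exp (- (b * x\<^sup>2)))"
    unfolding e p unfolding power_divide
    by (simp only: times_divide_eq_left times_divide_eq_right divide_divide_eq_left mult_1_left)
  show "\<bar>x / sqrt s\<bar> ^ M * exp (- (b * s * (x / sqrt s)\<^sup>2)) / sqrt s = s powr - (real (M + 1) / 2) * (\<bar>x\<bar> ^ M * exp (- (b * x\<^sup>2)))"
    unfolding e p unfolding power_divide abs_divide abs_of_pos[OF q]
    by (simp only: times_divide_eq_left times_divide_eq_right divide_divide_eq_left mult_1_left)
qed

text \<open>The substitution t = x / sqrt s; with \<open>s = k\<close> it produces the half-integer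
  powers of \<open>k\<close>.\<close>

lemma gauss_scale:
  assumes "s > 0"
  shows "(LINT t|lborel. t ^ M * exp (- (b * s * t\<^sup>2))) = s powr - (real (M + 1) / 2) * gmom b M"
    and "(LINT t|lborel. \<bar>t\<bar> ^ M * exp (- (b * s * t\<^sup>2))) = s powr - (real (M + 1) / 2) * gmom_abs b M"
proof -
  have scale: "(LINT t|lborel. f t) = (LINT x|lborel. f (x / sqrt s) / sqrt s)" for f :: "real \<Rightarrow> real"
    using lborel_integral_real_affine[of "1 / sqrt s" f 0] assms by simp
  show "(LINT t|lborel. t ^ M * exp (- (b * s * t\<^sup>2))) = s powr - (real (M + 1) / 2) * gmom b M"
    by (subst scale) (simp only: gauss_scale_aux[OF assms] gmom_def integral_mult_right_zero)
  show "(LINT t|lborel. \<bar>t\<bar> ^ M * exp (- (b * s * t\<^sup>2))) = s powr - (real (M + 1) / 2) * gmom_abs b M"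
    by (subst scale) (simp only: gauss_scale_aux[OF assms] gmom_abs_def integral_mult_right_zero)
qed

lemma gmom_abs_nonneg: "gmom_abs b M \<ge> 0"
  unfolding gmom_abs_def by (intro integral_nonneg_AE) auto

lemma norm_set_integral_le:
  fixes f :: "real \<Rightarrow> complex"
  assumes "continuous_on {a..b} f" "integrable lborel g"
    and "\<And>t. t \<in> {a..b} \<Longrightarrow> norm (f t) \<le> g t" "\<And>t. 0 \<le> g t"
  shows "norm (LINT t:{a..b}|lborel. f t) \<le> (LINT t|lborel. g t)"
  unfolding set_lebesgue_integral_def
proof (rule Bochner_Integration.integral_norm_bound_integral)
  show "integrable lborel (\<lambda>t. indicator {a..b} t *\<^sub>R f t)"
    using borel_integrable_atLeastAtMost'[OF assms(1)] by (simp add: set_integrable_def)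
  show "norm (indicator {a..b} t *\<^sub>R f t) \<le> g t" for t
    using assms(3,4) by (cases "t \<in> {a..b}") auto
qed (rule assms)

lemma set_integral_sum_complex:
  fixes g :: "'i \<Rightarrow> real \<Rightarrow> complex"
  assumes "\<And>i. i \<in> I \<Longrightarrow> continuous_on {a..b} (g i)"
  shows "(LINT t:{a..b}|lborel. (\<Sum>i\<in>I. c i * g i t)) = (\<Sum>i\<in>I. c i * (LINT t:{a..b}|lborel. g i t))"
proof -
  have int: "integrable lborel (\<lambda>t. indicator {a..b} t *\<^sub>R g i t)" if "i \<in> I" for i
    using borel_integrable_atLeastAtMost'[OF assms[OF that]] by (simp add: set_integrable_def)
  have "(LINT t:{a..b}|lborel. (\<Sum>i\<in>I. c i * g i t)) =
      (LINT t|lborel. (\<Sum>i\<in>I. c i * (indicator {a..b} t *\<^sub>R g i t)))"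
    unfolding set_lebesgue_integral_def by (intro Bochner_Integration.integral_cong refl) (simp add: scaleR_sum_right)
  also have "\<dots> = (\<Sum>i\<in>I. c i * (LINT t:{a..b}|lborel. g i t))"
    unfolding set_lebesgue_integral_def
    by (subst Bochner_Integration.integral_sum) (simp_all only: integrable_mult_right int integral_mult_right_zero)
  finally show ?thesis .
qed

definition trunc_moment :: "real \<Rightarrow> nat \<Rightarrow> nat \<Rightarrow> real" where
  "trunc_moment a M k = (LINT t:{-pi..pi}|lborel. t ^ M * gauss a k t)"

text \<open>Outside \<open>[-pi, pi]\<close> one has \<open>\<bar>t\<bar> \<ge> 1\<close>, so
  raising the exponent of \<open>\<bar>t\<bar>\<close> by \<open>2 * N\<close> only enlarges the
  missing tail. It is therefore bounded by moments of arbitrarily high order and decays faster than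
  any power of \<open>k\<close>.\<close>

lemma trunc_moment_bigo:
  assumes a: "a > 0"
  shows "(\<lambda>k. trunc_moment a M k - gmom a M * real k powr - (real (M + 1) / 2)) \<in> Opow \<alpha>"
proof -
  define N where "N = nat \<lceil>\<alpha>\<rceil>"
  have N: "\<alpha> \<le> real (M + 2 * N + 1) / 2" unfolding N_def using real_nat_ceiling_ge[of \<alpha>] by (simp add: add_divide_distrib)
  have bound: "\<bar>trunc_moment a M k - gmom a M * real k powr - (real (M + 1) / 2)\<bar>
      \<le> gmom_abs a (M + 2 * N) * real k powr - (real (M + 2 * N + 1) / 2)" if k: "k > 0" for k
  proof -
    define f where "f t = t ^ M * gauss a k t" for t
    have int: "integrable lborel f"
      unfolding f_def using integrable_gauss_moment[of "a * real k" M] a k by simp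
    have int': "integrable lborel (\<lambda>t. indicator {-pi..pi} t *\<^sub>R f t)"
      by (intro integrable_mult_indicator int) auto
    have "gmom a M * real k powr - (real (M + 1) / 2) = (LINT t|lborel. f t)"
      unfolding f_def using gauss_scale(1)[of "real k" M a] k by simp
    then have "\<bar>trunc_moment a M k - gmom a M * real k powr - (real (M + 1) / 2)\<bar>
        = norm (LINT t|lborel. indicator {-pi..pi} t *\<^sub>R f t - f t)"
      using Bochner_Integration.integral_diff[OF int' int]
      by (simp add: trunc_moment_def set_lebesgue_integral_def f_def[symmetric])
    also have "\<dots> \<le> (LINT t|lborel. \<bar>t\<bar> ^ (M + 2 * N) * gauss a k t)"
    proof (rule Bochner_Integration.integral_norm_bound_integral)
      show "integrable lborel (\<lambda>t. indicator {-pi..pi} t *\<^sub>R f t - f t)"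
        using int int' by simp
      show "integrable lborel (\<lambda>t. \<bar>t\<bar> ^ (M + 2 * N) * gauss a k t)"
        using integrable_gauss_moment_abs[of "a * real k"] a k by simp
      show "norm (indicator {-pi..pi} t *\<^sub>R f t - f t) \<le> \<bar>t\<bar> ^ (M + 2 * N) * gauss a k t" for t
      proof (cases "t \<in> {-pi..pi}")
        case False
        then have "\<bar>t\<bar> \<ge> 1" using pi_ge_two by auto
        then have "\<bar>t\<bar> ^ M * 1 \<le> \<bar>t\<bar> ^ M * \<bar>t\<bar> ^ (2 * N)" by (intro mult_left_mono one_le_power) auto
        then have "\<bar>t\<bar> ^ M * gauss a k t \<le> \<bar>t\<bar> ^ (M + 2 * N) * gauss a k t"
          by (intro mult_right_mono) (auto simp: power_add)
        with False show ?thesis by (simp add: f_def abs_mult power_abs)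
      qed simp
    qed
    also have "\<dots> = gmom_abs a (M + 2 * N) * real k powr - (real (M + 2 * N + 1) / 2)"
      using gauss_scale(2)[of "real k" "M + 2 * N" a] k by simp
    finally show ?thesis .
  qed
  have "(\<lambda>k. trunc_moment a M k - gmom a M * real k powr - (real (M + 1) / 2))
      \<in> Opow (real (M + 2 * N + 1) / 2)"
    using bound by (intro bigoI[where c="gmom_abs a (M + 2 * N)"] eventually_mono[OF eventually_gt_at_top[of 0]]) simp
  then show ?thesis using N by (rule bigo_powr_mono)
qed

text \<open>For odd \<open>M\<close> the full moment vanishes by symmetry. For
  \<open>M = 2 * q\<close> it is a multiple of \<open>half_powr q\<close>, and
  \<open>l \<le> q\<close> is what \<open>expands_binomial_half_powr\<close> requires. The growth of
  \<open>k choose l\<close> is harmless to the truncation error.\<close>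

lemma expands_trunc_moment:
  assumes a: "a > 0" and l: "2 * l \<le> M"
  shows "expands half_powr \<rho> (\<lambda>k. real (k choose l) * trunc_moment a M k)"
proof -
  have "(\<lambda>k. real (k choose l)) \<in> O(\<lambda>k. real k powr real l)"
  proof (intro bigoI[where c=1] eventually_mono[OF eventually_gt_at_top[of 0]])
    fix k :: nat assume "k > 0"
    then show "norm (real (k choose l)) \<le> 1 * norm (real k powr real l)"
      using binomial_le_power_real[of k l] by (simp add: powr_realpow)
  qed
  from bigo_powr_mult[OF this trunc_moment_bigo[OF a, of M "\<rho> + real l"], of "- \<rho>"]
  have err: "(\<lambda>k. real (k choose l) * (trunc_moment a M k - gmom a M * real k powr - (real (M + 1) / 2)))
      \<in> Opow \<rho>" by simp
  have "expands half_powr \<rho> (\<lambda>k. gmom a M * (real (k choose l) * real k powr - (real (M + 1) / 2)))"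
  proof (cases "even M")
    case True
    then obtain q where q: "M = 2 * q" by (elim evenE)
    have "expands half_powr \<rho> (\<lambda>k. gmom a M * (real (k choose l) * half_powr q k))"
      using l by (intro expands_cmult expands_binomial_half_powr) (simp add: q)
    moreover have "half_powr q k = real k powr - (real (M + 1) / 2)" for k
      unfolding half_powr_def q by (simp add: add_divide_distrib add.commute)
    ultimately show ?thesis by simp
  next
    case False
    then obtain q where "M = 2 * q + 1" by (elim oddE)
    then have "gmom a M = 0" using gmom_odd[OF a] by simp
    then show ?thesis by (simp add: expands_small)
  qed
  from expands_add[OF expands_small[OF err] this] show ?thesis by (simp add: algebra_simps)
qed

section \<open>Fourier moments of powers of a nearly Gaussian function\<close>

locale gauss_like =
  fixes \<phi> R :: "real \<Rightarrow> complex" and a c K A :: real and r :: nat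
  assumes cont_\<phi>: "continuous_on {-pi..pi} \<phi>" and cont_R: "continuous_on {-pi..pi} R"
    and a_pos: "a > 0" and c_pos: "c > 0"
    and \<phi>_le: "\<And>t. \<bar>t\<bar> \<le> pi \<Longrightarrow> norm (\<phi> t) \<le> exp (- (c * t\<^sup>2))"
    and R_le: "\<And>t. \<bar>t\<bar> \<le> pi \<Longrightarrow> norm (R t) \<le> K * \<bar>t\<bar> ^ 3"
    and \<phi>_approx: "\<And>t. \<bar>t\<bar> \<le> pi \<Longrightarrow> norm (\<phi> t - of_real (exp (- (a * t\<^sup>2))) * (1 + R t)) \<le> A * \<bar>t\<bar> ^ (r + 3)"
begin

definition moment :: "nat \<Rightarrow> nat \<Rightarrow> complex" where
  "moment p k = (LINT t:{-pi..pi}|lborel. of_real (t ^ p) * \<phi> t ^ k)"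

text \<open>The two pointwise errors, \<open>k * \<bar>t\<bar> ^ (r + 3)\<close> and
  \<open>k ^ Suc r * \<bar>t\<bar> ^ (3 * Suc r)\<close>, times \<open>\<bar>t\<bar> ^ p\<close>,
  integrate against the Gaussian to the same power of \<open>k\<close>. This balance is why
  \<open>r\<close> correction terms go together with \<open>r + 3\<close> moments.\<close>

lemma moment_approx:
  "\<exists>C. \<forall>k\<ge>1. norm (moment p k - (\<Sum>l\<le>r. of_nat (k choose l) *
      (LINT t:{-pi..pi}|lborel. of_real (t ^ p) * (R t ^ l * of_real (gauss a k t)))))
    \<le> C * real k powr - (real (r + p + 2) / 2)"
proof -
  obtain b C where b: "b > 0" and C: "C \<ge> 0" and
    *: "\<And>k t. k \<ge> 1 \<Longrightarrow> \<bar>t\<bar> \<le> pi \<Longrightarrow>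
      norm (\<phi> t ^ k - (\<Sum>l\<le>r. of_nat (k choose l) * R t ^ l) * of_real (gauss a k t))
      \<le> C * (real k * \<bar>t\<bar> ^ (r + 3) + real k ^ Suc r * \<bar>t\<bar> ^ (3 * Suc r)) * gauss b k t"
    by (rule power_gauss_approx[OF a_pos c_pos pi_gt_zero \<phi>_le R_le \<phi>_approx]) (assumption | rule that)+
  define M1 M2 where "M1 = p + r + 3" and "M2 = p + 3 * Suc r"
  have "norm (moment p k - (\<Sum>l\<le>r. of_nat (k choose l) *
      (LINT t:{-pi..pi}|lborel. of_real (t ^ p) * (R t ^ l * of_real (gauss a k t)))))
    \<le> C * (gmom_abs b M1 + gmom_abs b M2) * real k powr - (real (r + p + 2) / 2)" if k: "k \<ge> 1" for k
  proof -
    define e where "e t = complex_of_real (gauss a k t)" for t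
    define S where "S t = (\<Sum>l\<le>r. of_nat (k choose l) * R t ^ l)" for t
    define g where "g t = C * (real k * (\<bar>t\<bar> ^ M1 * gauss b k t)
        + real k ^ Suc r * (\<bar>t\<bar> ^ M2 * gauss b k t))" for t
    have bk: "b * real k > 0" using b k by simp
    have cont_e: "continuous_on {-pi..pi} e" unfolding e_def by (intro continuous_intros)
    have "(\<Sum>l\<le>r. of_nat (k choose l) * (LINT t:{-pi..pi}|lborel. of_real (t ^ p) * (R t ^ l * e t)))
        = (LINT t:{-pi..pi}|lborel. (\<Sum>l\<le>r. of_nat (k choose l) * (of_real (t ^ p) * (R t ^ l * e t))))"
      by (rule set_integral_sum_complex[symmetric]) (intro continuous_intros cont_R cont_e)
    also have "\<dots> = (LINT t:{-pi..pi}|lborel. of_real (t ^ p) * (S t * e t))"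
      by (intro set_lebesgue_integral_cong) (auto simp: S_def sum_distrib_left sum_distrib_right mult_ac)
    finally have "moment p k - (\<Sum>l\<le>r. of_nat (k choose l) * (LINT t:{-pi..pi}|lborel. of_real (t ^ p) * (R t ^ l * e t)))
        = (LINT t:{-pi..pi}|lborel. of_real (t ^ p) * \<phi> t ^ k) - (LINT t:{-pi..pi}|lborel. of_real (t ^ p) * (S t * e t))"
      by (simp add: moment_def)
    also have "\<dots> = (LINT t:{-pi..pi}|lborel. of_real (t ^ p) * \<phi> t ^ k - of_real (t ^ p) * (S t * e t))"
      by (rule set_integral_diff(2)[symmetric])
        (auto intro!: borel_integrable_atLeastAtMost' continuous_intros cont_\<phi> cont_R cont_e simp: S_def)
    also have "norm \<dots> \<le> (LINT t|lborel. g t)"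
    proof (rule norm_set_integral_le)
      show "continuous_on {-pi..pi} (\<lambda>t. of_real (t ^ p) * \<phi> t ^ k - of_real (t ^ p) * (S t * e t))"
        unfolding S_def by (intro continuous_intros cont_\<phi> cont_R cont_e)
      show "integrable lborel g" unfolding g_def
        by (intro integrable_mult_right Bochner_Integration.integrable_add integrable_gauss_moment_abs bk)
      show "g t \<ge> 0" for t unfolding g_def using C by (intro mult_nonneg_nonneg add_nonneg_nonneg) auto
      fix t assume "t \<in> {-pi..pi}"
      then have t: "\<bar>t\<bar> \<le> pi" by auto
      have "norm (of_real (t ^ p) * \<phi> t ^ k - of_real (t ^ p) * (S t * e t)) = \<bar>t\<bar> ^ p * norm (\<phi> t ^ k - S t * e t)"
        unfolding right_diff_distrib[symmetric] by (simp add: norm_mult norm_power)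
      also have "\<dots> \<le> \<bar>t\<bar> ^ p * (C * (real k * \<bar>t\<bar> ^ (r + 3) + real k ^ Suc r * \<bar>t\<bar> ^ (3 * Suc r)) * gauss b k t)"
        using *[OF k t] unfolding S_def e_def by (intro mult_left_mono) auto
      also have "\<dots> = g t"
        unfolding g_def M1_def M2_def add.assoc[of p] power_add[of _ p] by (simp only: distrib_left distrib_right mult_ac)
      finally show "norm (of_real (t ^ p) * \<phi> t ^ k - of_real (t ^ p) * (S t * e t)) \<le> g t" .
    qed
    also have "(LINT t|lborel. g t) = C * (real k * (LINT t|lborel. \<bar>t\<bar> ^ M1 * gauss b k t)
        + real k ^ Suc r * (LINT t|lborel. \<bar>t\<bar> ^ M2 * gauss b k t))"
      unfolding g_def
      by (simp only: integral_mult_right_zero Bochner_Integration.integral_add[OF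
            integrable_mult_right[OF integrable_gauss_moment_abs[OF bk]]
            integrable_mult_right[OF integrable_gauss_moment_abs[OF bk]]])
    also have "\<dots> = C * (gmom_abs b M1 * (real k powr 1 * real k powr - (real (M1 + 1) / 2))
        + gmom_abs b M2 * (real k powr real (Suc r) * real k powr - (real (M2 + 1) / 2)))"
    proof -
      have "real k > 0" using k by simp
      then show ?thesis
        by (simp only: gauss_scale(2) powr_realpow powr_one less_imp_le) (simp only: mult_ac)
    qed
    also have "\<dots> = C * (gmom_abs b M1 + gmom_abs b M2) * real k powr - (real (r + p + 2) / 2)"
    proof -
      have "1 + - (real (M1 + 1) / 2) = - (real (r + p + 2) / 2)"
        "real (Suc r) + - (real (M2 + 1) / 2) = - (real (r + p + 2) / 2)"
        by (simp_all add: M1_def M2_def field_simps)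
      then show ?thesis unfolding powr_add[symmetric] by (simp only: distrib_right mult.assoc distrib_left)
    qed
    finally show ?thesis unfolding e_def .
  qed
  then show ?thesis by blast
qed

text \<open>The correction \<open>R\<close> is itself cubic and can be merged into the error of the
  coarsest approximation; \<open>pi ^ r\<close> arises from
  \<open>\<bar>t\<bar> ^ r \<le> pi ^ r\<close>.\<close>

lemma gauss_like_0: "gauss_like \<phi> (\<lambda>_. 0) a c 0 (K + A * pi ^ r) 0"
proof
  fix t :: real assume t: "\<bar>t\<bar> \<le> pi"
  have A: "A \<ge> 0"
    using order_trans[OF norm_ge_zero \<phi>_approx[of pi]] zero_less_power[OF pi_gt_zero, of "r + 3"]
    by (auto simp: zero_le_mult_iff simp del: power_add)
  have eq: "\<phi> t - of_real (exp (- (a * t\<^sup>2))) = (\<phi> t - of_real (exp (- (a * t\<^sup>2))) * (1 + R t)) + of_real (exp (- (a * t\<^sup>2))) * R t"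
    by (simp add: algebra_simps)
  have "norm (\<phi> t - of_real (exp (- (a * t\<^sup>2)))) \<le> A * \<bar>t\<bar> ^ (r + 3) + exp (- (a * t\<^sup>2)) * norm (R t)"
    by (subst eq, rule order_trans[OF norm_triangle_ineq add_mono[OF \<phi>_approx[OF t]]]) (simp add: norm_mult)
  also have "\<dots> \<le> A * (pi ^ r * \<bar>t\<bar> ^ 3) + 1 * (K * \<bar>t\<bar> ^ 3)"
    using A R_le[OF t] a_pos t by (intro add_mono mult_mono) (auto simp: power_add intro!: mult_right_mono power_mono)
  finally show "norm (\<phi> t - of_real (exp (- (a * t\<^sup>2))) * (1 + 0)) \<le> (K + A * pi ^ r) * \<bar>t\<bar> ^ (0 + 3)"
    by (simp add: algebra_simps)
qed (use cont_\<phi> a_pos c_pos \<phi>_le in auto)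

text \<open>Instance of \<open>moment_approx\<close> without correction terms: only the plain
  Gaussian moment remains, with an error smaller by k^(-1/2).\<close>

lemma moment_leading_term:
  "(\<lambda>k. norm (moment p k - of_real (gmom a p * real k powr - (real (p + 1) / 2)))) \<in> Opow (real (p + 2) / 2)"
proof -
  interpret z: gauss_like \<phi> "\<lambda>_. 0" a c 0 "K + A * pi ^ r" 0 by (rule gauss_like_0)
  obtain C where C: "\<And>k. k \<ge> 1 \<Longrightarrow> norm (moment p k - of_real (trunc_moment a p k)) \<le> C * real k powr - (real (p + 2) / 2)"
  proof -
    have "z.moment p k = moment p k" for k by (simp add: z.moment_def moment_def)
    moreover have "(LINT t:{-pi..pi}|lborel. of_real (t ^ p) * of_real (gauss a k t)) = complex_of_real (trunc_moment a p k)" for k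
      unfolding trunc_moment_def by (simp add: set_lebesgue_integral_def flip: integral_complex_of_real) (simp add: scaleR_conv_of_real)
    ultimately show ?thesis using z.moment_approx[of p] that by auto
  qed
  have 1: "(\<lambda>k. norm (moment p k - of_real (trunc_moment a p k))) \<in> Opow (real (p + 2) / 2)"
    using C by (intro bigoI[where c=C] eventually_mono[OF eventually_ge_at_top[of 1]]) simp
  have 2: "(\<lambda>k. norm (complex_of_real (trunc_moment a p k - gmom a p * real k powr - (real (p + 1) / 2))))
      \<in> Opow (real (p + 2) / 2)"
    using trunc_moment_bigo[OF a_pos] unfolding norm_of_real by (subst landau_o.big.abs_in_iff) auto
  show ?thesis
  proof (rule landau_o.big_mono[THEN landau_o.big_trans, OF _ sum_in_bigo(1)[OF 1 2]])
    show "\<forall>\<^sub>F k in sequentially. norm (norm (moment p k - of_real (gmom a p * real k powr - (real (p + 1) / 2))))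
      \<le> norm (norm (moment p k - of_real (trunc_moment a p k)) +
          norm (complex_of_real (trunc_moment a p k - gmom a p * real k powr - (real (p + 1) / 2))))"
    proof (intro always_eventually allI)
      fix k
      have "moment p k - of_real (gmom a p * real k powr - (real (p + 1) / 2)) =
          (moment p k - of_real (trunc_moment a p k)) + of_real (trunc_moment a p k - gmom a p * real k powr - (real (p + 1) / 2))"
        by simp
      then show "norm (norm (moment p k - of_real (gmom a p * real k powr - (real (p + 1) / 2))))
        \<le> norm (norm (moment p k - of_real (trunc_moment a p k)) +
            norm (complex_of_real (trunc_moment a p k - gmom a p * real k powr - (real (p + 1) / 2))))"
        using norm_triangle_ineq[of "moment p k - of_real (trunc_moment a p k)"] by (simp only: real_norm_def abs_of_nonneg add_nonneg_nonneg norm_ge_zero)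
    qed
  qed
qed

text \<open>\<open>R t ^ l\<close> contributes the factor \<open>t ^ (3 * l)\<close>, so every
  moment that appears with \<open>k choose l\<close> has index at least \<open>2 * l\<close> and
  \<open>expands_trunc_moment\<close> applies. The error is stated uniformly in \<open>p\<close>.
  The factor \<open>z\<close> will be a power of the imaginary unit or a normalising
  constant.\<close>

lemma expands_moment:
  assumes R_eq: "\<And>t. R t = of_real t ^ 3 * poly Q (of_real t)"
  shows "expands half_powr (real (r + 2) / 2) (\<lambda>k. Re (z * moment p k))"
proof -
  define I where "I k l = (LINT t:{-pi..pi}|lborel. of_real (t ^ p) * (R t ^ l * of_real (gauss a k t)))" for k l
  have I_eq: "I k l = (\<Sum>i\<le>degree (Q ^ l). coeff (Q ^ l) i * of_real (trunc_moment a (p + 3 * l + i) k))" for k l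
  proof -
    have "I k l = (LINT t:{-pi..pi}|lborel. (\<Sum>i\<le>degree (Q ^ l). coeff (Q ^ l) i *
        of_real (t ^ (p + 3 * l + i) * gauss a k t)))"
      unfolding I_def
    proof (intro set_lebesgue_integral_cong allI impI)
      fix t :: real
      have "R t ^ l = of_real t ^ (3 * l) * poly (Q ^ l) (of_real t)"
        unfolding R_eq by (simp add: power_mult_distrib power_mult)
      then show "of_real (t ^ p) * (R t ^ l * of_real (gauss a k t)) = (\<Sum>i\<le>degree (Q ^ l). coeff (Q ^ l) i *
        of_real (t ^ (p + 3 * l + i) * gauss a k t))"
        by (simp add: poly_altdef sum_distrib_left sum_distrib_right power_add mult_ac)
    qed simp
    also have "\<dots> = (\<Sum>i\<le>degree (Q ^ l). coeff (Q ^ l) i *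
        (LINT t:{-pi..pi}|lborel. of_real (t ^ (p + 3 * l + i) * gauss a k t)))"
      by (rule set_integral_sum_complex) (intro continuous_intros)
    finally show ?thesis
      by (simp only: trunc_moment_def set_integral_complex_of_real)
  qed
  let ?D = "\<lambda>k. moment p k - (\<Sum>l\<le>r. of_nat (k choose l) * I k l)"
  obtain C where C: "\<And>k. k \<ge> 1 \<Longrightarrow> norm (?D k) \<le> C * real k powr - (real (r + p + 2) / 2)"
    using moment_approx[of p] unfolding I_def by blast
  have "(\<lambda>k. Re (z * ?D k)) \<in> Opow (real (r + p + 2) / 2)"
  proof (intro bigoI[where c="norm z * C"] eventually_mono[OF eventually_ge_at_top[of 1]])
    fix k :: nat assume k: "k \<ge> 1"
    have "\<bar>Re (z * ?D k)\<bar> \<le> norm z * norm (?D k)"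
      by (metis abs_Re_le_cmod norm_mult)
    also have "\<dots> \<le> norm z * (C * real k powr - (real (r + p + 2) / 2))"
      by (intro mult_left_mono C k) auto
    finally show "norm (Re (z * ?D k)) \<le> norm z * C * norm (real k powr - (real (r + p + 2) / 2))"
      by simp
  qed
  then have 1: "expands half_powr (real (r + 2) / 2) (\<lambda>k. Re (z * ?D k))"
    by (intro expands_small, elim bigo_powr_mono) simp
  have 2: "expands half_powr (real (r + 2) / 2) (\<lambda>k. \<Sum>l\<le>r. \<Sum>i\<le>degree (Q ^ l). Re (z * coeff (Q ^ l) i) * (real (k choose l) * trunc_moment a (p + 3 * l + i) k))"
    by (intro expands_sum expands_cmult expands_trunc_moment a_pos) auto
  have "Re (z * (\<Sum>l\<le>r. of_nat (k choose l) * I k l)) = (\<Sum>l\<le>r. \<Sum>i\<le>degree (Q ^ l). Re (z * coeff (Q ^ l) i) * (real (k choose l) * trunc_moment a (p + 3 * l + i) k))" for k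
  proof -
    have "z * (\<Sum>l\<le>r. of_nat (k choose l) * I k l) = (\<Sum>l\<le>r. \<Sum>i\<le>degree (Q ^ l). (z * coeff (Q ^ l) i) * of_real (real (k choose l) * trunc_moment a (p + 3 * l + i) k))"
      unfolding I_eq sum_distrib_left by (intro sum.cong refl) (simp add: mult_ac)
    then show ?thesis by simp
  qed
  with expands_add[OF 1 2] show ?thesis by (simp add: right_diff_distrib)
qed

end

section \<open>The characteristic function\<close>

lemma integral_cis_int:
  "(LINT t:{-pi..pi}|lborel. cis (t * of_int n)) = (if n = 0 then 2 * of_real pi else 0)"
proof (cases "n = 0")
  case True
  then show ?thesis by (simp add: set_lebesgue_integral_def scaleR_conv_of_real)
next
  case False
  define F where "F t = cis (t * of_int n) / (\<i> * of_int n)" for t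
  have F: "(F has_vector_derivative cis (t * of_int n)) (at t within {-pi..pi})" for t
  proof -
    have "((\<lambda>t. cis (t * of_int n)) has_derivative (\<lambda>h. (h * of_int n) *\<^sub>R (\<i> * cis (t * of_int n)))) (at t within {-pi..pi})"
      by (auto intro!: derivative_eq_intros)
    then have "((\<lambda>t. cis (t * of_int n)) has_vector_derivative (of_int n * \<i> * cis (t * of_int n))) (at t within {-pi..pi})"
      unfolding has_vector_derivative_def by (simp add: scaleR_conv_of_real mult_ac)
    from has_vector_derivative_divide[OF this, of "\<i> * of_int n"] show ?thesis
      unfolding F_def using False by simp
  qed
  have "(LINT t:{-pi..pi}|lborel. cis (t * of_int n)) = F pi - F (- pi)"
    unfolding set_lebesgue_integral_def
    by (rule integral_FTC_atLeastAtMost) (auto intro!: F continuous_intros)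
  also have "cis (pi * of_int n) = cis (- pi * of_int n)"
    by (simp add: complex_eq_iff sin_zero_iff_int2)
  then have "F pi - F (- pi) = 0" by (simp add: F_def)
  finally show ?thesis using False by simp
qed

text \<open>\<open>m0\<close> makes \<open>c\<close> a rational n0 / m0. Integrality then says that
  m0 divides n0 m for all m in \<open>S\<close>, hence also n0 times the gcd, even for infinite
  \<open>S\<close>.\<close>

lemma real_mult_Gcd_Ints:
  fixes c :: real and S :: "nat set"
  assumes "\<And>m. m \<in> S \<Longrightarrow> c * real m \<in> \<int>" "m0 \<in> S" "m0 > 0"
  shows "c * real (Gcd S) \<in> \<int>"
proof -
  obtain n0 where n0: "c * real m0 = real_of_int n0" using assms(1)[OF assms(2)] by (elim Ints_cases)
  have c: "c = real_of_int n0 / real m0" using n0 assms(3) by (simp add: eq_divide_eq)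
  have dvd: "int m0 dvd n0 * int m" if m: "m \<in> S" for m
  proof -
    obtain n where n: "c * real m = real_of_int n" using assms(1)[OF m] by (elim Ints_cases)
    then have "real_of_int (n0 * int m) = real_of_int (int m0 * n)"
      using assms(3) unfolding c by (simp add: field_simps)
    then have "n0 * int m = int m0 * n" by (simp only: of_int_eq_iff)
    then show ?thesis by simp
  qed
  have "m0 dvd Gcd ((*) (nat \<bar>n0\<bar>) ` S)"
  proof (rule Gcd_greatest)
    fix b assume "b \<in> (*) (nat \<bar>n0\<bar>) ` S"
    then obtain m where "m \<in> S" "b = nat \<bar>n0\<bar> * m" by auto
    then have "int b = \<bar>n0 * int m\<bar>" by (simp add: abs_mult)
    then have "int m0 dvd int b" using dvd[OF \<open>m \<in> S\<close>] by simp
    then show "m0 dvd b" by simp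
  qed
  then have "m0 dvd nat \<bar>n0\<bar> * Gcd S" by (simp add: Gcd_mult)
  then obtain q where "nat \<bar>n0\<bar> * Gcd S = m0 * q" by (elim dvdE)
  then have "real (nat \<bar>n0\<bar>) * real (Gcd S) = real m0 * real q" by (metis of_nat_mult)
  then have "real_of_int \<bar>n0\<bar> * real (Gcd S) = real q * real m0" by (simp add: mult.commute)
  then have "\<bar>c * real (Gcd S)\<bar> = real q"
    unfolding c using assms(3) by (simp add: abs_mult divide_eq_eq)
  then have "c * real (Gcd S) = real q \<or> c * real (Gcd S) = - real q" by linarith
  then show ?thesis by (elim disjE) simp_all
qed

text \<open>Since \<open>p 0 > 0\<close>, the gcd of the support equals the gcd of its differences,
  that is, the span of the step law.\<close>

locale lattice_law = skip_free_law +
  fixes d r :: nat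
  assumes d_eq: "d = Gcd {m. p m > 0}"
    and moment_summable: "summable (\<lambda>m. p m * \<bar>real m - 1\<bar> ^ (r + 3))"
    and nondegenerate: "\<exists>m\<ge>2. p m > 0"
begin

lemma d_dvd: "p m \<noteq> 0 \<Longrightarrow> d dvd m"
  using p_nonneg[of m] unfolding d_eq by (intro Gcd_dvd) (simp add: less_le)

lemma d_pos: "d > 0"
proof -
  obtain m where "m \<ge> 2" "p m > 0" using nondegenerate by blast
  then have "d dvd m" "m > 0" using d_dvd[of m] by auto
  then show ?thesis by (rule dvd_pos_nat[rotated])
qed

text \<open>The probability of S_k = N - k: the power series records the sum of \<open>k\<close>
  shifted steps.\<close>

definition law :: "nat \<Rightarrow> nat \<Rightarrow> real" where
  "law k N = fps_nth (Abs_fps p ^ k) N"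

lemma law_0: "law 0 N = (if N = 0 then 1 else 0)"
  by (simp add: law_def)

lemma law_Suc: "law (Suc k) N = (\<Sum>i\<le>N. p i * law k (N - i))"
  by (simp add: law_def fps_mult_nth atLeast0AtMost)

lemma law_nonneg: "law k N \<ge> 0"
  by (induction k arbitrary: N) (auto simp: law_0 law_Suc intro!: sum_nonneg mult_nonneg_nonneg p_nonneg)

lemma d_dvd_law: "law k N \<noteq> 0 \<Longrightarrow> d dvd N"
proof (induction k arbitrary: N)
  case (Suc k)
  then obtain i where i: "i \<le> N" "p i * law k (N - i) \<noteq> 0"
    unfolding law_Suc by (auto elim!: sum.not_neutral_contains_not_neutral)
  then have "d dvd i" "d dvd N - i" using Suc.IH d_dvd by auto
  then show ?case using i by (metis dvd_add le_add_diff_inverse)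
qed (auto simp: law_0 split: if_splits)

text \<open>The characteristic function of X / d. Scaling by the span leaves 0 as the only point of
  \<open>[-pi, pi]\<close> where the modulus is one.\<close>

definition charf :: "real \<Rightarrow> complex" where
  "charf t = (\<Sum>m. of_real (p m) * cis (t * ((real m - 1) / real d)))"

lemma charf_sums: "(\<lambda>m. of_real (p m) * cis (t * ((real m - 1) / real d))) sums charf t"
  unfolding charf_def
  by (intro summable_sums summable_norm_cancel[OF summable_comparison_test'[OF sums_summable[OF p_sums], of 0]])
    (simp add: norm_mult p_nonneg)

lemma summable_law: "summable (law k)"
  and law_sums: "(\<lambda>N. of_real (law k N) * cis (t * ((real N - real k) / real d))) sums charf t ^ k"
proof -
  have "summable (law k) \<and>
    (\<lambda>N. of_real (law k N) * cis (t * ((real N - real k) / real d))) sums charf t ^ k" for t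
  proof (induction k)
    case 0
    have "(\<lambda>N. if N = 0 then 1 else 0 :: complex) sums 1" using sums_single[of 0 "\<lambda>_. 1::complex"] by simp
    moreover have "summable (\<lambda>N. if N = 0 then 1 else 0 :: real)" by simp
    moreover have "of_real (law 0 N) * cis (t * ((real N - real 0) / real d)) = (if N = 0 then 1 else 0)" for N
      by (simp add: law_0)
    ultimately show ?case by (simp add: law_0[abs_def])
  next
    case (Suc k)
    let ?a = "\<lambda>m. complex_of_real (p m) * cis (t * ((real m - 1) / real d))"
    let ?b = "\<lambda>N. complex_of_real (law k N) * cis (t * ((real N - real k) / real d))"
    have sum_a: "summable (\<lambda>m. norm (?a m))" and sum_b: "summable (\<lambda>m. norm (?b m))"
      using sums_summable[OF p_sums] Suc.IH by (simp_all add: norm_mult p_nonneg law_nonneg)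
    have "(\<lambda>N. \<Sum>i\<le>N. ?a i * ?b (N - i)) sums (charf t * charf t ^ k)"
      using Cauchy_product_sums[OF sum_a sum_b] charf_sums Suc.IH by (simp add: sums_iff)
    moreover have "(\<Sum>i\<le>N. ?a i * ?b (N - i)) = of_real (law (Suc k) N) * cis (t * ((real N - real (Suc k)) / real d))" for N
      unfolding law_Suc of_real_sum sum_distrib_right
    proof (intro sum.cong refl)
      fix i assume "i \<in> {..N}"
      then have "t * ((real i - 1) / real d) + t * ((real (N - i) - real k) / real d) = t * ((real N - real (Suc k)) / real d)"
        by (simp add: of_nat_diff field_simps add_divide_distrib[symmetric] diff_divide_distrib[symmetric])
      then have "cis (t * ((real N - real (Suc k)) / real d)) = cis (t * ((real i - 1) / real d)) * cis (t * ((real (N - i) - real k) / real d))"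
        unfolding cis_mult by (simp only:)
      then show "?a i * ?b (N - i) = of_real (p i * law k (N - i)) * cis (t * ((real N - real (Suc k)) / real d))"
        by (simp only: of_real_mult mult_ac)
    qed
    moreover have "summable (\<lambda>N. \<Sum>i\<le>N. p i * law k (N - i))"
      using Suc.IH sums_summable[OF p_sums] by (intro sums_summable[OF Cauchy_product_sums]) (auto simp: p_nonneg law_nonneg)
    ultimately show ?case by (simp add: law_Suc[abs_def] del: of_nat_Suc)
  qed
  then show "summable (law k)"
    "(\<lambda>N. of_real (law k N) * cis (t * ((real N - real k) / real d))) sums charf t ^ k" by blast+
qed

text \<open>By the congruence, every \<open>N\<close> with \<open>law k N \<noteq> 0\<close> gives
  an integer frequency (N - k + y) / d, so orthogonality over \<open>[-pi, pi]\<close> selects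
  \<open>N = k - y\<close>.\<close>

lemma fourier_inversion:
  fixes y :: int
  assumes "int d dvd int k - y"
  shows "(LINT t:{-pi..pi}|lborel. cis (t * (of_int y / real d)) * charf t ^ k)
    = 2 * of_real pi * of_real (if y \<le> int k then law k (nat (int k - y)) else 0)"
proof -
  define f where "f N t = indicator {-pi..pi} t *\<^sub>R (complex_of_real (law k N) * cis (t * ((real N - real k + of_int y) / real d)))" for N t
  have int_f: "integrable lborel (f N)" for N
  proof -
    have "continuous_on {-pi..pi} (\<lambda>t. complex_of_real (law k N) * cis (t * ((real N - real k + of_int y) / real d)))"
      by (intro continuous_intros)
    from borel_integrable_atLeastAtMost'[OF this] show ?thesis unfolding f_def set_integrable_def .
  qed
  have norm_f: "norm (f N t) = indicator {-pi..pi} t * law k N" for N t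
    unfolding f_def by (simp add: norm_mult law_nonneg)
  have sums: "(\<lambda>N. f N t) sums (indicator {-pi..pi} t *\<^sub>R (cis (t * (of_int y / real d)) * charf t ^ k))" for t
  proof -
    have "(\<lambda>N. indicator {-pi..pi} t *\<^sub>R (cis (t * (of_int y / real d)) * (of_real (law k N) * cis (t * ((real N - real k) / real d)))))
      sums (indicator {-pi..pi} t *\<^sub>R (cis (t * (of_int y / real d)) * charf t ^ k))"
      by (intro sums_scaleR_right sums_mult law_sums)
    moreover have "cis (t * ((real N - real k + of_int y) / real d)) = cis (t * (of_int y / real d)) * cis (t * ((real N - real k) / real d))" for N
      unfolding cis_mult by (simp add: add_divide_distrib distrib_left add.commute)
    ultimately show ?thesis unfolding f_def by (simp add: mult_ac)
  qed
  have "(\<lambda>N. integral\<^sup>L lborel (f N)) sums (LINT t|lborel. (\<Sum>N. f N t))"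
  proof (rule sums_integral[OF int_f])
    show "AE t in lborel. summable (\<lambda>N. norm (f N t))"
      unfolding norm_f by (intro AE_I2 summable_mult summable_law)
    have "(LINT t|lborel. norm (f N t)) = 2 * pi * law k N" for N
      unfolding norm_f by simp
    then show "summable (\<lambda>N. LINT t|lborel. norm (f N t))"
      by (simp add: summable_mult summable_law)
  qed
  also have "(LINT t|lborel. (\<Sum>N. f N t)) = (LINT t:{-pi..pi}|lborel. cis (t * (of_int y / real d)) * charf t ^ k)"
    unfolding set_lebesgue_integral_def using sums_unique[OF sums] by simp
  finally have 1: "(\<lambda>N. integral\<^sup>L lborel (f N)) sums (LINT t:{-pi..pi}|lborel. cis (t * (of_int y / real d)) * charf t ^ k)" .
  have int_eq: "integral\<^sup>L lborel (f N) = (if int N = int k - y then 2 * of_real pi * of_real (law k N) else 0)" for N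
  proof (cases "law k N = 0")
    case True
    then have "f N = (\<lambda>_. 0)" by (auto simp: f_def)
    with True show ?thesis by simp
  next
    case False
    then have "int d dvd int N" using d_dvd_law by simp
    then have "int d dvd int N - (int k - y)" using assms by (rule dvd_diff)
    then obtain M where M: "int N - (int k - y) = int d * M" by (elim dvdE)
    have "real N - real k + of_int y = of_int (int N - (int k - y))" by simp
    also have "\<dots> = real d * of_int M" unfolding M by simp
    finally have "(real N - real k + of_int y) / real d = of_int M" using d_pos by simp
    then have "integral\<^sup>L lborel (f N) = of_real (law k N) * (LINT t:{-pi..pi}|lborel. cis (t * of_int M))"
      unfolding f_def set_lebesgue_integral_def by (simp flip: integral_mult_right_zero)
    also have "\<dots> = of_real (law k N) * (if M = 0 then 2 * of_real pi else 0)"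
      by (simp only: integral_cis_int)
    also have "M = 0 \<longleftrightarrow> int N = int k - y" using M d_pos by auto
    finally show ?thesis by simp
  qed
  show ?thesis
  proof (cases "y \<le> int k")
    case True
    have "(\<lambda>N. integral\<^sup>L lborel (f N)) sums (2 * of_real pi * of_real (law k (nat (int k - y))))"
    proof -
      have "(\<lambda>N. if N = nat (int k - y) then 2 * complex_of_real pi * of_real (law k N) else 0) sums (2 * of_real pi * of_real (law k (nat (int k - y))))"
        by (rule sums_single)
      moreover have "N = nat (int k - y) \<longleftrightarrow> int N = int k - y" for N using True by auto
      ultimately show ?thesis unfolding int_eq by simp
    qed
    with 1 True show ?thesis using sums_unique2 by fastforce
  next
    case False
    then have "integral\<^sup>L lborel (f N) = 0" for N unfolding int_eq by auto
    then have "(\<lambda>N. integral\<^sup>L lborel (f N)) sums 0" by simp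
    with 1 False show ?thesis using sums_unique2 by fastforce
  qed
qed

lemma hit_fourier:
  assumes "k > 0"
  shows "hit p k x = (if int d dvd int k - int x then real x / real k / (2 * pi) *
    Re (LINT t:{-pi..pi}|lborel. cis (t * (real x / real d)) * charf t ^ k) else 0)"
proof (cases "x \<le> k")
  case True
  have hit: "hit p k x = real x / real k * law k (k - x)"
    unfolding law_def using assms True by (rule hit_eq_fps_power)
  show ?thesis
  proof (cases "int d dvd int k - int x")
    case dvd: True
    have "(LINT t:{-pi..pi}|lborel. cis (t * (real x / real d)) * charf t ^ k) = 2 * of_real pi * of_real (law k (k - x))"
      using fourier_inversion[OF dvd] True by (simp add: nat_diff_distrib)
    then have "Re (LINT t:{-pi..pi}|lborel. cis (t * (real x / real d)) * charf t ^ k) = 2 * pi * law k (k - x)" by simp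
    then show ?thesis using dvd hit by simp
  next
    case False
    have "law k (k - x) = 0"
    proof (rule ccontr)
      assume "law k (k - x) \<noteq> 0"
      then have "int d dvd int (k - x)" using d_dvd_law by simp
      then show False using False True by (simp add: of_nat_diff)
    qed
    then show ?thesis using False hit by simp
  qed
next
  case False
  then have "(LINT t:{-pi..pi}|lborel. cis (t * (real x / real d)) * charf t ^ k) = 0" if "int d dvd int k - int x"
    using fourier_inversion[OF that] by simp
  then show ?thesis using False hit_eq_0[of k x p] by auto
qed

end

section \<open>Taylor expansion and decay of the characteristic function\<close>

context lattice_law
begin

lemma moment_summable_le:
  assumes "j \<le> r + 3"
  shows "summable (\<lambda>m. p m * \<bar>real m - 1\<bar> ^ j)"
proof (rule summable_comparison_test'[where N=0])
  show "summable (\<lambda>m. p m + p m * \<bar>real m - 1\<bar> ^ (r + 3))"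
    by (intro summable_add sums_summable[OF p_sums] moment_summable)
  fix m
  have "\<bar>real m - 1\<bar> ^ j \<le> 1 + \<bar>real m - 1\<bar> ^ (r + 3)"
  proof (cases "\<bar>real m - 1\<bar> \<ge> 1")
    case True
    then show ?thesis using power_increasing[OF assms True] by linarith
  next
    case False
    then have "\<bar>real m - 1\<bar> ^ j \<le> 1" by (intro power_le_one) auto
    then show ?thesis by (simp add: add_increasing2)
  qed
  then have "p m * \<bar>real m - 1\<bar> ^ j \<le> p m * (1 + \<bar>real m - 1\<bar> ^ (r + 3))"
    using p_nonneg by (intro mult_left_mono)
  then show "norm (p m * \<bar>real m - 1\<bar> ^ j) \<le> p m + p m * \<bar>real m - 1\<bar> ^ (r + 3)"
    by (simp add: distrib_left p_nonneg)
qed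

definition mu :: "nat \<Rightarrow> real" where
  "mu j = (\<Sum>m. p m * (real m - 1) ^ j)"

lemma mu_sums: "j \<le> r + 3 \<Longrightarrow> (\<lambda>m. p m * (real m - 1) ^ j) sums mu j"
  unfolding mu_def
  by (intro summable_sums summable_norm_cancel[OF summable_comparison_test'[OF moment_summable_le, of j 0]])
    (auto simp: abs_mult power_abs p_nonneg)

lemma mu_0: "mu 0 = 1"
  using mu_sums[of 0] p_sums sums_unique2 by fastforce

lemma mu_1: "mu 1 = 0"
proof -
  have "(\<lambda>m. real m * p m - p m) sums (1 - 1)"
    by (intro sums_diff mean_sums p_sums)
  moreover have "(\<lambda>m. real m * p m - p m) = (\<lambda>m. p m * (real m - 1) ^ 1)"
    by (auto simp: algebra_simps)
  ultimately show ?thesis using mu_sums[of 1] sums_unique2 by fastforce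
qed

lemma mu_2_pos: "mu 2 > 0"
proof -
  obtain m where m: "m \<ge> 2" "p m > 0" using nondegenerate by blast
  then have "0 < p m * (real m - 1) ^ 2" by simp
  also have "\<dots> \<le> mu 2"
    using sum_le_suminf[OF sums_summable[OF mu_sums[of 2]], of "{m}"] p_nonneg unfolding mu_def by simp
  finally show ?thesis .
qed

text \<open>The pointwise Taylor remainder of the exponential, summed against the law; it costs
  \<open>n + 1\<close> absolute moments, of which \<open>r + 3\<close> are available.\<close>

lemma charf_taylor:
  assumes "n \<le> r + 2"
  shows "\<exists>B. \<forall>t. norm (charf t - (\<Sum>j\<le>n. (\<i> * of_real t / of_nat d) ^ j / fact j * of_real (mu j))) \<le> B * \<bar>t\<bar> ^ Suc n"
proof (intro exI allI)
  fix t
  let ?T = "\<Sum>j\<le>n. (\<i> * of_real t / of_nat d) ^ j / fact j * of_real (mu j)"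
  let ?b = "\<lambda>m. p m * \<bar>real m - 1\<bar> ^ Suc n"
  let ?x = "\<lambda>m. t * ((real m - 1) / real d)"
  let ?g = "\<lambda>m. of_real (p m) * cis (?x m) - (\<Sum>j\<le>n. (\<i> * of_real t / of_nat d) ^ j / fact j * of_real (p m * (real m - 1) ^ j))"
  have sum_b: "summable ?b" using assms by (intro moment_summable_le) auto
  have "(\<lambda>m. ?g m) sums (charf t - ?T)"
    using assms by (intro sums_diff charf_sums sums_sum sums_mult sums_of_real mu_sums) auto
  then have "charf t - ?T = (\<Sum>m. ?g m)"
    by (rule sums_unique)
  also have "norm \<dots> \<le> (\<Sum>m. (\<bar>t\<bar> / real d) ^ Suc n * ?b m)"
  proof (rule norm_suminf_le)
    show "summable (\<lambda>m. (\<bar>t\<bar> / real d) ^ Suc n * ?b m)" by (intro summable_mult sum_b)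
    fix m
    have "?g m = of_real (p m) * (iexp (?x m) - (\<Sum>j\<le>n. (\<i> * of_real (?x m)) ^ j / fact j))"
    proof -
      have "(\<i> * of_real (?x m)) ^ j = (\<i> * of_real t / of_nat d) ^ j * of_real ((real m - 1) ^ j)" for j
      proof -
        have "\<i> * of_real (?x m) = (\<i> * of_real t / of_nat d) * of_real (real m - 1)" by simp
        then show ?thesis by (simp only: power_mult_distrib of_real_power)
      qed
      then show ?thesis
        by (simp only: cis_conv_exp right_diff_distrib sum_distrib_left of_real_mult
            times_divide_eq_left times_divide_eq_right mult_ac)
    qed
    then have "norm (?g m) = p m * norm (iexp (?x m) - (\<Sum>j\<le>n. (\<i> * of_real (?x m)) ^ j / fact j))"
      by (simp only: norm_mult norm_of_real abs_of_nonneg[OF p_nonneg])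
    also have "\<dots> \<le> p m * (\<bar>?x m\<bar> ^ Suc n / fact (Suc n))"
      by (intro mult_left_mono iexp_approx1 p_nonneg)
    also have "\<dots> \<le> p m * \<bar>?x m\<bar> ^ Suc n"
    proof (intro mult_left_mono p_nonneg)
      have "(1::real) \<le> fact (Suc n)" by (rule fact_ge_1)
      then show "\<bar>?x m\<bar> ^ Suc n / fact (Suc n) \<le> \<bar>?x m\<bar> ^ Suc n"
        using divide_left_mono[of 1 "fact (Suc n)" "\<bar>?x m\<bar> ^ Suc n"] by (simp del: fact_Suc power_Suc)
    qed
    also have "\<dots> = (\<bar>t\<bar> / real d) ^ Suc n * ?b m"
      by (simp only: abs_mult abs_divide power_mult_distrib power_divide abs_of_nat times_divide_eq_left times_divide_eq_right mult_ac)
    finally show "norm (?g m) \<le> (\<bar>t\<bar> / real d) ^ Suc n * ?b m" .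
  qed
  also have "\<dots> = (1 / real d) ^ Suc n * suminf ?b * \<bar>t\<bar> ^ Suc n"
    by (subst suminf_mult[OF sum_b]) (simp only: power_divide power_one times_divide_eq_left times_divide_eq_right mult_1_left mult_ac)
  finally show "norm (charf t - ?T)
    \<le> (1 / real d) ^ Suc n * suminf ?b * \<bar>t\<bar> ^ Suc n" .
qed

lemma continuous_on_charf: "continuous_on S charf"
proof (rule continuous_on_subset[OF uniform_limit_theorem])
  show "\<forall>\<^sub>F n in sequentially. continuous_on UNIV (\<lambda>t. \<Sum>m<n. of_real (p m) * cis (t * ((real m - 1) / real d)))"
    by (intro always_eventually allI continuous_intros)
  show "uniform_limit UNIV (\<lambda>n t. \<Sum>m<n. of_real (p m) * cis (t * ((real m - 1) / real d))) charf sequentially"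
    unfolding charf_def[abs_def]
    by (rule Weierstrass_m_test[OF _ sums_summable[OF p_sums]]) (simp add: norm_mult p_nonneg)
qed auto

text \<open>Modulus one would align all phases on the support. Comparing each \<open>m\<close> with
  0, which is in the support, gives t m / (2 pi d) integral; by the gcd property t / (2 pi) is
  integral, impossible for nonzero t in \<open>[-pi, pi]\<close>.\<close>

lemma norm_charf_less_1:
  assumes t: "t \<noteq> 0" "\<bar>t\<bar> \<le> pi"
  shows "norm (charf t) < 1"
proof (rule ccontr)
  assume "\<not> norm (charf t) < 1"
  define \<theta> where "\<theta> = Arg (charf t)"
  let ?y = "\<lambda>m. t * ((real m - 1) / real d) - \<theta>"
  have "cis (- \<theta>) * charf t = of_real (norm (charf t))"
  proof -
    have "charf t = rcis (norm (charf t)) \<theta>" unfolding \<theta>_def by (rule rcis_cmod_Arg[symmetric])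
    then have "cis (- \<theta>) * charf t = cis (- \<theta>) * rcis (norm (charf t)) \<theta>" by simp
    also have "\<dots> = of_real (norm (charf t))" by (simp add: rcis_def cis_mult)
    finally show ?thesis .
  qed
  moreover have "(\<lambda>m. cis (- \<theta>) * (of_real (p m) * cis (t * ((real m - 1) / real d)))) sums (cis (- \<theta>) * charf t)"
    by (intro sums_mult charf_sums)
  moreover have "cis (- \<theta>) * (of_real (p m) * cis (t * ((real m - 1) / real d))) = of_real (p m) * cis (?y m)" for m
    by (simp add: mult.left_commute cis_mult)
  ultimately have "(\<lambda>m. of_real (p m) * cis (?y m)) sums of_real (norm (charf t))" by (simp only:)
  from sums_Re[OF this] have "(\<lambda>m. p m * cos (?y m)) sums norm (charf t)" by simp
  from sums_diff[OF p_sums this] have s: "(\<lambda>m. p m - p m * cos (?y m)) sums (1 - norm (charf t))" .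
  have nonneg: "p m - p m * cos (?y m) \<ge> 0" for m
    using mult_left_mono[OF cos_le_one p_nonneg] by simp
  have cos1: "cos (?y m) = 1" if "p m > 0" for m
  proof -
    have "p m - p m * cos (?y m) \<le> 1 - norm (charf t)"
      using sum_le_suminf[OF sums_summable[OF s], of "{m}"] nonneg sums_unique[OF s] by simp
    then have "p m * (1 - cos (?y m)) \<le> 0" using \<open>\<not> norm (charf t) < 1\<close> by (simp add: right_diff_distrib)
    then have "1 - cos (?y m) \<le> 0" using that by (simp add: mult_le_0_iff)
    then show ?thesis using cos_le_one[of "?y m"] by linarith
  qed
  have int: "t / (2 * pi * real d) * real m \<in> \<int>" if m: "m \<in> {m. p m > 0}" for m
  proof -
    obtain n :: int where n: "?y m = of_int n * 2 * pi"
      using cos1[of m] m unfolding cos_one_2pi_int by blast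
    obtain n0 :: int where n0: "?y 0 = of_int n0 * 2 * pi"
      using cos1[OF p_0] unfolding cos_one_2pi_int by blast
    have "t * real m / real d = ?y m - ?y 0"
      by (simp add: diff_divide_distrib right_diff_distrib)
    also have "\<dots> = (of_int (n - n0)) * (2 * pi)" unfolding n n0 by (simp add: algebra_simps)
    finally have "t * real m / real d / (2 * pi) = of_int (n - n0)" by simp
    then have "t / (2 * pi * real d) * real m = of_int (n - n0)" by (simp add: field_simps)
    then show ?thesis by simp
  qed
  obtain m0 where "m0 \<ge> 2" "p m0 > 0" using nondegenerate by blast
  then have "t / (2 * pi * real d) * real (Gcd {m. p m > 0}) \<in> \<int>"
    by (intro real_mult_Gcd_Ints[OF int, of _ m0]) auto
  then have "t / (2 * pi * real d) * real d \<in> \<int>" by (simp only: d_eq)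
  then have "t / (2 * pi) \<in> \<int>" using d_pos by simp
  then obtain n :: int where n: "t / (2 * pi) = of_int n" by (elim Ints_cases)
  have "\<bar>t / (2 * pi)\<bar> < 1"
    using t pi_gt_zero by (simp add: abs_divide) 
  then have "n = 0" unfolding n by linarith
  then show False using n t by simp
qed

text \<open>Half the variance of X / d, the quadratic coefficient of the matching Gaussian.\<close>

definition a0 :: real where "a0 = mu 2 / (2 * real d ^ 2)"

lemma a0_pos: "a0 > 0"
  unfolding a0_def using mu_2_pos d_pos by simp

text \<open>The quadratic Taylor polynomial gives the bound near 0; on the remaining compact set the
  modulus has a maximum below one.\<close>

lemma norm_charf_le:
  obtains c where "c > 0" "\<And>t. \<bar>t\<bar> \<le> pi \<Longrightarrow> norm (charf t) \<le> exp (- (c * t\<^sup>2))"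
proof -
  obtain B0 where B0: "\<And>t. norm (charf t - (\<Sum>j\<le>2. (\<i> * of_real t / of_nat d) ^ j / fact j * of_real (mu j))) \<le> B0 * \<bar>t\<bar> ^ 3"
    using charf_taylor[of 2] by (auto simp: eval_nat_numeral)
  define B where "B = \<bar>B0\<bar> + 1"
  have B: "norm (charf t - of_real (1 - a0 * t\<^sup>2)) \<le> B * \<bar>t\<bar> ^ 3" for t
  proof -
    have "(\<Sum>j\<le>2. (\<i> * of_real t / of_nat d) ^ j / fact j * of_real (mu j)) = of_real (1 - a0 * t\<^sup>2)"
      using mu_1 by (simp add: eval_nat_numeral mu_0 a0_def power_divide power_mult_distrib field_simps)
    then have "norm (charf t - of_real (1 - a0 * t\<^sup>2)) \<le> B0 * \<bar>t\<bar> ^ 3" using B0[of t] by (simp only:)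
    also have "\<dots> \<le> B * \<bar>t\<bar> ^ 3" by (intro mult_right_mono) (auto simp: B_def)
    finally show ?thesis .
  qed
  \<comment> \<open>Small enough that the cubic error is at most half the quadratic term and that
    \<open>1 - a0 * t\<^sup>2\<close> is nonnegative, hence its own modulus.\<close>
  define \<delta> where "\<delta> = min (min 1 pi) (min (a0 / (2 * B)) (1 / (a0 + 1)))"
  have Bpos: "B > 0" by (simp add: B_def)
  have \<delta>: "\<delta> > 0" "\<delta> \<le> 1" "\<delta> \<le> pi" "B * \<delta> \<le> a0 / 2" "a0 * \<delta> \<le> 1"
  proof -
    show "\<delta> > 0" using a0_pos Bpos by (simp add: \<delta>_def)
    show "\<delta> \<le> 1" "\<delta> \<le> pi" by (simp_all add: \<delta>_def)
    have "\<delta> \<le> a0 / (2 * B)" by (simp add: \<delta>_def)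
    then show "B * \<delta> \<le> a0 / 2" using Bpos by (simp add: field_simps)
    have "\<delta> \<le> 1 / (a0 + 1)" by (simp add: \<delta>_def)
    then have "a0 * \<delta> \<le> a0 * (1 / (a0 + 1))" using a0_pos by (intro mult_left_mono) auto
    also have "\<dots> \<le> 1" using a0_pos by simp
    finally show "a0 * \<delta> \<le> 1" .
  qed
  have near: "norm (charf t) \<le> exp (- (a0 / 2 * t\<^sup>2))" if "\<bar>t\<bar> \<le> \<delta>" for t
  proof -
    have "a0 * t\<^sup>2 \<le> 1"
    proof -
      have "t\<^sup>2 \<le> \<delta> * 1" using that \<delta> unfolding power2_eq_square abs_mult_self_eq[symmetric, of t]
        by (intro mult_mono) auto
      then have "a0 * t\<^sup>2 \<le> a0 * \<delta>" using a0_pos by (intro mult_left_mono) auto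
      then show ?thesis using \<delta>(5) by linarith
    qed
    have "B * \<bar>t\<bar> ^ 3 = B * \<bar>t\<bar> * t\<^sup>2" by (simp add: power3_eq_cube power2_eq_square)
    also have "\<dots> \<le> a0 / 2 * t\<^sup>2"
    proof (intro mult_right_mono)
      show "B * \<bar>t\<bar> \<le> a0 / 2"
        using order_trans[OF mult_left_mono[OF that less_imp_le[OF Bpos]] \<delta>(4)] .
    qed simp
    finally have "B * \<bar>t\<bar> ^ 3 \<le> a0 / 2 * t\<^sup>2" .
    moreover have "norm (charf t) \<le> norm (complex_of_real (1 - a0 * t\<^sup>2)) + B * \<bar>t\<bar> ^ 3"
      using norm_triangle_sub[of "charf t" "of_real (1 - a0 * t\<^sup>2)"] B[of t] by linarith
    moreover have "norm (complex_of_real (1 - a0 * t\<^sup>2)) = 1 - a0 * t\<^sup>2"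
      unfolding norm_of_real using \<open>a0 * t\<^sup>2 \<le> 1\<close> by simp
    ultimately have "norm (charf t) \<le> 1 + - (a0 / 2 * t\<^sup>2)" by simp
    also have "\<dots> \<le> exp (- (a0 / 2 * t\<^sup>2))" by (rule exp_ge_add_one_self)
    finally show ?thesis .
  qed
  have "compact ({-pi..-\<delta>} \<union> {\<delta>..pi})" by (intro compact_Un compact_Icc)
  moreover have "{-pi..-\<delta>} \<union> {\<delta>..pi} \<noteq> {}" using \<delta> by auto
  moreover have "continuous_on ({-pi..-\<delta>} \<union> {\<delta>..pi}) (\<lambda>t. norm (charf t))"
    by (intro continuous_on_norm continuous_on_charf)
  ultimately obtain s where s: "s \<in> {-pi..-\<delta>} \<union> {\<delta>..pi}"
    "\<And>t. t \<in> {-pi..-\<delta>} \<union> {\<delta>..pi} \<Longrightarrow> norm (charf t) \<le> norm (charf s)"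
    using continuous_attains_sup by metis
  have "norm (charf s) < 1" using s(1) \<delta> by (intro norm_charf_less_1) auto
  \<comment> \<open>The lower bound 1/2 keeps the logarithm meaningful if
    \<open>charf s = 0\<close>. The second bound on \<open>c\<close> below yields
    \<open>\<eta> \<le> exp (- (c * pi\<^sup>2))\<close>.\<close>
  define \<eta> where "\<eta> = max (norm (charf s)) (1/2)"
  have \<eta>: "0 < \<eta>" "\<eta> < 1" "norm (charf s) \<le> \<eta>" using \<open>norm (charf s) < 1\<close> by (auto simp: \<eta>_def)
  define c where "c = min (a0 / 2) (- ln \<eta> / pi\<^sup>2)"
  have c_le: "c \<le> a0 / 2" "c \<le> - ln \<eta> / pi\<^sup>2" unfolding c_def by (rule min.cobounded1, rule min.cobounded2)
  have "c > 0" using a0_pos \<eta> by (auto simp: c_def divide_neg_pos)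
  moreover have "norm (charf t) \<le> exp (- (c * t\<^sup>2))" if t: "\<bar>t\<bar> \<le> pi" for t
  proof (cases "\<bar>t\<bar> \<le> \<delta>")
    case True
    have "c * t\<^sup>2 \<le> a0 / 2 * t\<^sup>2" by (intro mult_right_mono c_le) auto
    then have "exp (- (a0 / 2 * t\<^sup>2)) \<le> exp (- (c * t\<^sup>2))" by simp
    then show ?thesis using near[OF True] by linarith
  next
    case False
    then have "t \<in> {-pi..-\<delta>} \<union> {\<delta>..pi}" using t by (auto simp: abs_if split: if_splits)
    from order_trans[OF s(2)[OF this] \<eta>(3)] have "norm (charf t) \<le> \<eta>" .
    also have "\<eta> = exp (ln \<eta>)" using \<eta> by simp
    also have "\<dots> \<le> exp (- (c * t\<^sup>2))"
    proof -
      have "t\<^sup>2 \<le> pi\<^sup>2" using t by (metis abs_ge_zero power2_abs power_mono)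
      then have "c * t\<^sup>2 \<le> c * pi\<^sup>2" using \<open>c > 0\<close> by (intro mult_left_mono) auto
      also have "\<dots> \<le> - ln \<eta> / pi\<^sup>2 * pi\<^sup>2" by (intro mult_right_mono c_le) auto
      also have "\<dots> = - ln \<eta>" by simp
      finally show ?thesis by simp
    qed
    finally show ?thesis .
  qed
  ultimately show ?thesis by (rule that)
qed

text \<open>\<open>J\<close> is the Taylor polynomial of \<open>charf\<close>, \<open>E\<close> the
  truncated series of exp(a0 t^2). So \<open>charf\<close> is close to exp(-a0 t^2) J E, and R = J E
  - 1 is a polynomial correction. Its coefficients below degree 3 vanish by total mass one, mean
  zero and the choice of \<open>a0\<close>.\<close>

lemma ex_gauss_like:
  obtains Q c K A where "gauss_like charf (\<lambda>t. of_real t ^ 3 * poly Q (of_real t)) a0 c K A r"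
proof -
  define J :: "complex poly" where "J = (\<Sum>j\<le>r+2. monom ((\<i> / of_nat d) ^ j / fact j * of_real (mu j)) j)"
  define E :: "complex poly" where "E = (\<Sum>i\<le>r+2. monom (of_real (a0 ^ i / fact i)) (2 * i))"
  have poly_J: "poly J (of_real t) = (\<Sum>j\<le>r+2. (\<i> * of_real t / of_nat d) ^ j / fact j * of_real (mu j))" for t
    unfolding J_def poly_sum poly_monom by (intro sum.cong refl) (simp add: power_mult_distrib power_divide mult_ac)
  have poly_E: "poly E (of_real t) = of_real (\<Sum>i<r+3. (a0 * t\<^sup>2) ^ i / fact i)" for t
    unfolding E_def poly_sum poly_monom of_real_sum
    by (rule sum.cong) (auto simp: power_mult_distrib power_mult)
  have coeff_J: "coeff J i = (if i \<le> r + 2 then (\<i> / of_nat d) ^ i / fact i * of_real (mu i) else 0)" for i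
    unfolding J_def by (simp only: coeff_sum coeff_monom sum.delta finite_atMost atMost_iff)
  have coeff_E: "coeff E i = (if even i \<and> i div 2 \<le> r + 2 then of_real (a0 ^ (i div 2) / fact (i div 2)) else 0)" for i
  proof -
    have "coeff E i = (\<Sum>j\<le>r+2. if j = i div 2 then (if even i then of_real (a0 ^ (i div 2) / fact (i div 2)) else 0) else 0)"
      unfolding E_def coeff_sum coeff_monom by (intro sum.cong refl) auto
    then show ?thesis unfolding sum.delta[OF finite_atMost] by simp
  qed
  have "coeff (J * E - 1) i = 0" if "i < 3" for i
  proof -
    have mu1: "mu (Suc 0) = 0" using mu_1 by simp
    have "i = 0 \<or> i = 1 \<or> i = 2" using that by linarith
    then consider "i = 0" | "i = 1" | "i = 2" by blast
    then show ?thesis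
    proof cases
      case 3
      have "coeff (J * E) 2 = of_real a0 - of_real (mu 2) / (2 * of_nat d ^ 2)"
        by (simp add: coeff_mult coeff_J coeff_E eval_nat_numeral mu1 mu_0 power_divide)
      also have "\<dots> = 0" by (simp add: a0_def)
      finally show ?thesis using 3 by simp
    qed (simp_all add: coeff_mult coeff_J coeff_E mu_0 mu1)
  qed
  then have "monom 1 3 dvd J * E - 1" unfolding monom_1_dvd_iff' by blast
  then obtain Q where Q: "J * E - 1 = monom 1 3 * Q" by (elim dvdE)
  define R where "R t = of_real t ^ 3 * poly Q (complex_of_real t)" for t
  have R: "1 + R t = poly J (of_real t) * poly E (of_real t)" for t
  proof -
    have "poly (J * E - 1) (of_real t) = R t" unfolding Q R_def by (simp add: poly_monom)
    then show ?thesis by (simp add: diff_eq_eq add.commute)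
  qed
  obtain B where B: "\<And>t. norm (charf t - poly J (of_real t)) \<le> B * \<bar>t\<bar> ^ (r + 3)"
  proof -
    have eq: "Suc (r + 2) = r + 3" by simp
    have "\<exists>B. \<forall>t. norm (charf t - poly J (of_real t)) \<le> B * \<bar>t\<bar> ^ (r + 3)"
      unfolding poly_J by (rule charf_taylor[OF order_refl, unfolded eq])
    then show ?thesis using that by blast
  qed
  have bounded: "\<exists>K\<ge>0. \<forall>t. \<bar>t\<bar> \<le> pi \<longrightarrow> norm (poly P (complex_of_real t)) \<le> K" for P
  proof -
    have comp: "compact ((\<lambda>t. poly P (complex_of_real t)) ` {-pi..pi})"
      by (rule compact_continuous_image[OF _ compact_Icc]) (intro continuous_intros)
    obtain K where K: "\<forall>z \<in> (\<lambda>t. poly P (complex_of_real t)) ` {-pi..pi}. norm z \<le> K"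
      using compact_imp_bounded[OF comp] unfolding bounded_iff by (elim exE) (rule that)
    have "norm (poly P (complex_of_real t)) \<le> max K 0" if "\<bar>t\<bar> \<le> pi" for t
    proof -
      have "t \<in> {-pi..pi}" using that by auto
      then have "norm (poly P (complex_of_real t)) \<le> K" by (intro bspec[OF K] imageI)
      then show ?thesis by simp
    qed
    then show ?thesis by (intro exI[of _ "max K 0"]) simp
  qed
  obtain K where K: "K \<ge> 0" "\<And>t. \<bar>t\<bar> \<le> pi \<Longrightarrow> norm (poly Q (complex_of_real t)) \<le> K"
    using bounded[of Q] by blast
  obtain L where L: "L \<ge> 0" "\<And>t. \<bar>t\<bar> \<le> pi \<Longrightarrow> norm (poly J (complex_of_real t)) \<le> L"
    using bounded[of J] by blast
  \<comment> \<open>\<open>B\<close> is the Taylor error. The rest is the truncation error of the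
    exponential, where (a0 t^2)^(r+3) is reduced to \<bar>t\<bar>^(r+3) by
    \<open>t\<^sup>2 \<le> pi * \<bar>t\<bar>\<close>.\<close>
  define A where "A = B + L * (a0 * pi) ^ (r + 3)"
  obtain c where c: "c > 0" "\<And>t. \<bar>t\<bar> \<le> pi \<Longrightarrow> norm (charf t) \<le> exp (- (c * t\<^sup>2))"
    by (rule norm_charf_le) (rule that)
  have "gauss_like charf R a0 c K A r"
  proof
    show "continuous_on {-pi..pi} R" unfolding R_def by (intro continuous_intros)
    fix t :: real assume t: "\<bar>t\<bar> \<le> pi"
    show "norm (R t) \<le> K * \<bar>t\<bar> ^ 3"
      unfolding R_def norm_mult norm_power norm_of_real using K(2)[OF t]
      by (subst mult.commute) (intro mult_right_mono; simp)
    define y where "y = a0 * t\<^sup>2"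
    have y: "y \<ge> 0" using a0_pos by (simp add: y_def)
    \<comment> \<open>The Lagrange remainder contains \<open>exp s\<close> with
      \<open>s \<le> y\<close>, so multiplying by \<open>exp (- y)\<close> leaves a factor at most
      one.\<close>
    obtain s where s: "\<bar>s\<bar> \<le> \<bar>y\<bar>" "exp y = (\<Sum>i<r+3. y ^ i / fact i) + exp s / fact (r + 3) * y ^ (r + 3)"
      using Maclaurin_exp_le[of y "r + 3"] by blast
    have "norm (1 - of_real (exp (- y)) * poly E (of_real t)) \<le> (a0 * pi) ^ (r + 3) * \<bar>t\<bar> ^ (r + 3)"
    proof -
      have "1 - exp (- y) * (\<Sum>i<r+3. y ^ i / fact i) = exp (- y) * (exp y - (\<Sum>i<r+3. y ^ i / fact i))"
        by (simp add: right_diff_distrib flip: exp_add)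
      also have "\<dots> = exp (s - y) / fact (r + 3) * y ^ (r + 3)"
        unfolding s(2) by (simp add: exp_diff exp_minus divide_inverse mult_ac)
      finally have eq: "1 - exp (- y) * (\<Sum>i<r+3. y ^ i / fact i) = exp (s - y) / fact (r + 3) * y ^ (r + 3)" .
      have "exp (s - y) \<le> 1" using s(1) y by simp
      also have "(1::real) \<le> fact (r + 3)" by (rule fact_ge_1)
      finally have "exp (s - y) / fact (r + 3) * y ^ (r + 3) \<le> 1 * y ^ (r + 3)"
        using y by (intro mult_right_mono) (auto simp: divide_le_eq_1)
      also have "y ^ (r + 3) \<le> (a0 * (pi * \<bar>t\<bar>)) ^ (r + 3)"
      proof (intro power_mono y)
        have "t\<^sup>2 \<le> pi * \<bar>t\<bar>" using t unfolding power2_eq_square abs_mult_self_eq[symmetric, of t]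
          by (intro mult_right_mono) auto
        then show "y \<le> a0 * (pi * \<bar>t\<bar>)" unfolding y_def using a0_pos by (intro mult_left_mono) auto
      qed
      finally have "exp (s - y) / fact (r + 3) * y ^ (r + 3) \<le> (a0 * pi) ^ (r + 3) * \<bar>t\<bar> ^ (r + 3)"
        by (simp only: mult_1_left power_mult_distrib mult.assoc)
      moreover have "norm (1 - of_real (exp (- y)) * poly E (of_real t)) = \<bar>1 - exp (- y) * (\<Sum>i<r+3. y ^ i / fact i)\<bar>"
      proof -
        have "1 - of_real (exp (- y)) * poly E (of_real t) = complex_of_real (1 - exp (- y) * (\<Sum>i<r+3. y ^ i / fact i))"
          unfolding poly_E y_def by simp
        then show ?thesis by (simp only: norm_of_real)
      qed
      moreover have "exp (s - y) / fact (r + 3) * y ^ (r + 3) \<ge> 0" using y by simp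
      ultimately show ?thesis unfolding eq by simp
    qed
    then have le: "norm (poly J (of_real t) * (1 - of_real (exp (- y)) * poly E (of_real t))) \<le> L * ((a0 * pi) ^ (r + 3) * \<bar>t\<bar> ^ (r + 3))"
      unfolding norm_mult using L t by (intro mult_mono) auto
    have eq: "charf t - of_real (exp (- (a0 * t\<^sup>2))) * (1 + R t) =
        (charf t - poly J (of_real t)) + poly J (of_real t) * (1 - of_real (exp (- y)) * poly E (of_real t))"
      unfolding R y_def by (simp add: algebra_simps)
    show "norm (charf t - of_real (exp (- (a0 * t\<^sup>2))) * (1 + R t)) \<le> A * \<bar>t\<bar> ^ (r + 3)"
      unfolding eq A_def distrib_right mult.assoc by (rule order_trans[OF norm_triangle_ineq add_mono[OF B le]])
  qed (use c a0_pos continuous_on_charf in auto)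
  moreover have "R = (\<lambda>t. of_real t ^ 3 * poly Q (of_real t))" by (simp add: R_def fun_eq_iff)
  ultimately have "gauss_like charf (\<lambda>t. of_real t ^ 3 * poly Q (of_real t)) a0 c K A r" by (simp only:)
  then show ?thesis by (rule that)
qed

end

section \<open>Expansion of the hitting probabilities\<close>

definition lazy_step :: "nat \<Rightarrow> real" where
  "lazy_step m = (if m = 1 then 1/2 else if m \<le> 2 then 1/4 else 0)"

lemma lazy_step_fps: "Abs_fps lazy_step = fps_const (1/4) * (1 + fps_X) ^ 2"
proof (rule fps_ext)
  fix n :: nat
  have "(1 + fps_X :: real fps) ^ 2 = fps_binomial 2" using fps_binomial_of_nat[of 2, where 'a=real] by simp
  moreover have "(2::real) gchoose n = real (2 choose n)" using binomial_gbinomial[of 2 n, where 'a=real] by simp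
  moreover have "real (2 choose n) = 4 * lazy_step n"
  proof (cases "n \<le> 2")
    case True
    then have "n = 0 \<or> n = 1 \<or> n = 2" by auto
    then show ?thesis by (auto simp: lazy_step_def)
  qed (simp add: lazy_step_def binomial_eq_0)
  ultimately show "fps_nth (Abs_fps lazy_step) n = fps_nth (fps_const (1/4) * (1 + fps_X) ^ 2) n"
    by simp
qed

text \<open>The generating function of a step is ((1 + s) / 2)^2, so the return probability is (2k
  choose k) / 4^k, which is the coefficient of s^k in (1 - s)^(-1/2). Laziness gives span one, so no
  parity restriction intervenes.\<close>

lemma lazy_step_power_nth: "fps_nth (Abs_fps lazy_step ^ k) k = acoeff 1 k"
proof -
  have "Abs_fps lazy_step ^ k = fps_const ((1/4) ^ k) * fps_binomial (real (2 * k))"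
    unfolding lazy_step_fps power_mult_distrib power_mult[symmetric] fps_binomial_of_nat by (simp add: fps_const_power)
  then have "fps_nth (Abs_fps lazy_step ^ k) k = (1/4) ^ k * real ((2 * k) choose k)"
    using binomial_gbinomial[of "2 * k" k, where 'a=real] by simp
  also have "\<dots> = (1/4) ^ k * (fact (2 * k) / (fact k * fact k))"
    by (subst binomial_fact) (auto simp: mult_2)
  also have "\<dots> = (1/4) ^ k * (2 ^ (2 * k) * pochhammer (1 / 2) k * fact k / (fact k * fact k))"
    by (subst fact_double) simp
  also have "\<dots> = pochhammer (1 / 2) k / fact k"
  proof -
    have "(2::real) ^ (2 * k) = 4 ^ k" by (simp add: power_mult)
    then show ?thesis by (simp add: power_one_over)
  qed
  also have "\<dots> = acoeff 1 k"
    unfolding acoeff_gchoose gbinomial_pochhammer by (cases "even k") simp_all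
  finally show ?thesis .
qed

lemma lattice_law_lazy_step: "lattice_law lazy_step 1 r"
proof
  have sums: "(\<lambda>m. lazy_step m * f m) sums (f 0 / 4 + f 1 / 2 + f 2 / 4)" for f
  proof -
    have "(\<lambda>m. lazy_step m * f m) sums (\<Sum>m\<in>{0,1,2}. lazy_step m * f m)"
    proof (rule sums_finite)
      fix m :: nat assume "m \<notin> {0,1,2}"
      then have "m \<noteq> 1" "\<not> m \<le> 2" by auto
      then show "lazy_step m * f m = 0" unfolding lazy_step_def by simp
    qed simp
    also have "(\<Sum>m\<in>{0,1,2}. lazy_step m * f m) = f 0 / 4 + f 1 / 2 + f 2 / 4"
      by (simp add: lazy_step_def add.assoc)
    finally show ?thesis .
  qed
  show "lazy_step m \<ge> 0" for m by (simp add: lazy_step_def)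
  show "lazy_step sums 1" using sums[of "\<lambda>_. 1"] by simp
  show "(\<lambda>m. real m * lazy_step m) sums 1" using sums[of real] by (simp add: mult.commute[of _ "lazy_step _"])
  show "lazy_step 0 > 0" by (simp add: lazy_step_def)
  show "\<exists>m\<ge>2. lazy_step m > 0" by (intro exI[of _ 2]) (simp add: lazy_step_def)
  show "summable (\<lambda>m. lazy_step m * \<bar>real m - 1\<bar> ^ (r + 3))" using sums_summable[OF sums[of "\<lambda>m. \<bar>real m - 1\<bar> ^ (r + 3)"]] .
  have "Gcd {m. lazy_step m > 0} dvd 1" by (rule Gcd_dvd) (simp add: lazy_step_def)
  then show "1 = Gcd {m. lazy_step m > 0}" unfolding nat_dvd_1_iff_1 by (rule sym)
qed

lemma expands_half_powr_acoeff_1: "expands half_powr \<rho> (acoeff 1)"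
proof -
  \<comment> \<open>The lazy walk has bounded steps, so the number of moments may be chosen to suit
    the desired error.\<close>
  define r where "r = nat \<lceil>2 * \<rho>\<rceil>"
  interpret lattice_law lazy_step 1 r by (rule lattice_law_lazy_step)
  obtain Q c K A where "gauss_like charf (\<lambda>t. of_real t ^ 3 * poly Q (of_real t)) a0 c K A r"
    by (rule ex_gauss_like)
  then interpret g: gauss_like charf "\<lambda>t. of_real t ^ 3 * poly Q (of_real t)" a0 c K A r .
  have "acoeff 1 k = Re (complex_of_real (1 / (2 * pi)) * g.moment 0 k)" for k
    using fourier_inversion[of k 0] unfolding g.moment_def
    by (simp add: law_def lazy_step_power_nth)
  moreover have "expands half_powr (real (r + 2) / 2) (\<lambda>k. Re (complex_of_real (1 / (2 * pi)) * g.moment 0 k))"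
    by (rule g.expands_moment[OF refl])
  ultimately have "expands half_powr (real (r + 2) / 2) (\<lambda>k. acoeff 1 k)" by (simp only:)
  then show ?thesis
  proof (rule expands_mono)
    show "\<rho> \<le> real (r + 2) / 2" using real_nat_ceiling_ge[of "2 * \<rho>"] unfolding r_def by simp
  qed
qed

lemma expands_half_powr_imp_acs: "expands half_powr \<rho> f \<Longrightarrow> expands acs \<rho> f"
  by (erule expands_trans) (intro expands_acoeff_half_powr expands_half_powr_acoeff_1)

lemma bigo_acs_sum:
  assumes "\<And>j. j \<in> S \<Longrightarrow> \<alpha> \<le> real j + 1/2"
  shows "(\<lambda>k. \<Sum>j\<in>S. c j * acs j k) \<in> Opow \<alpha>"
proof (rule big_sum_in_bigo)
  fix j assume "j \<in> S"
  then have "acs j \<in> Opow \<alpha>" using assms[of j] by (intro bigo_powr_mono[OF acoeff_bigo]) simp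
  then show "(\<lambda>k. c j * acs j k) \<in> Opow \<alpha>" by (cases "c j = 0") auto
qed

lemma powr_not_bigo:
  assumes "(\<lambda>k. c * real k powr - \<alpha>) \<in> Opow \<beta>" "\<alpha> < \<beta>"
  shows "c = 0"
proof -
  have "(\<lambda>k. c * real k powr - \<alpha> * real k powr \<alpha>) \<in> Opow (\<beta> - \<alpha>)"
    by (rule bigo_powr_mult[OF assms(1) landau_o.big_refl]) simp
  then have l0: "(\<lambda>k. c * real k powr - \<alpha> * real k powr \<alpha>) \<longlonglongrightarrow> 0"
    by (rule bigo_powr_tendsto_0) (use assms(2) in simp)
  have lc: "(\<lambda>k. c * real k powr - \<alpha> * real k powr \<alpha>) \<longlonglongrightarrow> c"
  proof (rule tendsto_eventually)
    show "\<forall>\<^sub>F k in sequentially. c * real k powr - \<alpha> * real k powr \<alpha> = c"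
    proof (rule eventually_mono[OF eventually_gt_at_top[of 0]])
      fix k :: nat assume "k > 0"
      then have "real k powr - \<alpha> * real k powr \<alpha> = 1" by (simp only: powr_add[symmetric]) simp
      then show "c * real k powr - \<alpha> * real k powr \<alpha> = c" by (simp only: mult.assoc mult_1_right)
    qed
  qed
  show ?thesis by (rule LIMSEQ_unique[OF lc l0])
qed

section \<open>Which coefficients occur in the expansion of a moment\<close>

context gauss_like
begin

text \<open>The expansion exists by change of basis; the range and the vanishing of coefficients
  follow from orders alone. Terms beyond \<open>r div 2 + 1\<close> are within the error, those with
  \<open>2 * j < p + 2\<close> would exceed the size of the moment divided by \<open>k\<close>, and
  for even \<open>p\<close> the next one carries the nonzero Gaussian term.\<close>

lemma moment_expansion:
  assumes R_eq: "\<And>t. R t = of_real t ^ 3 * poly Q (of_real t)" and "p \<le> r"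
  obtains \<delta> where
    "(\<lambda>k. Re (\<i> ^ p * moment p k) / real k - (\<Sum>j=1..r div 2 + 1. \<delta> j * acs j k)) \<in> Opow (real (r + 4) / 2)"
    "\<And>j. 2 * j < p + 2 \<Longrightarrow> \<delta> j = 0"
    "even p \<Longrightarrow> \<delta> (p div 2 + 1) \<noteq> 0"
proof -
  define J where "J = r div 2 + 1"
  define \<rho> where "\<rho> = real (r + 2) / 2"
  have \<rho>1: "\<rho> + 1 = real (r + 4) / 2" by (simp add: \<rho>_def field_simps)
  define f where "f k = Re (\<i> ^ p * moment p k)" for k
  have "expands acs (\<rho> + 1) (\<lambda>k. f k / real k)"
    unfolding f_def \<rho>_def by (intro expands_div expands_half_powr_imp_acs expands_moment[OF R_eq])
  then obtain c0 M where c0: "(\<lambda>k. f k / real k - (\<Sum>j<M. c0 j * acs j k)) \<in> Opow (\<rho> + 1)"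
    unfolding expands_def by blast
  define c where "c j = (if j < M then c0 j else 0)" for j
  define S where "S k = (\<Sum>j<Suc J. c j * acs j k)" for k
  have err: "(\<lambda>k. f k / real k - S k) \<in> Opow (\<rho> + 1)"
  proof -
    have "(\<Sum>j<M. c0 j * acs j k) = S k + (\<Sum>j=Suc J..<max M (Suc J). c j * acs j k)" for k
    proof -
      have "(\<Sum>j<M. c0 j * acs j k) = (\<Sum>j<max M (Suc J). c j * acs j k)"
        by (intro sum.mono_neutral_cong_left) (auto simp: c_def)
      also have "{..<max M (Suc J)} = {..<Suc J} \<union> {Suc J..<max M (Suc J)}" by auto
      also have "(\<Sum>j\<in>\<dots>. c j * acs j k) = S k + (\<Sum>j=Suc J..<max M (Suc J). c j * acs j k)"
        unfolding S_def by (intro sum.union_disjoint) auto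
      finally show ?thesis .
    qed
    then have eq: "f k / real k - S k = (f k / real k - (\<Sum>j<M. c0 j * acs j k)) + (\<Sum>j=Suc J..<max M (Suc J). c j * acs j k)" for k
      by simp
    have "\<rho> + 1 \<le> real j + 1/2" if "j \<in> {Suc J..<max M (Suc J)}" for j
    proof -
      have "r + 3 \<le> 2 * j" using that unfolding J_def by auto
      then have "real (r + 3) \<le> real (2 * j)" by (simp only: of_nat_le_iff)
      then show ?thesis by (simp add: \<rho>_def field_simps)
    qed
    then show ?thesis unfolding eq by (intro sum_in_bigo(1)[OF c0] bigo_acs_sum)
  qed
  define \<mu> where "\<mu> = gmom a p"
  let ?lead = "\<lambda>k. Re (\<i> ^ p) * \<mu> * real k powr - (real (p + 1) / 2)"
  have f_lead: "(\<lambda>k. f k - ?lead k) \<in> Opow (real (p + 2) / 2)"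
  proof (rule landau_o.big_trans[OF bigoI[where c=1] moment_leading_term[of p]], intro always_eventually allI)
    fix k
    let ?z = "moment p k - of_real (gmom a p * real k powr - (real (p + 1) / 2))"
    have "f k - ?lead k = Re (\<i> ^ p * ?z)"
      unfolding f_def \<mu>_def right_diff_distrib by (simp add: mult_ac)
    also have "\<bar>\<dots>\<bar> \<le> norm (\<i> ^ p * ?z)" by (rule abs_Re_le_cmod)
    also have "\<dots> = norm ?z" by (simp add: norm_mult norm_power)
    finally show "norm (f k - ?lead k) \<le> 1 * norm (norm ?z)" by simp
  qed
  have f_bigo: "f \<in> Opow (real (p + 1) / 2)"
  proof -
    have "(\<lambda>k. (f k - ?lead k) + ?lead k)
        \<in> Opow (real (p + 1) / 2)"
      by (intro sum_in_bigo(1) bigo_powr_mono[OF f_lead]) auto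
    then show ?thesis by simp
  qed
  have S_bigo: "S \<in> Opow (real (p + 3) / 2)"
  proof -
    have "(\<lambda>k. f k * inverse (real k)) \<in> Opow (real (p + 3) / 2)"
      by (rule bigo_powr_mult[OF f_bigo inverse_bigo]) (simp add: field_simps)
    then have "(\<lambda>k. f k / real k) \<in> Opow (real (p + 3) / 2)"
      by (simp only: divide_inverse[of "f _"])
    moreover have "(\<lambda>k. f k / real k - S k) \<in> Opow (real (p + 3) / 2)"
      using \<open>p \<le> r\<close> by (intro bigo_powr_mono[OF err]) (simp add: \<rho>_def field_simps)
    ultimately have "(\<lambda>k. f k / real k - (f k / real k - S k)) \<in> Opow (real (p + 3) / 2)"
      by (rule sum_in_bigo(2))
    then show ?thesis by (simp only: diff_diff_eq2 add_diff_cancel_left')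
  qed
  have c_zero: "c j = 0" if "2 * j < p + 2" for j
  proof (rule acoeff_sum_coeff_eq_0[OF S_bigo[unfolded S_def[abs_def]]])
    show "j < Suc J" using that \<open>p \<le> r\<close> unfolding J_def by linarith
    have "real (2 * j) < real (p + 2)" using that by (simp only: of_nat_less_iff)
    then show "real j + 1/2 < real (p + 3) / 2" by (simp add: field_simps)
  qed
  \<comment> \<open>Otherwise, with p = 2 i, \<open>f k / k\<close> would be of order k^(-(i+2)),
    whereas its leading term is a nonzero multiple of k^(-(i+3/2)). For even \<open>p\<close> the
    power of the imaginary unit is real, so that term survives in the real part.\<close>
  have c_nonzero: "c (p div 2 + 1) \<noteq> 0" if "even p"
  proof
    assume c0: "c (p div 2 + 1) = 0"
    obtain i where i: "p = 2 * i" using \<open>even p\<close> by (elim evenE)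
    have "S k = (\<Sum>j=i+2..<Suc J. c j * acs j k)" for k
    proof -
      have "c j = 0" if "j < i + 2" for j
        using c_zero[of j] c0 that i by (cases "j = i + 1") auto
      then show ?thesis unfolding S_def by (intro sum.mono_neutral_right) auto
    qed
    then have "S = (\<lambda>k. \<Sum>j=i+2..<Suc J. c j * acs j k)" by (rule ext)
    moreover have "(\<lambda>k. \<Sum>j=i+2..<Suc J. c j * acs j k) \<in> Opow (real i + 2)"
      by (rule bigo_acs_sum) auto
    ultimately have "S \<in> Opow (real i + 2)" by (simp only:)
    then have "S \<in> Opow (real i + 2)" .
    moreover have "(\<lambda>k. f k / real k - S k) \<in> Opow (real i + 2)"
      using \<open>p \<le> r\<close> i by (intro bigo_powr_mono[OF err]) (simp add: \<rho>_def field_simps)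
    ultimately have "(\<lambda>k. (f k / real k - S k) + S k) \<in> Opow (real i + 2)"
      by (intro sum_in_bigo(1))
    then have "(\<lambda>k. f k / real k) \<in> Opow (real i + 2)" by simp
    then have "(\<lambda>k. f k / real k * real k powr 1) \<in> Opow (real i + 1)"
      by (rule bigo_powr_mult[OF _ landau_o.big_refl]) simp
    also have "?this \<longleftrightarrow> f \<in> Opow (real i + 1)"
      by (intro landau_o.big.in_cong eventually_mono[OF eventually_gt_at_top[of 0]]) simp
    finally have "f \<in> Opow (real i + 1)" .
    moreover have "(\<lambda>k. f k - ?lead k) \<in> Opow (real i + 1)"
      using i by (intro bigo_powr_mono[OF f_lead]) simp
    ultimately have "(\<lambda>k. f k - (f k - ?lead k)) \<in> Opow (real i + 1)"
      by (rule sum_in_bigo(2))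
    then have "(\<lambda>k. Re (\<i> ^ p) * \<mu> * real k powr - (real (p + 1) / 2)) \<in> Opow (real i + 1)"
      by (simp only: diff_diff_eq2 add_diff_cancel_left')
    then have "Re (\<i> ^ p) * \<mu> = 0" by (rule powr_not_bigo) (simp add: i)
    moreover have "\<mu> > 0" unfolding \<mu>_def i by (rule gmom_even_pos[OF a_pos])
    moreover have "Re (\<i> ^ p) \<noteq> 0" by (cases "even i") (simp_all add: i power_mult)
    ultimately show False by simp
  qed
  have S_eq: "S k = (\<Sum>j=1..r div 2 + 1. c j * acs j k)" for k
    unfolding S_def J_def[symmetric]
  proof (rule sum.mono_neutral_right)
    show "\<forall>j\<in>{..<Suc J} - {1..J}. c j * acs j k = 0"
    proof
      fix j assume "j \<in> {..<Suc J} - {1..J}"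
      then have "j = 0" by auto
      then show "c j * acs j k = 0" using c_zero[of 0] by simp
    qed
  qed auto
  show ?thesis
  proof (rule that[of c])
    show "(\<lambda>k. Re (\<i> ^ p * moment p k) / real k - (\<Sum>j=1..r div 2 + 1. c j * acs j k)) \<in> Opow (real (r + 4) / 2)"
      using err unfolding S_eq f_def \<rho>1 .
    show "c j = 0" if "2 * j < p + 2" for j using that by (rule c_zero)
    show "c (p div 2 + 1) \<noteq> 0" if "even p" using that by (rule c_nonzero)
  qed
qed

end

section \<open>Tail sums over all times and over one residue class\<close>

lemma sums_acs_tail:
  assumes "j \<ge> 1"
  shows "(\<lambda>k. acs j (k + Suc n)) sums (- acoeff j n)"
proof -
  have "acoeff j \<in> Opow (1/2)"
    using assms by (intro bigo_powr_mono[OF acoeff_bigo]) auto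
  then have "acoeff j \<longlonglongrightarrow> 0" by (rule bigo_powr_tendsto_0) simp
  then have "(\<lambda>k. acoeff j (k + n)) \<longlonglongrightarrow> 0" by (rule LIMSEQ_ignore_initial_segment)
  from telescope_sums[OF this] have "(\<lambda>k. acoeff j (Suc k + n) - acoeff j (k + n)) sums (0 - acoeff j (0 + n))" .
  moreover have "acoeff j (Suc k + n) - acoeff j (k + n) = acs j (k + Suc n)" for k
    using acoeff_diff[of j "k + n"] by simp
  ultimately show ?thesis by simp
qed

text \<open>Comparison with the telescoping differences of x^(-\<rho>) by the mean value
  theorem.\<close>

lemma powr_tail:
  assumes "\<rho> > 0" "n \<ge> 1"
  shows "summable (\<lambda>k. real (k + Suc n) powr - (\<rho> + 1))"
    and "(\<Sum>k. real (k + Suc n) powr - (\<rho> + 1)) \<le> real n powr - \<rho> / \<rho>"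
proof -
  define f where "f x = x powr - \<rho>" for x :: real
  have le: "real (k + Suc n) powr - (\<rho> + 1) \<le> (f (real (k + n)) - f (real (Suc k + n))) / \<rho>" for k
  proof -
    let ?x = "real (k + n)"
    have x: "?x > 0" using assms by simp
    have "\<exists>z>?x. z < ?x + 1 \<and> f (?x + 1) - f ?x = (?x + 1 - ?x) * (- \<rho> * z powr (- \<rho> - 1))"
      unfolding f_def
    proof (rule MVT2)
      fix z :: real assume "?x \<le> z"
      then have "z > 0" using x by linarith
      then show "((\<lambda>x. x powr - \<rho>) has_real_derivative - \<rho> * z powr (- \<rho> - 1)) (at z)"
        by (rule has_real_derivative_powr)
    qed simp
    then obtain z where z: "?x < z" "z < ?x + 1" "f (?x + 1) - f ?x = - \<rho> * z powr (- \<rho> - 1)" by auto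
    have pz: "(?x + 1) powr (- \<rho> - 1) \<le> z powr (- \<rho> - 1)"
      using z x assms by (intro powr_mono2') auto
    have "\<rho> * (?x + 1) powr (- \<rho> - 1) \<le> f ?x - f (?x + 1)"
      using mult_left_mono[OF pz less_imp_le[OF assms(1)]] z(3) by (simp only: mult_minus_left)
    moreover have "?x + 1 = real (k + Suc n)" "?x + 1 = real (Suc k + n)" "- \<rho> - 1 = - (\<rho> + 1)" by simp_all
    ultimately have "\<rho> * real (k + Suc n) powr - (\<rho> + 1) \<le> f ?x - f (real (Suc k + n))" by (simp only:)
    then show ?thesis using assms(1) by (simp only: pos_le_divide_eq mult.commute)
  qed
  have "(\<lambda>k. real k powr - \<rho>) \<longlonglongrightarrow> 0"
    using assms(1) by (intro tendsto_neg_powr filterlim_real_sequentially) auto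
  then have "(\<lambda>k. f (real (k + n))) \<longlonglongrightarrow> 0"
    unfolding f_def by (rule LIMSEQ_ignore_initial_segment)
  from sums_divide[OF telescope_sums'[OF this], of \<rho>]
  have sums: "(\<lambda>k. (f (real (k + n)) - f (real (Suc k + n))) / \<rho>) sums (real n powr - \<rho> / \<rho>)"
    by (simp add: f_def)
  show summ: "summable (\<lambda>k. real (k + Suc n) powr - (\<rho> + 1))"
    by (rule summable_comparison_test'[OF sums_summable[OF sums], of 0]) (use le in simp)
  show "(\<Sum>k. real (k + Suc n) powr - (\<rho> + 1)) \<le> real n powr - \<rho> / \<rho>"
    using suminf_le[OF le summ sums_summable[OF sums]] sums_unique[OF sums] by simp
qed

lemma bigoE_nat:
  fixes f g :: "nat \<Rightarrow> real"
  assumes "f \<in> O(g)" "\<And>k. g k \<ge> 0"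
  obtains C N where "C \<ge> 0" "\<And>k. k \<ge> N \<Longrightarrow> \<bar>f k\<bar> \<le> C * g k"
proof -
  obtain c where c: "c > 0" "\<forall>\<^sub>F k in sequentially. norm (f k) \<le> c * norm (g k)"
    using assms(1) by (elim landau_o.bigE)
  then obtain N where "\<And>k. k \<ge> N \<Longrightarrow> norm (f k) \<le> c * norm (g k)"
    unfolding eventually_sequentially by blast
  then show ?thesis using that[of c N] c(1) assms(2) by auto
qed

text \<open>Summation by parts against the bounded sequence \<open>W\<close> bounds the effect of the periodicity of
  the walk on the tail sums.\<close>

lemma dvd_indicator_increment:
  fixes x :: int
  assumes "d > 0"
  defines "W \<equiv> \<lambda>k::nat. - real_of_int ((int k - x) mod int d) / real d"
  shows "(if int d dvd int (Suc k) - x then 1 else 0) = 1 / real d + W (Suc k) - W k" "\<bar>W k\<bar> \<le> 1"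
proof -
  define m where "m = (int k - x) mod int d"
  have m: "0 \<le> m" "m < int d" using assms(1) by (auto simp: m_def)
  have "(int (Suc k) - x) mod int d = (m + 1) mod int d"
    unfolding m_def by (simp add: mod_simps algebra_simps)
  also have "\<dots> = (if m + 1 = int d then 0 else m + 1)"
    using m by (auto intro: mod_pos_pos_trivial)
  finally have eq: "(int (Suc k) - x) mod int d = (if m + 1 = int d then 0 else m + 1)" .
  have dvd: "int d dvd int (Suc k) - x \<longleftrightarrow> m + 1 = int d"
    unfolding dvd_eq_mod_eq_0 eq using m by auto
  show "(if int d dvd int (Suc k) - x then 1 else 0) = 1 / real d + W (Suc k) - W k"
  proof (cases "m + 1 = int d")
    case True
    then have "real_of_int m = real d - 1" by linarith
    then have "1 / real d + real_of_int m / real d = 1"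
      using assms(1) by (simp flip: add_divide_distrib)
    then show ?thesis unfolding W_def eq dvd m_def[symmetric] using True by simp
  next
    case False
    then show ?thesis unfolding W_def eq dvd m_def[symmetric] by (simp add: add_divide_distrib diff_divide_distrib)
  qed
  have "real_of_int m \<le> real d" using m by linarith
  then show "\<bar>W k\<bar> \<le> 1" unfolding W_def m_def[symmetric] using m assms(1) by simp
qed

text \<open>The indicator of the residue class is its mean 1/d plus the increment of a bounded
  sequence. The mean gives the main term; summation by parts leaves a boundary term of size
  \<open>acs 1\<close> and a sum of terms of size \<open>acs 2\<close>, both of order n^(-3/2). The
  bound on \<open>W\<close> does not involve \<open>x\<close>, which makes this uniform.\<close>

lemma periodic_acs_tail:
  assumes d: "d > 0"
  obtains C N where "C \<ge> 0" "\<And>n x. n \<ge> N \<Longrightarrow> \<exists>T. (\<lambda>k. if int d dvd int (k + Suc n) - x then acs 1 (k + Suc n) else 0) sums T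
      \<and> \<bar>T + acoeff 1 n / real d\<bar> \<le> C * real n powr - (3/2)"
proof -
  have "acs 1 \<in> Opow (3/2)" "acs 2 \<in> Opow (5/2)"
    by (auto intro!: bigo_powr_mono[OF acoeff_bigo])
  then obtain C1 N1 C2 N2 where
    C1: "C1 \<ge> 0" "\<And>k. k \<ge> N1 \<Longrightarrow> \<bar>acs 1 k\<bar> \<le> C1 * real k powr - (3/2)" and
    C2: "C2 \<ge> 0" "\<And>k. k \<ge> N2 \<Longrightarrow> \<bar>acs 2 k\<bar> \<le> C2 * real k powr - (5/2)"
    by (metis bigoE_nat powr_ge_zero)
  have "\<exists>T. (\<lambda>k. if int d dvd int (k + Suc n) - x then acs 1 (k + Suc n) else 0) sums T
      \<and> \<bar>T + acoeff 1 n / real d\<bar> \<le> (C1 + C2) * real n powr - (3/2)"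
    if n: "n \<ge> max 1 (max N1 N2)" for n x
  proof -
    let ?\<chi> = "\<lambda>k. if int d dvd int (k + Suc n) - x then acs 1 (k + Suc n) else 0"
    define W where "W k = - real_of_int ((int k - x) mod int d) / real d" for k :: nat
    have W: "(if int d dvd int (Suc k) - x then 1 else 0) = 1 / real d + W (Suc k) - W k" "\<bar>W k\<bar> \<le> 1" for k
      using dvd_indicator_increment[OF d, of k x] unfolding W_def by auto
    \<comment> \<open>The remainder of the summation by parts: \<open>acs 2\<close> is the increment
      of \<open>acs 1\<close>, one power of \<open>k\<close> smaller.\<close>
    define e where "e k = W (Suc (k + n)) * acs 2 (Suc k + Suc n)" for k
    have term_eq: "?\<chi> k =
        1 / real d * acs 1 (k + Suc n) + (W (Suc k + n) * acs 1 (Suc k + Suc n) - W (k + n) * acs 1 (k + Suc n)) - e k" for k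
    proof -
      have A: "acs 2 (Suc k + Suc n) = acs 1 (Suc k + Suc n) - acs 1 (k + Suc n)"
        using acoeff_diff[of 2 "k + Suc n"] by (simp add: numeral_2_eq_2)
      have B: "?\<chi> k = (1 / real d + W (Suc (k + n)) - W (k + n)) * acs 1 (k + Suc n)"
        unfolding W(1)[symmetric] by simp
      show ?thesis unfolding B e_def A by (simp add: algebra_simps)
    qed
    have e_le: "\<bar>e k\<bar> \<le> C2 * real (k + Suc n) powr - (3/2 + 1)" for k
    proof -
      have "\<bar>e k\<bar> \<le> 1 * \<bar>acs 2 (Suc k + Suc n)\<bar>"
        unfolding e_def abs_mult by (intro mult_right_mono W) auto
      also have "\<dots> \<le> C2 * real (Suc k + Suc n) powr - (5/2)" using C2(2)[of "Suc k + Suc n"] n by simp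
      also have "\<dots> \<le> C2 * real (k + Suc n) powr - (5/2)" using C2(1) by (intro mult_left_mono powr_mono2') auto
      finally show ?thesis by simp
    qed
    have pt: "summable (\<lambda>k. C2 * real (k + Suc n) powr - (3/2 + 1))"
      using n by (intro summable_mult powr_tail(1)) auto
    have e_sum: "summable (\<lambda>k. \<bar>e k\<bar>)" by (rule summable_comparison_test'[OF pt, of 0]) (use e_le in simp)
    have "(\<Sum>k. \<bar>e k\<bar>) \<le> (\<Sum>k. C2 * real (k + Suc n) powr - (3/2 + 1))" by (intro suminf_le e_le e_sum pt)
    also have "\<dots> = C2 * (\<Sum>k. real (k + Suc n) powr - (3/2 + 1))" using n by (intro suminf_mult powr_tail(1)) auto
    also have "\<dots> \<le> C2 * (real n powr - (3/2) / (3/2))" using n C2(1) by (intro mult_left_mono powr_tail(2)) auto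
    also have "\<dots> \<le> C2 * real n powr - (3/2)" using C2(1) by (intro mult_left_mono) auto
    finally have e_sum_le: "\<bar>\<Sum>k. e k\<bar> \<le> C2 * real n powr - (3/2)"
      using summable_rabs[OF e_sum] by linarith
    have "(\<lambda>k. W (k + n) * acs 1 (k + Suc n)) \<longlonglongrightarrow> 0"
    proof (rule Lim_null_comparison[where g="\<lambda>k. \<bar>acs 1 (k + Suc n)\<bar>"])
      show "\<forall>\<^sub>F k in sequentially. norm (W (k + n) * acs 1 (k + Suc n)) \<le> \<bar>acs 1 (k + Suc n)\<bar>"
        using mult_right_mono[OF W(2)] by (intro always_eventually) (auto simp: abs_mult)
      have "acs 1 \<in> Opow (1/2)" by (auto intro!: bigo_powr_mono[OF acoeff_bigo])
      then have "acs 1 \<longlonglongrightarrow> 0" by (rule bigo_powr_tendsto_0) simp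
      then have "(\<lambda>k. acs 1 (k + Suc n)) \<longlonglongrightarrow> 0" by (rule LIMSEQ_ignore_initial_segment)
      then show "(\<lambda>k. \<bar>acs 1 (k + Suc n)\<bar>) \<longlonglongrightarrow> 0" by (rule tendsto_rabs_zero)
    qed
    from telescope_sums[OF this]
    have tel: "(\<lambda>k. W (Suc k + n) * acs 1 (Suc k + Suc n) - W (k + n) * acs 1 (k + Suc n)) sums (0 - W n * acs 1 (Suc n))" by simp
    define T where "T = 1 / real d * (- acoeff 1 n) + (0 - W n * acs 1 (Suc n)) - (\<Sum>k. e k)"
    have "?\<chi> sums T"
      unfolding term_eq T_def
      by (intro sums_diff sums_add sums_mult sums_acs_tail tel summable_sums summable_rabs_cancel[OF e_sum]) simp
    moreover have "\<bar>T + acoeff 1 n / real d\<bar> \<le> (C1 + C2) * real n powr - (3/2)"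
    proof -
      have "\<bar>W n * acs 1 (Suc n)\<bar> \<le> 1 * (C1 * real (Suc n) powr - (3/2))"
        unfolding abs_mult using n by (intro mult_mono W C1(2)) auto
      also have "\<dots> \<le> C1 * real n powr - (3/2)"
        using C1(1) n by (auto intro!: mult_left_mono powr_mono2')
      finally have "\<bar>W n * acs 1 (Suc n)\<bar> \<le> C1 * real n powr - (3/2)" .
      moreover have "T + acoeff 1 n / real d = - (W n * acs 1 (Suc n)) - (\<Sum>k. e k)" by (simp add: T_def)
      ultimately show ?thesis using e_sum_le by (simp only: distrib_right)
    qed
    ultimately show ?thesis by blast
  qed
  then show ?thesis using that[of "C1 + C2" "max 1 (max N1 N2)"] C1(1) C2(1) by auto
qed

section \<open>Hitting probabilities, uniformly in the starting point\<close>

context lattice_law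
begin

lemma weight_le:
  assumes "q \<le> r"
  shows "0 \<le> real x ^ Suc q / (2 * pi * real d ^ q * fact q)"
    and "real x ^ Suc q / (2 * pi * real d ^ q * fact q) \<le> 1 + real x ^ (r + 2)"
proof -
  have "1 * 1 * 1 \<le> 2 * pi * real d ^ q * fact q"
    using d_pos pi_ge_two by (intro mult_mono one_le_power fact_ge_1) auto
  then have den: "2 * pi * real d ^ q * fact q \<ge> 1" by simp
  show "0 \<le> real x ^ Suc q / (2 * pi * real d ^ q * fact q)" by simp
  have "real x ^ Suc q / (2 * pi * real d ^ q * fact q) \<le> real x ^ Suc q / 1"
    by (intro divide_left_mono den mult_pos_pos less_le_trans[OF zero_less_one den]) auto
  also have "\<dots> \<le> 1 + real x ^ (r + 2)"
  proof (cases "x = 0")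
    case False
    then have "real x ^ Suc q \<le> real x ^ (r + 2)" using assms by (intro power_increasing) auto
    then show ?thesis by (simp del: power_Suc)
  qed simp
  finally show "real x ^ Suc q / (2 * pi * real d ^ q * fact q) \<le> 1 + real x ^ (r + 2)" .
qed

text \<open>Expanding the exponential to order \<open>r\<close> leaves a remainder (\<bar>t\<bar>
  x)^(r+1). Integration and the prefactor x / k turn it into x^(r+2) k^(-(r+4)/2), the origin of the
  weight in \<open>x\<close>. The finitely many moment expansions do not involve \<open>x\<close>,
  so their errors only pick up the weights bounded by \<open>weight_le\<close>.\<close>

lemma hit_expansion:
  obtains \<delta> C N where "C \<ge> 0"
    "\<And>k x. k \<ge> N \<Longrightarrow> \<bar>hit p k x - (if int d dvd int k - int x then
        (\<Sum>j=1..r div 2 + 1. (\<Sum>q\<le>r. \<delta> q j * (real x ^ Suc q / (2 * pi * real d ^ q * fact q))) * acs j k) else 0)\<bar>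
      \<le> C * (1 + real x ^ (r + 2)) * real k powr - (real (r + 4) / 2)"
    "\<And>q j. q \<le> r \<Longrightarrow> 2 * j < q + 2 \<Longrightarrow> \<delta> q j = 0"
    "\<And>q. q \<le> r \<Longrightarrow> even q \<Longrightarrow> \<delta> q (q div 2 + 1) \<noteq> 0"
proof -
  obtain Q c' K A where "gauss_like charf (\<lambda>t. of_real t ^ 3 * poly Q (of_real t)) a0 c' K A r"
    by (rule ex_gauss_like)
  then interpret g: gauss_like charf "\<lambda>t. of_real t ^ 3 * poly Q (of_real t)" a0 c' K A r .
  define Good where "Good q \<delta> C N \<longleftrightarrow>
      (\<forall>k\<ge>N. \<bar>Re (\<i> ^ q * g.moment q k) / real k - (\<Sum>j=1..r div 2 + 1. \<delta> j * acs j k)\<bar>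
        \<le> C * real k powr - (real (r + 4) / 2))
      \<and> (\<forall>j. 2 * j < q + 2 \<longrightarrow> \<delta> j = 0) \<and> (even q \<longrightarrow> \<delta> (q div 2 + 1) \<noteq> 0)"
    for q N :: nat and \<delta> :: "nat \<Rightarrow> real" and C :: real
  have "\<forall>q\<in>{..r}. \<exists>\<delta>. \<exists>C\<ge>0. \<exists>N. Good q \<delta> C N"
  proof
    fix q assume "q \<in> {..r}"
    then have "q \<le> r" by simp
    from g.moment_expansion[OF refl this] obtain \<delta> where \<delta>:
      "(\<lambda>k. Re (\<i> ^ q * g.moment q k) / real k - (\<Sum>j=1..r div 2 + 1. \<delta> j * acs j k)) \<in> Opow (real (r + 4) / 2)"
      "\<And>j. 2 * j < q + 2 \<Longrightarrow> \<delta> j = 0" "even q \<Longrightarrow> \<delta> (q div 2 + 1) \<noteq> 0" by blast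
    obtain C N where "C \<ge> 0" "\<And>k. k \<ge> N \<Longrightarrow> \<bar>Re (\<i> ^ q * g.moment q k) / real k - (\<Sum>j=1..r div 2 + 1. \<delta> j * acs j k)\<bar> \<le> C * real k powr - (real (r + 4) / 2)"
      by (rule bigoE_nat[OF \<delta>(1)]) (auto intro: that)
    with \<delta>(2,3) show "\<exists>\<delta>. \<exists>C\<ge>0. \<exists>N. Good q \<delta> C N" unfolding Good_def by blast
  qed
  from bchoice[OF this] obtain \<delta> where "\<forall>q\<in>{..r}. \<exists>C\<ge>0. \<exists>N. Good q (\<delta> q) C N" ..
  from bchoice[OF this] obtain C where C: "\<forall>q\<in>{..r}. C q \<ge> 0 \<and> (\<exists>N. Good q (\<delta> q) (C q) N)" ..
  then have "\<forall>q\<in>{..r}. \<exists>N. Good q (\<delta> q) (C q) N" by blast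
  from bchoice[OF this] obtain N where N: "\<forall>q\<in>{..r}. Good q (\<delta> q) (C q) (N q)" ..
  obtain c where c: "c > 0" "\<And>t. \<bar>t\<bar> \<le> pi \<Longrightarrow> norm (charf t) \<le> exp (- (c * t\<^sup>2))"
    by (rule norm_charf_le) (rule that)
  \<comment> \<open>The sum dominates each threshold, and the successor ensures
    \<open>k \<ge> 1\<close>.\<close>
  define N0 where "N0 = Suc (\<Sum>q\<le>r. N q)"
  have N0: "N q \<le> N0" if "q \<le> r" for q
    using member_le_sum[of q "{..r}" N] that unfolding N0_def by simp
  define C0 where "C0 = (\<Sum>q\<le>r. C q) + gmom_abs c (r + 1)"
  define w where "w x q = real x ^ Suc q / (2 * pi * real d ^ q * fact q)" for x q
  have w_le: "0 \<le> w x q" "w x q \<le> 1 + real x ^ (r + 2)" if "q \<le> r" for x q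
    unfolding w_def using that by (rule weight_le)+
  have rem: "norm ((LINT t:{-pi..pi}|lborel. cis (t * (real x / real d)) * charf t ^ k) -
      (\<Sum>q\<le>r. (\<i> * of_real (real x / real d)) ^ q / fact q * g.moment q k)) \<le> real x ^ (r + 1) * (real k powr - (real (r + 2) / 2) * gmom_abs c (r + 1))"
    if k: "k \<ge> 1" for k x
  proof -
    let ?y = "real x / real d"
    let ?s = "\<lambda>t. \<Sum>q\<le>r. (\<i> * of_real ?y) ^ q / fact q * (of_real (t ^ q) * charf t ^ k)"
    let ?e = "\<lambda>t. \<Sum>q\<le>r. (\<i> * of_real (t * ?y)) ^ q / fact q"
    let ?S = "\<Sum>q\<le>r. (\<i> * of_real ?y) ^ q / fact q * g.moment q k"
    let ?g = "\<lambda>t. gauss c k t"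
    have cont: "continuous_on {-pi..pi} (\<lambda>t. complex_of_real (t ^ q) * charf t ^ k)" for q
      by (intro continuous_intros continuous_on_charf)
    have pw: "norm (cis (t * ?y) * charf t ^ k - ?s t)
        \<le> real x ^ (r + 1) * (\<bar>t\<bar> ^ (r + 1) * ?g t)" if t_in: "t \<in> {-pi..pi}" for t
    proof -
      have t: "\<bar>t\<bar> \<le> pi" using t_in by auto
      have eq: "cis (t * ?y) * charf t ^ k - ?s t =
          (iexp (t * ?y) - ?e t) * charf t ^ k"
      proof -
        have "(\<i> * of_real ?y) ^ q / fact q * (of_real (t ^ q) * charf t ^ k) = (\<i> * of_real (t * ?y)) ^ q / fact q * charf t ^ k" for q
          unfolding of_real_mult[of t ?y] of_real_power power_mult_distrib
          by (simp only: times_divide_eq_left times_divide_eq_right mult_ac)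
        then show ?thesis by (simp only: cis_conv_exp left_diff_distrib sum_distrib_right)
      qed
      have "norm (charf t ^ k) \<le> exp (- (c * t\<^sup>2)) ^ k"
        unfolding norm_power by (intro power_mono c(2)[OF t]) auto
      also have "\<dots> = ?g t"
      proof -
        have "real k * - (c * t\<^sup>2) = - (c * real k * t\<^sup>2)" by simp
        then show ?thesis by (simp only: exp_of_nat_mult[symmetric])
      qed
      finally have n1: "norm (charf t ^ k) \<le> ?g t" .
      have n2: "norm (iexp (t * ?y) - ?e t) \<le> real x ^ (r + 1) * \<bar>t\<bar> ^ (r + 1)"
      proof -
        have "norm (iexp (t * ?y) - ?e t) \<le> \<bar>t * ?y\<bar> ^ Suc r / fact (Suc r)"
          by (rule iexp_approx1)
        also have "\<dots> \<le> \<bar>t * ?y\<bar> ^ Suc r / 1"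
          by (intro divide_left_mono fact_ge_1) auto
        also have "\<dots> \<le> (\<bar>t\<bar> * real x) ^ Suc r"
        proof -
          have "real x / real d \<le> real x / 1" using d_pos by (intro divide_left_mono) auto
          then have "\<bar>t\<bar> * ?y \<le> \<bar>t\<bar> * real x" by (intro mult_left_mono) auto
          then have "\<bar>t * ?y\<bar> \<le> \<bar>t\<bar> * real x" by (simp add: abs_mult)
          then show ?thesis by (simp only: div_by_1) (intro power_mono; simp)
        qed
        finally show ?thesis by (simp add: power_mult_distrib mult_ac)
      qed
      have "norm (cis (t * ?y) * charf t ^ k - ?s t) =
          norm (iexp (t * ?y) - ?e t) * norm (charf t ^ k)"
        by (subst eq) (rule norm_mult)
      also have "\<dots> \<le> (real x ^ (r + 1) * \<bar>t\<bar> ^ (r + 1)) * ?g t"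
        by (rule mult_mono[OF n2 n1]) auto
      also have "\<dots> = real x ^ (r + 1) * (\<bar>t\<bar> ^ (r + 1) * ?g t)" by (rule mult.assoc)
      finally show ?thesis .
    qed
    have "?S =
        (LINT t:{-pi..pi}|lborel. ?s t)"
      unfolding g.moment_def by (rule set_integral_sum_complex[symmetric]) (rule cont)
    moreover have "set_integrable lborel {-pi..pi} (\<lambda>t. cis (t * ?y) * charf t ^ k)"
      "set_integrable lborel {-pi..pi} (\<lambda>t. ?s t)"
      by (rule borel_integrable_atLeastAtMost', intro continuous_intros continuous_on_charf)+
    ultimately have diff_eq: "(LINT t:{-pi..pi}|lborel. cis (t * ?y) * charf t ^ k) - ?S =
        (LINT t:{-pi..pi}|lborel. cis (t * ?y) * charf t ^ k - ?s t)"
      by (simp only: set_integral_diff(2))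
    have "norm ((LINT t:{-pi..pi}|lborel. cis (t * ?y) * charf t ^ k) - ?S)
        \<le> (LINT t|lborel. real x ^ (r + 1) * (\<bar>t\<bar> ^ (r + 1) * ?g t))"
      unfolding diff_eq
    proof (rule norm_set_integral_le[OF _ _ pw])
      show "continuous_on {-pi..pi} (\<lambda>t. cis (t * ?y) * charf t ^ k - ?s t)"
        by (intro continuous_intros continuous_on_charf)
      show "integrable lborel (\<lambda>t. real x ^ (r + 1) * (\<bar>t\<bar> ^ (r + 1) * ?g t))"
        using c k by (intro integrable_mult_right integrable_gauss_moment_abs) auto
      show "0 \<le> real x ^ (r + 1) * (\<bar>t\<bar> ^ (r + 1) * ?g t)" for t by simp
    qed
    also have "\<dots> = real x ^ (r + 1) * (real k powr - (real (r + 1 + 1) / 2) * gmom_abs c (r + 1))"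
    proof -
      have "real k > 0" using k by simp
      then show ?thesis by (simp only: integral_mult_right_zero gauss_scale(2))
    qed
    finally have *: "norm ((LINT t:{-pi..pi}|lborel. cis (t * ?y) * charf t ^ k) - ?S)
        \<le> real x ^ (r + 1) * (real k powr - (real (r + 1 + 1) / 2) * gmom_abs c (r + 1))" .
    have "r + 1 + 1 = r + 2" by simp
    with * show ?thesis by (simp only:)
  qed
  have main: "\<bar>hit p k x - (if int d dvd int k - int x then
        (\<Sum>j=1..r div 2 + 1. (\<Sum>q\<le>r. \<delta> q j * w x q) * acs j k) else 0)\<bar>
      \<le> C0 * (1 + real x ^ (r + 2)) * real k powr - (real (r + 4) / 2)" if k: "k \<ge> N0" for k x
  proof (cases "int d dvd int k - int x")
    case False
    have "C0 \<ge> 0" unfolding C0_def using C gmom_abs_nonneg by (auto intro!: add_nonneg_nonneg sum_nonneg)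
    then show ?thesis using False k hit_fourier[of k x] unfolding N0_def by simp
  next
    case True
    have k1: "k \<ge> 1" using k by (simp add: N0_def)
    define Z where "Z = (LINT t:{-pi..pi}|lborel. cis (t * (real x / real d)) * charf t ^ k)"
    define S where "S = (\<Sum>q\<le>r. (\<i> * of_real (real x / real d)) ^ q / fact q * g.moment q k)"
    define P where "P = real k powr - (real (r + 4) / 2)"
    have hit: "hit p k x = real x / real k / (2 * pi) * Re Z"
      using hit_fourier[of k x] k1 True unfolding Z_def by simp
    have S: "real x / real k / (2 * pi) * Re S = (\<Sum>q\<le>r. w x q * (Re (\<i> ^ q * g.moment q k) / real k))"
      unfolding S_def Re_sum sum_distrib_left
    proof (intro sum.cong refl)
      fix q
      have "(\<i> * of_real (real x / real d)) ^ q / fact q * g.moment q k = of_real ((real x / real d) ^ q / fact q) * (\<i> ^ q * g.moment q k)"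
      proof -
        have "(\<i> * of_real y) ^ q / fact q * z = of_real (y ^ q / fact q) * (\<i> ^ q * z)" for y z
          by (simp add: power_mult_distrib mult_ac)
        then show ?thesis .
      qed
      moreover have "Re (of_real u * z) = u * Re z" for u z by simp
      ultimately have "Re ((\<i> * of_real (real x / real d)) ^ q / fact q * g.moment q k) = (real x / real d) ^ q / fact q * Re (\<i> ^ q * g.moment q k)"
        by (simp only:)
      moreover have "real x / real k / (2 * pi) * ((real x / real d) ^ q / fact q * z) = w x q * (z / real k)" for z
        unfolding w_def by (simp add: power_divide mult_ac)
      ultimately show "real x / real k / (2 * pi) * Re ((\<i> * of_real (real x / real d)) ^ q / fact q * g.moment q k) = w x q * (Re (\<i> ^ q * g.moment q k) / real k)"
        by (simp only:)
    qed
    have hit_eq: "hit p k x - (\<Sum>j=1..r div 2 + 1. (\<Sum>q\<le>r. \<delta> q j * w x q) * acs j k) =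
        real x / real k / (2 * pi) * Re (Z - S) + (\<Sum>q\<le>r. w x q * (Re (\<i> ^ q * g.moment q k) / real k - (\<Sum>j=1..r div 2 + 1. \<delta> q j * acs j k)))"
    proof -
      have "(\<Sum>j=1..r div 2 + 1. (\<Sum>q\<le>r. \<delta> q j * w x q) * acs j k) = (\<Sum>q\<le>r. w x q * (\<Sum>j=1..r div 2 + 1. \<delta> q j * acs j k))"
        unfolding sum_distrib_left sum_distrib_right by (subst sum.swap) (intro sum.cong refl, simp only: mult_ac)
      then show ?thesis unfolding hit minus_complex.sel right_diff_distrib sum_subtractf S[symmetric] by simp
    qed
    have Z_le: "\<bar>real x / real k / (2 * pi) * Re (Z - S)\<bar> \<le> (1 + real x ^ (r + 2)) * (gmom_abs c (r + 1) * P)"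
    proof -
      have "\<bar>Re (Z - S)\<bar> \<le> real x ^ (r + 1) * (real k powr - (real (r + 2) / 2) * gmom_abs c (r + 1))"
        using order_trans[OF abs_Re_le_cmod rem[OF k1, of x, folded Z_def S_def]] .
      moreover have "real x / real k / (2 * pi) \<le> real x / real k / 1"
        using pi_ge_two by (intro divide_left_mono) auto
      ultimately have "\<bar>real x / real k / (2 * pi) * Re (Z - S)\<bar> \<le> real x / real k / 1 * (real x ^ (r + 1) * (real k powr - (real (r + 2) / 2) * gmom_abs c (r + 1)))"
        unfolding abs_mult by (intro mult_mono) auto
      also have "\<dots> = real x ^ (r + 2) * (gmom_abs c (r + 1) * (real k powr - (real (r + 2) / 2) / real k))"
        by simp
      also have "real k powr - (real (r + 2) / 2) / real k = P"
      proof -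
        have "- (real (r + 4) / 2) = - (real (r + 2) / 2) - 1" by (simp add: field_simps)
        then show ?thesis unfolding P_def using k1 by (simp only: powr_diff) simp
      qed
      also have "real x ^ (r + 2) * (gmom_abs c (r + 1) * P) \<le> (1 + real x ^ (r + 2)) * (gmom_abs c (r + 1) * P)"
        unfolding P_def by (intro mult_right_mono) (auto simp: gmom_abs_nonneg)
      finally show ?thesis .
    qed
    have "\<bar>hit p k x - (\<Sum>j=1..r div 2 + 1. (\<Sum>q\<le>r. \<delta> q j * w x q) * acs j k)\<bar> \<le>
        (1 + real x ^ (r + 2)) * (gmom_abs c (r + 1) * P) + (\<Sum>q\<le>r. (1 + real x ^ (r + 2)) * (C q * P))"
      unfolding hit_eq
    proof (rule order_trans[OF abs_triangle_ineq add_mono[OF Z_le order_trans[OF sum_abs sum_mono]]])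
      fix q assume q: "q \<in> {..r}"
      have "\<bar>Re (\<i> ^ q * g.moment q k) / real k - (\<Sum>j=1..r div 2 + 1. \<delta> q j * acs j k)\<bar> \<le> C q * P"
        using N[THEN bspec, OF q] N0[of q] q k unfolding P_def Good_def by simp
      then show "\<bar>w x q * (Re (\<i> ^ q * g.moment q k) / real k - (\<Sum>j=1..r div 2 + 1. \<delta> q j * acs j k))\<bar> \<le> (1 + real x ^ (r + 2)) * (C q * P)"
        unfolding abs_mult using w_le[of q x] q by (intro mult_mono) auto
    qed
    also have "(1 + real x ^ (r + 2)) * (gmom_abs c (r + 1) * P) + (\<Sum>q\<le>r. (1 + real x ^ (r + 2)) * (C q * P)) = C0 * (1 + real x ^ (r + 2)) * P"
      unfolding C0_def by (simp only: sum_distrib_left[symmetric] sum_distrib_right[symmetric] distrib_left[symmetric] distrib_right[symmetric] mult_ac add_ac)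
    finally show ?thesis using True unfolding P_def by simp
  qed
  show ?thesis
  proof (rule that[of C0 N0 \<delta>])
    show "C0 \<ge> 0" unfolding C0_def using C gmom_abs_nonneg by (auto intro!: add_nonneg_nonneg sum_nonneg)
    show "\<bar>hit p k x - (if int d dvd int k - int x then
        (\<Sum>j=1..r div 2 + 1. (\<Sum>q\<le>r. \<delta> q j * (real x ^ Suc q / (2 * pi * real d ^ q * fact q))) * acs j k) else 0)\<bar>
      \<le> C0 * (1 + real x ^ (r + 2)) * real k powr - (real (r + 4) / 2)" if "k \<ge> N0" for k x
      using main[OF that, of x] unfolding w_def .
    show "\<delta> q j = 0" if "q \<le> r" "2 * j < q + 2" for q j
      using N that unfolding Good_def by blast
    show "\<delta> q (q div 2 + 1) \<noteq> 0" if "q \<le> r" "even q" for q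
      using N that unfolding Good_def by blast
  qed
qed

end

section \<open>Summation over late hitting times and the polynomials\<close>

context lattice_law
begin

text \<open>For \<open>d = 1\<close> the telescoping is exact. For larger \<open>d\<close> the
  assumption gives \<open>r \<le> 1\<close>, so only \<open>j = 1\<close> occurs and the n^(-3/2)
  defect is within the error.\<close>

lemma residue_tail:
  assumes "d = 1 \<or> r \<le> 1"
  obtains C N where "C \<ge> 0" "\<And>n x j. n \<ge> N \<Longrightarrow> j \<in> {1..r div 2 + 1} \<Longrightarrow>
    \<exists>T. (\<lambda>k. if int d dvd int (k + Suc n) - int x then acs j (k + Suc n) else 0) sums T
      \<and> \<bar>T + acoeff j n / real d\<bar> \<le> C * real n powr - (real (r + 2) / 2)"
proof (cases "d = 1")
  case True
  show ?thesis
  proof (rule that[of 0 0])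
    fix n x j assume j: "j \<in> {1..r div 2 + 1}"
    have "(\<lambda>k. if int d dvd int (k + Suc n) - int x then acs j (k + Suc n) else 0) sums (- acoeff j n)"
      using sums_acs_tail[of j n] j True by simp
    then show "\<exists>T. (\<lambda>k. if int d dvd int (k + Suc n) - int x then acs j (k + Suc n) else 0) sums T
      \<and> \<bar>T + acoeff j n / real d\<bar> \<le> 0 * real n powr - (real (r + 2) / 2)"
      using True by (intro exI[of _ "- acoeff j n"]) simp
  qed simp
next
  case False
  then have r: "r \<le> 1" using assms by simp
  obtain C N where C: "C \<ge> 0" "\<And>n x. n \<ge> N \<Longrightarrow> \<exists>T. (\<lambda>k. if int d dvd int (k + Suc n) - x then acs 1 (k + Suc n) else 0) sums T
      \<and> \<bar>T + acoeff 1 n / real d\<bar> \<le> C * real n powr - (3/2)"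
    by (rule periodic_acs_tail[OF d_pos]) (rule that)
  show ?thesis
  proof (rule that[OF C(1), of "max N 1"])
    fix n x j assume n: "n \<ge> max N 1" and j: "j \<in> {1..r div 2 + 1}"
    have "j = 1" using j r by auto
    obtain T where T: "(\<lambda>k. if int d dvd int (k + Suc n) - int x then acs 1 (k + Suc n) else 0) sums T"
      "\<bar>T + acoeff 1 n / real d\<bar> \<le> C * real n powr - (3/2)"
      using C(2)[of n "int x"] n by auto
    note T(2)
    also have "C * real n powr - (3/2) \<le> C * real n powr - (real (r + 2) / 2)"
      using n r C(1) by (intro mult_left_mono powr_mono) auto
    finally show "\<exists>T. (\<lambda>k. if int d dvd int (k + Suc n) - int x then acs j (k + Suc n) else 0) sums T
      \<and> \<bar>T + acoeff j n / real d\<bar> \<le> C * real n powr - (real (r + 2) / 2)"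
      using T(1) unfolding \<open>j = 1\<close> by blast
  qed
qed

lemma tail_expansion:
  assumes "d = 1 \<or> r \<le> 1"
  obtains V :: "nat \<Rightarrow> real poly" and C N where
    "\<And>j. j \<in> {1..r div 2 + 1} \<Longrightarrow> degree (V j) = 2 * j - 1"
    "\<And>n x. n \<ge> N \<Longrightarrow> \<bar>(1 - (\<Sum>k\<le>n. hit p k x)) - (\<Sum>j=1..r div 2 + 1. poly (V j) (real x) * acoeff j n)\<bar>
      \<le> C * ((1 + real x ^ (r + 2)) / real n powr (real (r + 2) / 2))"
proof -
  obtain \<delta> C1 N1 where C1: "C1 \<ge> 0" and
    hit: "\<And>k x. k \<ge> N1 \<Longrightarrow> \<bar>hit p k x - (if int d dvd int k - int x then
        (\<Sum>j=1..r div 2 + 1. (\<Sum>q\<le>r. \<delta> q j * (real x ^ Suc q / (2 * pi * real d ^ q * fact q))) * acs j k) else 0)\<bar>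
      \<le> C1 * (1 + real x ^ (r + 2)) * real k powr - (real (r + 4) / 2)" and
    \<delta>_0: "\<And>q j. q \<le> r \<Longrightarrow> 2 * j < q + 2 \<Longrightarrow> \<delta> q j = 0" and
    \<delta>_lead: "\<And>q. q \<le> r \<Longrightarrow> even q \<Longrightarrow> \<delta> q (q div 2 + 1) \<noteq> 0"
    by (rule hit_expansion) (rule that)
  obtain C2 N2 where C2: "C2 \<ge> 0" and
    tail: "\<And>n x j. n \<ge> N2 \<Longrightarrow> j \<in> {1..r div 2 + 1} \<Longrightarrow>
    \<exists>T. (\<lambda>k. if int d dvd int (k + Suc n) - int x then acs j (k + Suc n) else 0) sums T
      \<and> \<bar>T + acoeff j n / real d\<bar> \<le> C2 * real n powr - (real (r + 2) / 2)"
    by (rule residue_tail[OF assms]) (rule that)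
  define J where "J = r div 2 + 1"
  define \<rho> where "\<rho> = real (r + 2) / 2"
  have \<rho>: "\<rho> \<ge> 1" "\<rho> + 1 = real (r + 4) / 2" by (simp_all add: \<rho>_def field_simps)
  define v where "v j x = (\<Sum>q\<le>r. \<delta> q j * (real x ^ Suc q / (2 * pi * real d ^ q * fact q)))" for j x
  \<comment> \<open>The minus sign and the factor 1/d come from the tail of \<open>acs j\<close>
    along a residue class, which is close to \<open>- acoeff j n / real d\<close>.\<close>
  define V where "V j = (\<Sum>q\<le>r. monom (- (\<delta> q j) / (2 * pi * real d ^ q * fact q * real d)) (Suc q))" for j
  have poly_V: "poly (V j) (real x) = - (v j x / real d)" for j x
    unfolding V_def v_def poly_sum poly_monom sum_divide_distrib sum_negf[symmetric] by (intro sum.cong refl) simp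
  define D where "D j = (\<Sum>q\<le>r. \<bar>\<delta> q j\<bar>)" for j
  have D_nonneg: "D j \<ge> 0" for j unfolding D_def by (intro sum_nonneg) auto
  have v_le: "\<bar>v j x\<bar> \<le> D j * (1 + real x ^ (r + 2))" for j x
  proof -
    have "\<bar>v j x\<bar> \<le> (\<Sum>q\<le>r. \<bar>\<delta> q j\<bar> * (1 + real x ^ (r + 2)))"
      unfolding v_def
    proof (rule order_trans[OF sum_abs sum_mono])
      fix q assume "q \<in> {..r}"
      then show "\<bar>\<delta> q j * (real x ^ Suc q / (2 * pi * real d ^ q * fact q))\<bar> \<le> \<bar>\<delta> q j\<bar> * (1 + real x ^ (r + 2))"
        unfolding abs_mult using weight_le[of q x] by (intro mult_left_mono) auto
    qed
    then show ?thesis by (simp only: D_def sum_distrib_right)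
  qed
  define C where "C = C1 + (\<Sum>j=1..J. D j * C2)"
  show ?thesis
  proof (rule that[of V "max 1 (max N1 N2)" C])
    fix j assume j: "j \<in> {1..r div 2 + 1}"
    have coeff_V: "coeff (V j) (Suc q) = (if q \<le> r then - (\<delta> q j) / (2 * pi * real d ^ q * fact q * real d) else 0)" for q
    proof -
      have "coeff (V j) (Suc q) = (\<Sum>i\<le>r. if i = q then - (\<delta> i j) / (2 * pi * real d ^ i * fact i * real d) else 0)"
        unfolding V_def coeff_sum coeff_monom by (simp only: nat.inject)
      then show ?thesis by (simp only: sum.delta finite_atMost atMost_iff)
    qed
    show "degree (V j) = 2 * j - 1"
    \<comment> \<open>Coefficients above 2 j - 1 vanish by \<open>\<delta>_0\<close>; the power 2 j
      - 1 belongs to the even index q = 2 j - 2, where \<open>\<delta>_lead\<close> applies.\<close>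
    proof (rule antisym)
      show "degree (V j) \<le> 2 * j - 1"
      proof (rule degree_le, intro allI impI)
        fix i assume i: "2 * j - 1 < i"
        then obtain q where q: "i = Suc q" by (cases i) auto
        then have "2 * j < q + 2" using i j by auto
        then show "coeff (V j) i = 0" unfolding q coeff_V using \<delta>_0[of q j] by simp
      qed
      obtain i where i: "j = Suc i" using j by (cases j) auto
      have "2 * i \<le> r" using j i by auto
      then have "\<delta> (2 * i) j \<noteq> 0" using \<delta>_lead[of "2 * i"] by (simp add: i)
      then have "coeff (V j) (Suc (2 * i)) \<noteq> 0"
        unfolding coeff_V using \<open>2 * i \<le> r\<close> d_pos by simp
      then have "Suc (2 * i) \<le> degree (V j)" by (rule le_degree)
      then show "2 * j - 1 \<le> degree (V j)" by (simp add: i)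
    qed
  next
    fix n x assume n: "n \<ge> max 1 (max N1 N2)"
    define Y where "Y = 1 + real x ^ (r + 2)"
    have Y: "Y \<ge> 0" by (simp add: Y_def)
    let ?\<chi> = "\<lambda>j k. if int d dvd int (k + Suc n) - int x then acs j (k + Suc n) else 0"
    have "\<forall>j\<in>{1..J}. \<exists>T. ?\<chi> j sums T \<and> \<bar>T + acoeff j n / real d\<bar> \<le> C2 * real n powr - \<rho>"
      unfolding J_def \<rho>_def using tail n by simp
    from bchoice[OF this] obtain T where T: "\<And>j. j \<in> {1..J} \<Longrightarrow> ?\<chi> j sums T j"
      "\<And>j. j \<in> {1..J} \<Longrightarrow> \<bar>T j + acoeff j n / real d\<bar> \<le> C2 * real n powr - \<rho>" by blast
    define err where "err k = hit p (k + Suc n) x - (\<Sum>j=1..J. v j x * ?\<chi> j k)" for k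
    have err_le: "\<bar>err k\<bar> \<le> C1 * Y * real (k + Suc n) powr - (\<rho> + 1)" for k
    proof -
      have "(\<Sum>j=1..J. v j x * ?\<chi> j k) = (if int d dvd int (k + Suc n) - int x then (\<Sum>j=1..J. v j x * acs j (k + Suc n)) else 0)"
        by simp
      then show ?thesis
        using hit[of "k + Suc n" x] n unfolding err_def J_def v_def Y_def \<rho>(2) by (simp only:)
    qed
    have pt: "summable (\<lambda>k. C1 * Y * real (k + Suc n) powr - (\<rho> + 1))"
      using n \<rho> by (intro summable_mult powr_tail(1)) auto
    have err_sum: "summable (\<lambda>k. \<bar>err k\<bar>)" by (rule summable_comparison_test'[OF pt, of 0]) (use err_le in simp)
    have "\<bar>\<Sum>k. err k\<bar> \<le> (\<Sum>k. \<bar>err k\<bar>)" by (rule summable_rabs[OF err_sum])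
    also have "\<dots> \<le> (\<Sum>k. C1 * Y * real (k + Suc n) powr - (\<rho> + 1))" by (intro suminf_le err_le err_sum pt)
    also have "\<dots> = C1 * Y * (\<Sum>k. real (k + Suc n) powr - (\<rho> + 1))" using n \<rho> by (intro suminf_mult powr_tail(1)) auto
    also have "\<dots> \<le> C1 * Y * (real n powr - \<rho> / \<rho>)" using n \<rho> C1 Y by (intro mult_left_mono powr_tail(2)) auto
    \<comment> \<open>The divisor is dropped because \<open>\<rho> \<ge> 1\<close>.\<close>
    also have "\<dots> \<le> C1 * Y * (real n powr - \<rho> / 1)" using \<rho> C1 Y by (intro mult_left_mono divide_left_mono) auto
    finally have err_total: "\<bar>\<Sum>k. err k\<bar> \<le> C1 * Y * real n powr - \<rho>" by simp
    have "err sums ((1 - (\<Sum>k\<le>n. hit p k x)) - (\<Sum>j=1..J. v j x * T j))"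
      unfolding err_def by (intro sums_diff sums_hit_tail sums_sum sums_mult T)
    then have err_eq: "(\<Sum>k. err k) = (1 - (\<Sum>k\<le>n. hit p k x)) - (\<Sum>j=1..J. v j x * T j)" by (rule sums_unique[symmetric])
    have eq: "(1 - (\<Sum>k\<le>n. hit p k x)) - (\<Sum>j=1..J. poly (V j) (real x) * acoeff j n) =
        (\<Sum>k. err k) + (\<Sum>j=1..J. v j x * (T j + acoeff j n / real d))"
      unfolding err_eq poly_V by (simp add: distrib_left sum.distrib sum_negf)
    have "\<bar>(1 - (\<Sum>k\<le>n. hit p k x)) - (\<Sum>j=1..J. poly (V j) (real x) * acoeff j n)\<bar> \<le> C1 * Y * real n powr - \<rho> + (\<Sum>j=1..J. D j * Y * (C2 * real n powr - \<rho>))"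
      unfolding eq
    proof (rule order_trans[OF abs_triangle_ineq add_mono[OF err_total order_trans[OF sum_abs sum_mono]]])
      fix j assume "j \<in> {1..J}"
      then show "\<bar>v j x * (T j + acoeff j n / real d)\<bar> \<le> D j * Y * (C2 * real n powr - \<rho>)"
        unfolding abs_mult using v_le[of j x] T(2)[of j] D_nonneg[of j] Y unfolding Y_def
        by (intro mult_mono) auto
    qed
    also have "\<dots> = C * (Y / real n powr \<rho>)"
    proof -
      have "Y / real n powr \<rho> = Y * real n powr - \<rho>" by (simp add: powr_minus_divide)
      then show ?thesis unfolding C_def by (simp only: distrib_right sum_distrib_right) (simp only: mult_ac)
    qed
    finally show "\<bar>(1 - (\<Sum>k\<le>n. hit p k x)) - (\<Sum>j=1..r div 2 + 1. poly (V j) (real x) * acoeff j n)\<bar>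
      \<le> C * ((1 + real x ^ (r + 2)) / real n powr (real (r + 2) / 2))"
      unfolding J_def Y_def \<rho>_def .
  qed
qed

end

section \<open>Walks on a probability space\<close>

text \<open>The recursive definition suits first-step analysis; this form in terms of partial sums
  is what can be compared with the path of a walk.\<close>

lemma first_hit_iff:
  "first_hit x w \<longleftrightarrow> x + sum_list w = length w \<and> (\<forall>j<length w. j < x + sum_list (take j w))"
proof (induction w arbitrary: x)
  case (Cons m w)
  have "(\<forall>j<length (m # w). j < x + sum_list (take j (m # w))) \<longleftrightarrow>
      x > 0 \<and> (\<forall>j<length w. Suc j < x + m + sum_list (take j w))"
    by (simp add: All_less_Suc2 add.assoc)
  moreover have "x > 0 \<Longrightarrow> Suc j < x + m + s \<longleftrightarrow> j < x + m - 1 + s" for j s by linarith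
  moreover have "x > 0 \<Longrightarrow> x + sum_list (m # w) = length (m # w) \<longleftrightarrow> x + m - 1 + sum_list w = length w" by auto
  ultimately show ?case unfolding first_hit.simps Cons.IH by auto
qed auto

abbreviation prefix_word :: "(nat \<Rightarrow> nat) \<Rightarrow> nat \<Rightarrow> nat list" where
  "prefix_word z k \<equiv> map z [1..<Suc k]"

lemma first_hit_prefix_iff:
  "first_hit x (prefix_word z k) \<longleftrightarrow> x + (\<Sum>i=1..k. z i) = k \<and> (\<forall>j<k. j < x + (\<Sum>i=1..j. z i))"
proof -
  have "sum_list (take j (prefix_word z k)) = (\<Sum>i=1..j. z i)" if "j \<le> k" for j
  proof -
    have "take j (prefix_word z k) = prefix_word z j" using that by (simp add: take_map take_upt del: upt_Suc)
    then show ?thesis by (simp only: sum_list_distinct_conv_sum_set distinct_upt set_upt atLeastLessThanSuc_atLeastAtMost)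
  qed
  from this[of k] this show ?thesis unfolding first_hit_iff by (simp del: upt_Suc)
qed

text \<open>A step goes down by at most one, so at the first time the walk is nonpositive it is
  exactly 0. The assumption on \<open>x\<close> rules out time 0, at which \<open>first_hit\<close>
  would already succeed.\<close>

lemma ex_first_hit_prefix_iff:
  assumes "x \<ge> 1"
  shows "(\<exists>k\<le>n. first_hit x (prefix_word z k)) \<longleftrightarrow> (\<exists>k\<in>{1..n}. x + (\<Sum>i=1..k. z i) \<le> k)"
proof
  assume "\<exists>k\<le>n. first_hit x (prefix_word z k)"
  then obtain k where k: "k \<le> n" "x + (\<Sum>i=1..k. z i) = k" unfolding first_hit_prefix_iff by blast
  then show "\<exists>k\<in>{1..n}. x + (\<Sum>i=1..k. z i) \<le> k" using assms by (intro bexI[of _ k]) auto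
next
  assume "\<exists>k\<in>{1..n}. x + (\<Sum>i=1..k. z i) \<le> k"
  then obtain k' where k': "k' \<le> n" "x + (\<Sum>i=1..k'. z i) \<le> k'" by auto
  define k where "k = (LEAST k. x + (\<Sum>i=1..k. z i) \<le> k)"
  have k: "x + (\<Sum>i=1..k. z i) \<le> k" unfolding k_def by (rule LeastI[of _ k']) (rule k')
  have "k \<le> k'" unfolding k_def by (rule Least_le) (rule k')
  have less: "j < x + (\<Sum>i=1..j. z i)" if "j < k" for j
    using not_less_Least[OF that[unfolded k_def]] by simp
  obtain j where j: "k = Suc j" using k assms by (cases k) auto
  have "j < x + (\<Sum>i=1..j. z i)" using less[of j] j by simp
  then have "x + (\<Sum>i=1..k. z i) = k" using k unfolding j by simp
  then have "first_hit x (prefix_word z k)" unfolding first_hit_prefix_iff using less by simp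
  then show "\<exists>k\<le>n. first_hit x (prefix_word z k)" using \<open>k \<le> k'\<close> k'(1) by (intro exI[of _ k]) simp
qed

lemma first_hit_prefix_unique:
  assumes "first_hit x (prefix_word z k)" "first_hit x (prefix_word z k')"
  shows "k = k'"
  using assms unfolding first_hit_prefix_iff by (metis less_irrefl linorder_neqE_nat)

lemma tau_greater_iff: "tau X x \<omega> > enat n \<longleftrightarrow> (\<forall>k\<in>{1..n}. x + walk X k \<omega> > 0)"
proof
  assume gr: "tau X x \<omega> > enat n"
  show "\<forall>k\<in>{1..n}. x + walk X k \<omega> > 0"
  proof (rule ballI, rule ccontr)
    fix k assume k: "k \<in> {1..n}" "\<not> x + walk X k \<omega> > 0"
    then have "tau X x \<omega> \<le> enat k" unfolding tau_def by (intro Inf_lower) auto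
    also have "enat k \<le> enat n" using k by simp
    finally show False using gr by simp
  qed
next
  assume *: "\<forall>k\<in>{1..n}. x + walk X k \<omega> > 0"
  have "enat (Suc n) \<le> tau X x \<omega>"
    unfolding tau_def
  proof (rule Inf_greatest, clarify)
    fix k assume k: "k \<ge> 1" "x + walk X k \<omega> \<le> 0"
    then have "\<not> k \<le> n" using * by force
    then show "enat (Suc n) \<le> enat k" by simp
  qed
  then show "tau X x \<omega> > enat n" by (simp add: Suc_ile_eq)
qed

section \<open>From random variables to words\<close>

locale skip_free_walk = prob_space M for M :: "'a measure" +
  fixes X :: "nat \<Rightarrow> 'a \<Rightarrow> real"
  assumes indep: "indep_vars (\<lambda>_. borel) X {1..}"
    and ident: "\<And>i. i \<ge> 1 \<Longrightarrow> distr M borel (X i) = distr M borel (X 1)"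
    and skip_free: "prob {\<omega> \<in> space M. \<exists>k::int. k \<ge> -1 \<and> X 1 \<omega> = of_int k} = 1"
begin

lemma X_measurable [measurable]: "i \<ge> 1 \<Longrightarrow> X i \<in> borel_measurable M"
  using indep unfolding indep_vars_def by auto

text \<open>Total and measurable everywhere; it agrees with X + 1 almost surely, and its values on
  the exceptional null set are irrelevant.\<close>

definition Z :: "nat \<Rightarrow> 'a \<Rightarrow> nat" where
  "Z i \<omega> = nat \<lfloor>X i \<omega> + 1\<rfloor>"

lemma Z_measurable [measurable]: "i \<ge> 1 \<Longrightarrow> Z i \<in> measurable M (count_space UNIV)"
  unfolding Z_def by measurable

definition pmass :: "nat \<Rightarrow> real" where
  "pmass m = prob {\<omega> \<in> space M. Z 1 \<omega> = m}"

lemma prob_Z: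
  assumes "i \<ge> 1"
  shows "prob (Z i -` {m} \<inter> space M) = pmass m"
proof -
  let ?A = "{y::real. nat \<lfloor>y + 1\<rfloor> = m}"
  have A: "?A \<in> sets borel" by measurable
  have "prob (Z i -` {m} \<inter> space M) = measure (distr M borel (X i)) ?A"
    using A assms by (subst measure_distr) (auto simp: Z_def intro!: arg_cong[of _ _ prob])
  also have "\<dots> = measure (distr M borel (X 1)) ?A" by (simp only: ident[OF assms])
  also have "\<dots> = pmass m"
    using A by (subst measure_distr) (auto simp: Z_def pmass_def intro!: arg_cong[of _ _ prob])
  finally show ?thesis .
qed

text \<open>The support condition on the first step passes to every step through equality of
  distributions; countability gives one null set for all of them.\<close>

lemma AE_X_eq: "AE \<omega> in M. \<forall>i\<ge>1. X i \<omega> = real (Z i \<omega>) - 1"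
proof -
  have "AE \<omega> in M. X i \<omega> = real (Z i \<omega>) - 1" if i: "i \<ge> 1" for i
  proof -
    let ?A = "(\<lambda>k::int. real_of_int k) ` {-1..}"
    have "countable ?A" by (intro countable_image countableI_type)
    then have A: "?A \<in> sets borel" by (rule sets.countable[rotated]) (rule borel_singleton, rule sets.empty_sets)
    have "{\<omega> \<in> space M. X 1 \<omega> \<in> ?A} = {\<omega> \<in> space M. \<exists>k::int. k \<ge> -1 \<and> X 1 \<omega> = of_int k}" by auto
    then have p1: "prob {\<omega> \<in> space M. X 1 \<omega> \<in> ?A} = 1" using skip_free by (simp only:)
    have m: "{\<omega> \<in> space M. X 1 \<omega> \<in> ?A} \<in> sets M"
    proof -
      have "{\<omega> \<in> space M. X 1 \<omega> \<in> ?A} = X 1 -` ?A \<inter> space M" by blast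
      then show ?thesis using measurable_sets[OF X_measurable[OF order_refl] A] by (simp only:)
    qed
    have "AE \<omega> in M. X 1 \<omega> \<in> ?A" by (rule iffD1[OF prob_Collect_eq_1[OF m] p1])
    have A': "{y \<in> space borel. y \<in> ?A} \<in> sets borel" using A by simp
    have iff: "(AE y in distr M borel (X j). y \<in> ?A) \<longleftrightarrow> (AE \<omega> in M. X j \<omega> \<in> ?A)" if "j \<ge> 1" for j
      by (rule AE_distr_iff[OF X_measurable[OF that] A'])
    have "AE y in distr M borel (X i). y \<in> ?A"
      unfolding ident[OF i] using \<open>AE \<omega> in M. X 1 \<omega> \<in> ?A\<close> by (rule iffD2[OF iff[OF order_refl]])
    then have "AE \<omega> in M. X i \<omega> \<in> ?A" by (rule iffD1[OF iff[OF i]])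
    then show ?thesis
    proof eventually_elim
      case (elim \<omega>)
      then obtain k where k: "X i \<omega> = real_of_int k" "k \<ge> -1" by blast
      then have "\<lfloor>X i \<omega> + 1\<rfloor> = k + 1" by simp
      then show ?case using k unfolding Z_def by simp
    qed
  qed
  then have "AE \<omega> in M. \<forall>i. i \<ge> 1 \<longrightarrow> X i \<omega> = real (Z i \<omega>) - 1"
    unfolding AE_all_countable by (intro allI AE_impI)
  then show ?thesis by simp
qed

abbreviation word_event :: "nat \<Rightarrow> nat list \<Rightarrow> 'a set" where
  "word_event k w \<equiv> {\<omega> \<in> space M. prefix_word (\<lambda>i. Z i \<omega>) k = w}"

abbreviation hit_event :: "nat \<Rightarrow> nat \<Rightarrow> 'a set" where
  "hit_event k x \<equiv> {\<omega> \<in> space M. first_hit x (prefix_word (\<lambda>i. Z i \<omega>) k)}"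

lemma prob_prefix_word:
  assumes "length w = k"
  shows "prob (word_event k w) = prod_list (map pmass w)"
proof (cases "k = 0")
  case True
  then show ?thesis using assms by (simp add: prob_space)
next
  case False
  have indep_Z: "indep_vars (\<lambda>_. count_space UNIV) Z {1..}"
    unfolding Z_def by (rule indep_vars_compose2[OF indep]) measurable
  have "prefix_word (\<lambda>i. Z i \<omega>) k = w \<longleftrightarrow> (\<forall>j\<in>{1..k}. Z j \<omega> = w ! (j - 1))" for \<omega>
  proof -
    have "prefix_word (\<lambda>i. Z i \<omega>) k = w \<longleftrightarrow> (\<forall>i<k. Z (Suc i) \<omega> = w ! i)"
      using assms by (simp add: list_eq_iff_nth_eq del: upt_Suc)
    also have "\<dots> \<longleftrightarrow> (\<forall>j\<in>{1..k}. Z j \<omega> = w ! (j - 1))"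
    proof (intro iffI ballI allI impI)
      fix j assume "\<forall>i<k. Z (Suc i) \<omega> = w ! i" "j \<in> {1..k}"
      then show "Z j \<omega> = w ! (j - 1)" by (cases j) auto
    next
      fix i assume "\<forall>j\<in>{1..k}. Z j \<omega> = w ! (j - 1)" "i < k"
      then show "Z (Suc i) \<omega> = w ! i" by (auto dest: bspec[of _ _ "Suc i"])
    qed
    finally show ?thesis .
  qed
  then have "word_event k w = (\<Inter>j\<in>{1..k}. Z j -` {w ! (j - 1)} \<inter> space M)"
    using False by auto
  also have "prob \<dots> = (\<Prod>j\<in>{1..k}. prob (Z j -` {w ! (j - 1)} \<inter> space M))"
    using False by (intro indep_varsD[OF indep_Z]) auto
  also have "\<dots> = (\<Prod>j=1..k. pmass (w ! (j - 1)))" by (intro prod.cong refl prob_Z) auto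
  also have "\<dots> = (\<Prod>i<k. pmass (w ! i))"
    by (rule prod.reindex_bij_witness[of _ Suc "\<lambda>j. j - 1"]) auto
  also have "\<dots> = prod_list (map pmass w)"
    using assms by (simp add: prod.list_conv_set_nth atLeast0LessThan)
  finally show ?thesis .
qed

lemma prefix_word_measurable [measurable]:
  "word_event k w \<in> sets M"
proof (cases "length w = k")
  case True
  then have "word_event k w = {\<omega> \<in> space M. \<forall>i<k. Z (Suc i) \<omega> = w ! i}"
    by (simp add: list_eq_iff_nth_eq del: upt_Suc)
  also have "\<dots> \<in> sets M" by measurable
  finally show ?thesis .
next
  case False
  then have "word_event k w = {}" by (auto simp del: upt_Suc)
  then show ?thesis by (simp only: sets.empty_sets)
qed

lemma first_hit_event:
  "hit_event k x =
    (\<Union>w\<in>hit_words k x. word_event k w)"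
  unfolding hit_words_def by (auto simp del: upt_Suc)

lemma first_hit_event_measurable [measurable]:
  "hit_event k x \<in> sets M"
  unfolding first_hit_event by (intro sets.finite_UN finite_hit_words prefix_word_measurable)

lemma prob_first_hit: "prob (hit_event k x) = hit pmass k x"
proof -
  have "prob (hit_event k x) =
      (\<Sum>w\<in>hit_words k x. prob (word_event k w))"
    unfolding first_hit_event
  proof (rule finite_measure_finite_Union[OF finite_hit_words])
    show "word_event k ` hit_words k x \<subseteq> sets M"
      by (intro image_subsetI prefix_word_measurable)
  qed (auto simp: disjoint_family_on_def simp del: upt_Suc)
  also have "\<dots> = hit pmass k x"
    unfolding hit_def by (intro sum.cong refl prob_prefix_word) (simp add: hit_words_def)
  finally show ?thesis .
qed

text \<open>Almost surely survival up to \<open>n\<close> is the complement of the disjoint events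
  of first hitting at a time at most \<open>n\<close>. Starting from \<open>x \<ge> 1\<close>
  reconciles \<open>tau\<close>, which excludes time 0, with \<open>first_hit\<close>, which admits
  it.\<close>

lemma prob_tau_greater:
  assumes "x \<ge> 1"
  shows "prob {\<omega> \<in> space M. tau X (real x) \<omega> > enat n} = 1 - (\<Sum>k\<le>n. hit pmass k x)"
proof -
  let ?H = "\<Union>k\<in>{..n}. hit_event k x"
  have H: "?H \<in> sets M" by (intro sets.finite_UN first_hit_event_measurable) auto
  have T: "{\<omega> \<in> space M. tau X (real x) \<omega> > enat n} \<in> sets M"
    unfolding tau_greater_iff walk_def by measurable
  have "AE \<omega> in M. \<omega> \<in> {\<omega> \<in> space M. tau X (real x) \<omega> > enat n} \<longleftrightarrow> \<omega> \<in> space M - ?H"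
    using AE_X_eq AE_space
  proof eventually_elim
    case (elim \<omega>)
    have walk: "walk X k \<omega> = real (\<Sum>i=1..k. Z i \<omega>) - real k" for k
      unfolding walk_def using elim(1) by (simp add: sum_subtractf)
    have "x + (\<Sum>i=1..k. Z i \<omega>) \<le> k \<longleftrightarrow> real x + walk X k \<omega> \<le> 0" for k
      unfolding walk by linarith
    then have "(\<exists>k\<le>n. first_hit x (prefix_word (\<lambda>i. Z i \<omega>) k)) \<longleftrightarrow> (\<exists>k\<in>{1..n}. real x + walk X k \<omega> \<le> 0)"
      using ex_first_hit_prefix_iff[OF assms, of n "\<lambda>i. Z i \<omega>"] by simp
    then show ?case using elim(2) unfolding tau_greater_iff by (auto simp: not_le simp del: upt_Suc)
  qed
  then have "prob {\<omega> \<in> space M. tau X (real x) \<omega> > enat n} = prob (space M - ?H)"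
    using T H by (intro finite_measure_eq_AE) auto
  also have "\<dots> = 1 - prob ?H" by (rule prob_compl[OF H])
  also have "prob ?H = (\<Sum>k\<le>n. prob (hit_event k x))"
  proof (rule finite_measure_finite_Union)
    show "(\<lambda>k. hit_event k x) ` {..n} \<subseteq> sets M"
      by (intro image_subsetI first_hit_event_measurable)
    show "disjoint_family_on (\<lambda>k. hit_event k x) {..n}"
      unfolding disjoint_family_on_def using first_hit_prefix_unique by blast
  qed simp
  finally show ?thesis by (simp only: prob_first_hit)
qed

text \<open>Carries the moment assumptions on the first step over to series in the point masses,
  where the argument on words takes place.\<close>

lemma expectation_sums:
  fixes g :: "real \<Rightarrow> real"
  assumes [measurable]: "g \<in> borel_measurable borel" and int: "integrable M (\<lambda>\<omega>. g (X 1 \<omega>))"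
  shows "(\<lambda>m. pmass m * g (real m - 1)) sums expectation (\<lambda>\<omega>. g (X 1 \<omega>))"
proof -
  let ?D = "distr M (count_space UNIV) (Z 1)"
  have D: "?D = density (count_space UNIV) (\<lambda>m. ennreal (pmass m))"
  proof (rule measure_eqI_countable[where A=UNIV])
    fix m :: nat
    have "emeasure ?D {m} = ennreal (pmass m)"
      by (subst emeasure_distr) (auto simp: emeasure_eq_measure prob_Z)
    then show "emeasure ?D {m} = emeasure (density (count_space UNIV) (\<lambda>m. ennreal (pmass m))) {m}"
      by (simp add: emeasure_density nn_integral_count_space_indicator)
  qed auto
  have AE: "AE \<omega> in M. g (X 1 \<omega>) = g (real (Z 1 \<omega>) - 1)" using AE_X_eq by eventually_elim simp
  have m: "(\<lambda>\<omega>. g (real (Z 1 \<omega>) - 1)) \<in> borel_measurable M" by measurable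
  have "integrable M (\<lambda>\<omega>. g (real (Z 1 \<omega>) - 1))"
    using int AE m by (subst integrable_cong_AE[symmetric]) auto
  then have "integrable ?D (\<lambda>m. g (real m - 1))" by (subst integrable_distr_eq) auto
  then have int': "integrable (count_space UNIV) (\<lambda>m. pmass m *\<^sub>R g (real m - 1))"
    unfolding D by (subst (asm) integrable_density) (auto simp: pmass_def)
  have "expectation (\<lambda>\<omega>. g (X 1 \<omega>)) = expectation (\<lambda>\<omega>. g (real (Z 1 \<omega>) - 1))"
    using AE m by (intro integral_cong_AE) auto
  also have "\<dots> = (\<integral>m. g (real m - 1) \<partial>?D)" by (subst integral_distr) auto
  also have "\<dots> = (\<integral>m. pmass m *\<^sub>R g (real m - 1) \<partial>count_space UNIV)"
    unfolding D by (subst integral_density) (auto simp: pmass_def)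
  finally show ?thesis using sums_integral_count_space_nat[OF int'] by simp
qed

lemma AE_pmass_pos: "AE \<omega> in M. pmass (Z 1 \<omega>) > 0"
proof -
  have "AE \<omega> in M. pmass m = 0 \<longrightarrow> Z 1 \<omega> \<noteq> m" for m
  proof (cases "pmass m = 0")
    case True
    then have "prob {\<omega> \<in> space M. Z 1 \<omega> = m} = 0" by (simp add: pmass_def)
    then have "AE \<omega> in M. \<not> (Z 1 \<omega> = m)" by (subst (asm) prob_eq_0) auto
    then show ?thesis by simp
  qed simp
  then have "AE \<omega> in M. \<forall>m. pmass m = 0 \<longrightarrow> Z 1 \<omega> \<noteq> m" by (simp add: AE_all_countable)
  then show ?thesis
  proof eventually_elim
    case (elim \<omega>)
    then have "pmass (Z 1 \<omega>) \<noteq> 0" by blast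
    moreover have "pmass (Z 1 \<omega>) \<ge> 0" by (simp add: pmass_def)
    ultimately show ?case by simp
  qed
qed

text \<open>Mean zero with positive variance forces mass on both sides of 0; for a skip-free step
  the lower side is the single value -1.\<close>

lemma lattice_law_pmass:
  assumes "integrable M (X 1)" "expectation (X 1) = 0"
    and "integrable M (\<lambda>\<omega>. (X 1 \<omega>)\<^sup>2)" "expectation (\<lambda>\<omega>. (X 1 \<omega>)\<^sup>2) > 0"
    and "integrable M (\<lambda>\<omega>. \<bar>X 1 \<omega>\<bar> ^ (r + 3))"
  shows "lattice_law pmass (Gcd {m. pmass m > 0}) r"
proof -
  have nonneg: "pmass m \<ge> 0" for m by (simp add: pmass_def)
  have "(\<lambda>m. pmass m * 1) sums expectation (\<lambda>_. 1)"
    by (rule expectation_sums[where g="\<lambda>_. 1"]) auto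
  then have sums1: "pmass sums 1" by (simp add: prob_space)
  have "(\<lambda>m. pmass m * (real m - 1)) sums expectation (\<lambda>\<omega>. X 1 \<omega>)"
    by (rule expectation_sums[where g="\<lambda>y. y"]) (measurable, rule assms(1))
  then have mean: "(\<lambda>m. pmass m * (real m - 1)) sums 0" unfolding assms(2) .
  have var: "(\<lambda>m. pmass m * (real m - 1)\<^sup>2) sums expectation (\<lambda>\<omega>. (X 1 \<omega>)\<^sup>2)"
    by (rule expectation_sums[where g="\<lambda>y. y\<^sup>2"]) (measurable, rule assms(3))
  have zero: "f m = 0" if "f sums 0" "\<And>m. f m \<ge> 0" for f :: "nat \<Rightarrow> real" and m
    using suminf_eq_zero_iff[OF sums_summable[OF that(1)] that(2)] sums_unique[OF that(1)] by metis
  \<comment> \<open>Without downward steps the mean would be a series of nonnegative terms with sum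
    zero; all terms vanish, and with them the variance.\<close>
  have p0: "pmass 0 > 0"
  proof (rule ccontr)
    assume "\<not> pmass 0 > 0"
    then have "pmass 0 = 0" using nonneg[of 0] by simp
    then have "pmass m * (real m - 1) \<ge> 0" for m using nonneg[of m] by (cases m) auto
    then have "pmass m * (real m - 1) = 0" for m using zero[OF mean] by blast
    then have "pmass m * (real m - 1)\<^sup>2 = 0" for m unfolding power2_eq_square mult.assoc[symmetric] by simp
    then have "(\<lambda>m. pmass m * (real m - 1)\<^sup>2) = (\<lambda>_. 0)" by (rule ext)
    then have "(\<lambda>m. pmass m * (real m - 1)\<^sup>2) sums 0" by (simp only: sums_zero)
    then show False using sums_unique2[OF var] assms(4) by fastforce
  qed
  have nondeg: "\<exists>m\<ge>2. pmass m > 0"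
  proof (rule ccontr)
    assume "\<not> ?thesis"
    then have z: "pmass m = 0" if "m \<ge> 2" for m
    proof -
      have "\<not> pmass m > 0" using that \<open>\<not> (\<exists>m\<ge>2. pmass m > 0)\<close> by blast
      then show ?thesis using nonneg[of m] by linarith
    qed
    have "- (pmass m * (real m - 1)) \<ge> 0" for m
    proof (cases "m \<ge> 2")
      case False
      then have "m = 0 \<or> m = 1" by auto
      then show ?thesis using nonneg[of 0] by auto
    qed (simp add: z)
    moreover have "(\<lambda>m. - (pmass m * (real m - 1))) sums 0" using sums_minus[OF mean] by simp
    ultimately have "- (pmass 0 * (real 0 - 1)) = 0" using zero[of "\<lambda>m. - (pmass m * (real m - 1))" 0] by simp
    then show False using p0 by simp
  qed
  show ?thesis
  proof
    show "(\<lambda>m. real m * pmass m) sums 1"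
    proof -
      have "pmass m * (real m - 1) + pmass m = real m * pmass m" for m by (simp add: algebra_simps)
      then show ?thesis using sums_add[OF mean sums1] by (simp only:) simp
    qed
    show "summable (\<lambda>m. pmass m * \<bar>real m - 1\<bar> ^ (r + 3))"
      by (rule sums_summable[OF expectation_sums[OF _ assms(5)]]) measurable
  qed (fact nonneg sums1 p0 nondeg refl)+
qed

text \<open>A gcd d \<ge> 2 would place the step almost surely in the class -1 + d k, against span
  one.\<close>

lemma span_one_Gcd:
  assumes "span_one M (X 1)" "Gcd {m. pmass m > 0} > 0"
  shows "Gcd {m. pmass m > 0} = 1"
proof (rule ccontr)
  define d where "d = Gcd {m. pmass m > 0}"
  assume "Gcd {m. pmass m > 0} \<noteq> 1"
  then have d: "int d \<ge> 2" using assms(2) unfolding d_def by linarith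
  let ?S = "{\<omega> \<in> space M. \<exists>k::int. X 1 \<omega> = of_int (-1 + int d * k)}"
  have "AE \<omega> in M. \<exists>k::int. X 1 \<omega> = of_int (-1 + int d * k)"
    using AE_X_eq AE_pmass_pos
  proof eventually_elim
    case (elim \<omega>)
    have "d dvd Z 1 \<omega>" unfolding d_def using elim(2) by (intro Gcd_dvd) simp
    then obtain k where "Z 1 \<omega> = d * k" by (elim dvdE)
    then have "X 1 \<omega> = of_int (-1 + int d * int k)" using elim(1) by simp
    then show ?case by blast
  qed
  note ae = this
  have m: "?S \<in> sets M" by measurable
  have "prob ?S = 1"
    by (rule iffD2[OF prob_Collect_eq_1[OF m] ae])
  then show False using assms(1) d unfolding span_one_def by blast
qed

end

text \<open>The start is an integer \<open>x \<ge> 1\<close>: \<open>tau\<close> excludes time 0, so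
  a walk started at 0 survives with positive probability, whereas the polynomials built here vanish
  at 0. From \<open>r = 2\<close> on, span one excludes oscillation of the tail with the residue of
  n - x.\<close>

theorem theorem2:
  fixes M :: "'a measure" and X :: "nat \<Rightarrow> 'a \<Rightarrow> real" and r :: nat
  assumes "prob_space M"
    and "prob_space.indep_vars M (\<lambda>_. borel) X {1..}"
    and "\<forall>i\<ge>1. distr M borel (X i) = distr M borel (X 1)"
    and "integrable M (X 1)" and "integral\<^sup>L M (X 1) = 0"
    and "integrable M (\<lambda>\<omega>. (X 1 \<omega>)\<^sup>2)" and "integral\<^sup>L M (\<lambda>\<omega>. (X 1 \<omega>)\<^sup>2) > 0"
    and "measure M {\<omega> \<in> space M. \<exists>k::int. k \<ge> -1 \<and> X 1 \<omega> = of_int k} = 1"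
    and "integrable M (\<lambda>\<omega>. \<bar>X 1 \<omega>\<bar> ^ (r + 3))"
    and "r \<ge> 2 \<longrightarrow> span_one M (X 1)"
  shows "\<exists>V :: nat \<Rightarrow> real poly.
    (\<forall>k\<in>{1..r div 2 + 1}. degree (V k) = 2 * k - 1) \<and>
    (\<exists>C. \<forall>\<^sub>F n in sequentially. \<forall>x::nat. x \<ge> 1 \<longrightarrow>
       \<bar>measure M {\<omega> \<in> space M. tau X (real x) \<omega> > enat n}
          - (\<Sum>j=1..r div 2 + 1. poly (V j) (real x) * acoeff j n)\<bar>
       \<le> C * ((1 + real x ^ (r + 2)) / real n powr (real (r + 2) / 2)))"
proof -
  interpret prob_space M by (rule assms(1))
  interpret skip_free_walk M X
  proof
    show "distr M borel (X i) = distr M borel (X 1)" if "i \<ge> 1" for i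
      using assms(3) that by blast
  qed (fact assms(2) assms(8))+
  define d where "d = Gcd {m. pmass m > 0}"
  interpret L: lattice_law pmass d r
    unfolding d_def by (rule lattice_law_pmass) (fact assms)+
  have "d = 1 \<or> r \<le> 1"
  proof (cases "r \<ge> 2")
    case True
    then have "span_one M (X 1)" using assms(10) by (rule rev_mp)
    from span_one_Gcd[OF this L.d_pos[unfolded d_def]] show ?thesis unfolding d_def ..
  qed simp
  then obtain V :: "nat \<Rightarrow> real poly" and C N where
    V: "\<And>j. j \<in> {1..r div 2 + 1} \<Longrightarrow> degree (V j) = 2 * j - 1" and
    bound: "\<And>n x. n \<ge> N \<Longrightarrow> \<bar>(1 - (\<Sum>k\<le>n. hit pmass k x)) - (\<Sum>j=1..r div 2 + 1. poly (V j) (real x) * acoeff j n)\<bar>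
      \<le> C * ((1 + real x ^ (r + 2)) / real n powr (real (r + 2) / 2))"
    by (rule L.tail_expansion) (rule that)
  show ?thesis
  proof (intro exI conjI ballI)
    show "degree (V k) = 2 * k - 1" if "k \<in> {1..r div 2 + 1}" for k
      using that by (rule V)
    show "\<forall>\<^sub>F n in sequentially. \<forall>x::nat. x \<ge> 1 \<longrightarrow>
       \<bar>measure M {\<omega> \<in> space M. tau X (real x) \<omega> > enat n}
          - (\<Sum>j=1..r div 2 + 1. poly (V j) (real x) * acoeff j n)\<bar>
       \<le> C * ((1 + real x ^ (r + 2)) / real n powr (real (r + 2) / 2))"
    proof (rule eventually_mono[OF eventually_ge_at_top[of N]], intro allI impI)
      fix n x :: nat assume "n \<ge> N" "x \<ge> 1"
      then show "\<bar>measure M {\<omega> \<in> space M. tau X (real x) \<omega> > enat n}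
          - (\<Sum>j=1..r div 2 + 1. poly (V j) (real x) * acoeff j n)\<bar>
        \<le> C * ((1 + real x ^ (r + 2)) / real n powr (real (r + 2) / 2))"
        using bound[of n x] by (simp only: prob_tau_greater)
    qed
  qed
qed

end
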